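(* Let $\mathfrak{g}$ be a finite dimensional complex simple Lie algebra of dimension $d$ and let $\ell\in\mathbb{C}$ with $\ell\neq -h^\vee$. Fix an orthonormal basis $\{u^1,\dots,u^d\}$ of $\mathfrak{g}$ with respect to $\langle\cdot,\cdot\rangle$ and write $\mathbf{u}(-1)=[u^1(-1),\dots,u^d(-1)]$ (a row vector). Then each element $\omega'\in \operatorname{Ker}L(1)\cap V_{\widehat{\mathfrak{g}}}(\ell,0)_2$ corresponds to a unique symmetric $d\times d$ complex matrix $A=(a_{ij})$ such that $$\omega'=\mathbf{u}(-1)A\,\mathbf{u}(-1)^{tr}\mathbf{1}=\sum_{i,j=1}^d a_{ij}u^i(-1)u^j(-1)\mathbf{1}.$$ Equivalently, $\operatorname{Ker}L(1)\cap V_{\widehat{\mathfrak{g}}}(\ell,0)_2$ is isomorphic, as a $G$-module, to the space of all quadratic forms on $\mathfrak{g}^*$.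
   Context: $\langle\cdot,\cdot\rangle$ is the normalized Killing form on $\mathfrak{g}$ and $h^\vee$ is the dual Coxeter number. $\widehat{\mathfrak{g}}=\mathfrak{g}\otimes\mathbb{C}[t,t^{-1}]\oplus\mathbb{C}K$ is the affine Lie algebra, with $a(n)=a\otimes t^n$, $K$ central and $[a(n),b(m)]=[a,b](n+m)+n\delta_{n+m,0}\langle a,b\rangle K$. $V_{\widehat{\mathfrak{g}}}(\ell,0)=U(\widehat{\mathfrak{g}})\otimes_{U(\mathfrak{g}\otimes\mathbb{C}[t]\oplus\mathbb{C}K)}\mathbb{C}_\ell$ is the universal affine vertex operator algebra of level $\ell$ (where $\mathfrak{g}\otimes\mathbb{C}[t]$ acts by $0$ and $K$ by $\ell$ on $\mathbb{C}_\ell=\mathbb{C}\mathbf{1}$), with $Y(a(-1)\mathbf{1},z)=\sum_n a(n)z^{-n-1}$ and conformal vector $\omega=\frac{1}{2(\ell+h^\vee)}\sum_{i=1}^d u^i(-1)u^i(-1)\mathbf{1}$. Write $Y(\omega,z)=\sum_n L(n)z^{-n-2}$; $V_{\widehat{\mathfrak{g}}}(\ell,0)_n$ is the $L(0)$-eigenspace of eigenvalue $n$. $G$ is the adjoint algebraic group of $\mathfrak{g}$, acting on $V_{\widehat{\mathfrak{g}}}(\ell,0)$ by $g(a^{1}(-n_1)\cdots a^{r}(-n_r)\mathbf{1})=g(a^{1})(-n_1)\cdots g(a^{r})(-n_r)\mathbf{1}$, and naturally on quadratic forms on $\mathfrak{g}^*$. *)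

theory Defs
  imports
    "HOL-Analysis.Analysis"
    "HOL-Library.Poly_Mapping"
    "HOL-Library.Groups_Big_Fun"
    "HOL-Library.Function_Algebras"
begin

section \<open>Complex Lie algebras\<close>

locale lie_algebra = vector_space scale
  for scale :: "complex \<Rightarrow> 'g::ab_group_add \<Rightarrow> 'g" (infixr \<open>*s\<close> 75) +
  fixes br :: "'g \<Rightarrow> 'g \<Rightarrow> 'g"
  assumes br_add_left: "br (x + y) z = br x z + br y z"
    and br_scale_left: "br (c *s x) z = c *s br x z"
    and br_add_right: "br x (y + z) = br x y + br x z"
    and br_scale_right: "br x (c *s z) = c *s br x z"
    and br_self: "br x x = 0"
    and br_jacobi: "br x (br y z) + br y (br z x) + br z (br x y) = 0"
begin

definition lie_ideal :: "'g set \<Rightarrow> bool" where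
  "lie_ideal I \<longleftrightarrow> subspace I \<and> (\<forall>x. \<forall>y\<in>I. br x y \<in> I)"

text \<open>The trace is taken in the basis \<open>extend_basis {}\<close> chosen by the library; it is meaningful
  when the space is finite dimensional, and then does not depend on the basis.\<close>

definition trace_of :: "('g \<Rightarrow> 'g) \<Rightarrow> complex" where
  "trace_of f = (\<Sum>b\<in>extend_basis {}. representation (extend_basis {}) (f b) b)"

definition killing :: "'g \<Rightarrow> 'g \<Rightarrow> complex" where
  "killing x y = trace_of (\<lambda>z. br x (br y z))"

definition diagonalizable :: "('g \<Rightarrow> 'g) \<Rightarrow> bool" where
  "diagonalizable f \<longleftrightarrow> span {v. \<exists>c. f v = c *s v} = UNIV"

text \<open>Cartan subalgebras of a semisimple Lie algebra: abelian, equal to their own centralizer,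
  and consisting of ad-diagonalizable elements.\<close>

definition cartan_subalgebra :: "'g set \<Rightarrow> bool" where
  "cartan_subalgebra H \<longleftrightarrow>
     subspace H \<and>
     (\<forall>x\<in>H. \<forall>y\<in>H. br x y = 0) \<and>
     (\<forall>x. (\<forall>h\<in>H. br h x = 0) \<longrightarrow> x \<in> H) \<and>
     (\<forall>h\<in>H. diagonalizable (br h))"

definition root_space :: "'g set \<Rightarrow> ('g \<Rightarrow> complex) \<Rightarrow> 'g set" where
  "root_space H \<alpha> = {x. \<forall>h\<in>H. br h x = \<alpha> h *s x}"

text \<open>A functional on \<open>H\<close> is represented by the function on the whole Lie algebra that extends it
  by \<open>0\<close> outside \<open>H\<close> (such an extension is not linear on the Lie algebra). Linearity on \<open>H\<close> of a
  root is automatic, since its root space is nonzero.\<close>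

definition roots :: "'g set \<Rightarrow> ('g \<Rightarrow> complex) set" where
  "roots H = {\<alpha>. (\<forall>x. x \<notin> H \<longrightarrow> \<alpha> x = 0) \<and> (\<exists>h\<in>H. \<alpha> h \<noteq> 0) \<and> root_space H \<alpha> \<noteq> {0}}"

definition nonneg_combinations :: "('g \<Rightarrow> complex) set \<Rightarrow> ('g \<Rightarrow> complex) set" where
  "nonneg_combinations \<Delta> =
     {\<beta>. \<exists>n :: ('g \<Rightarrow> complex) \<Rightarrow> nat. \<beta> = (\<lambda>h. \<Sum>\<alpha>\<in>\<Delta>. of_nat (n \<alpha>) * \<alpha> h)}"

definition root_base :: "'g set \<Rightarrow> ('g \<Rightarrow> complex) set \<Rightarrow> bool" where
  "root_base H \<Delta> \<longleftrightarrow>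
     finite \<Delta> \<and> \<Delta> \<subseteq> roots H \<and>
     (\<forall>c :: ('g \<Rightarrow> complex) \<Rightarrow> complex.
        (\<forall>h. (\<Sum>\<alpha>\<in>\<Delta>. c \<alpha> * \<alpha> h) = 0) \<longrightarrow> (\<forall>\<alpha>\<in>\<Delta>. c \<alpha> = 0)) \<and>
     (\<forall>\<beta>\<in>roots H. \<beta> \<in> nonneg_combinations \<Delta> \<or> (\<lambda>h. - \<beta> h) \<in> nonneg_combinations \<Delta>)"

definition positive_roots :: "'g set \<Rightarrow> ('g \<Rightarrow> complex) set \<Rightarrow> ('g \<Rightarrow> complex) set" where
  "positive_roots H \<Delta> = roots H \<inter> nonneg_combinations \<Delta>"

definition highest_root :: "'g set \<Rightarrow> ('g \<Rightarrow> complex) set \<Rightarrow> ('g \<Rightarrow> complex) \<Rightarrow> bool" where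
  "highest_root H \<Delta> \<theta> \<longleftrightarrow>
     \<theta> \<in> roots H \<and> (\<forall>\<beta>\<in>roots H. (\<lambda>h. \<theta> h - \<beta> h) \<in> nonneg_combinations \<Delta>)"

text \<open>The normalized Killing form is the multiple of the Killing form for which the highest root
  has square length \<open>2\<close> in the induced form on the dual of \<open>H\<close>, that is \<open>\<langle>t, t\<rangle> = 2\<close> for the
  element \<open>t\<close> of \<open>H\<close> representing \<open>\<theta>\<close>.\<close>

definition normalized_killing_form ::
    "'g set \<Rightarrow> ('g \<Rightarrow> complex) \<Rightarrow> ('g \<Rightarrow> 'g \<Rightarrow> complex) \<Rightarrow> bool" where
  "normalized_killing_form H \<theta> form \<longleftrightarrow>
     (\<exists>c. \<forall>x y. form x y = c * killing x y) \<and>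
     (\<exists>t\<in>H. (\<forall>h\<in>H. form t h = \<theta> h) \<and> form t t = 2)"

definition coroot :: "'g set \<Rightarrow> ('g \<Rightarrow> complex) \<Rightarrow> 'g" where
  "coroot H \<alpha> = (THE h.
     h \<in> span {br x y | x y. x \<in> root_space H \<alpha> \<and> y \<in> root_space H (\<lambda>h. - \<alpha> h)} \<and> \<alpha> h = 2)"

text \<open>\<open>1 + \<rho>(\<theta>\<^sup>\<or>)\<close>, where \<open>\<rho>\<close> is half the sum of the positive roots.\<close>

definition dual_coxeter_number ::
    "'g set \<Rightarrow> ('g \<Rightarrow> complex) set \<Rightarrow> ('g \<Rightarrow> complex) \<Rightarrow> complex" where
  "dual_coxeter_number H \<Delta> \<theta> = 1 + (\<Sum>\<alpha>\<in>positive_roots H \<Delta>. \<alpha> (coroot H \<theta>)) / 2"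

definition orthonormal_basis :: "('g \<Rightarrow> 'g \<Rightarrow> complex) \<Rightarrow> ('d \<Rightarrow> 'g) \<Rightarrow> bool" where
  "orthonormal_basis form u \<longleftrightarrow>
     inj u \<and> independent (range u) \<and> span (range u) = UNIV \<and>
     (\<forall>i j. form (u i) (u j) = (if i = j then 1 else 0))"

definition lie_automorphisms :: "('g \<Rightarrow> 'g) set" where
  "lie_automorphisms =
     {\<sigma>. Vector_Spaces.linear scale scale \<sigma> \<and> bij \<sigma> \<and> (\<forall>x y. \<sigma> (br x y) = br (\<sigma> x) (\<sigma> y))}"

text \<open>Polynomials in the matrix coefficients of a linear map.\<close>

inductive_set polynomial_functions :: "(('g \<Rightarrow> 'g) \<Rightarrow> complex) set" where
  const: "(\<lambda>_. c) \<in> polynomial_functions"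
| coefficient: "Vector_Spaces.linear scale (*) \<xi> \<Longrightarrow> (\<lambda>\<sigma>. \<xi> (\<sigma> x)) \<in> polynomial_functions"
| add: "p \<in> polynomial_functions \<Longrightarrow> q \<in> polynomial_functions \<Longrightarrow>
    (\<lambda>\<sigma>. p \<sigma> + q \<sigma>) \<in> polynomial_functions"
| mult: "p \<in> polynomial_functions \<Longrightarrow> q \<in> polynomial_functions \<Longrightarrow>
    (\<lambda>\<sigma>. p \<sigma> * q \<sigma>) \<in> polynomial_functions"

definition zariski_topology :: "('g \<Rightarrow> 'g) topology" where
  "zariski_topology = topology_generated_by {{\<sigma>. p \<sigma> \<noteq> 0} | p. p \<in> polynomial_functions}"

text \<open>The adjoint algebraic group of a semisimple Lie algebra: the identity component of the
  algebraic group of its automorphisms.\<close>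

definition adjoint_group :: "('g \<Rightarrow> 'g) set" where
  "adjoint_group =
     connected_component_of_set (subtopology zariski_topology lie_automorphisms) id"

end

locale simple_lie_algebra = lie_algebra +
  assumes finite_dimensional: "\<exists>B. finite B \<and> span B = UNIV"
    and nonabelian: "\<exists>x y. br x y \<noteq> 0"
    and simple: "lie_ideal I \<Longrightarrow> I = {0} \<or> I = UNIV"


section \<open>Induced modules\<close>

text \<open>Let \<open>P\<close> be a subalgebra of the Lie algebra \<open>L\<close> and \<open>M\<close> a \<open>P\<close>-module. As a vector space,
  \<open>U(L) \<otimes>\<^bsub>U(P)\<^esub> M\<close> is generated by the symbols \<open>x\<^sub>1\<cdots>x\<^sub>r \<otimes> m\<close>, here the pairs \<open>([x\<^sub>1, \<dots>, x\<^sub>r], m)\<close>,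
  subject to the following relations: multilinearity in the letters and \<open>xy - yx = [x, y]\<close>
  inside a word (which define \<open>U(L)\<close>), linearity in \<open>m\<close>, and the passage of elements of \<open>P\<close> across
  the tensor sign. The free vector space on the symbols consists of the finitely supported
  functions on pairs.\<close>

abbreviation symb :: "'l list \<Rightarrow> 'm \<Rightarrow> ('l list \<times> 'm) \<Rightarrow>\<^sub>0 complex" where
  "symb w m \<equiv> Poly_Mapping.single (w, m) 1"

definition free_scale :: "complex \<Rightarrow> ('x \<Rightarrow>\<^sub>0 complex) \<Rightarrow> ('x \<Rightarrow>\<^sub>0 complex)" where
  "free_scale c F = Poly_Mapping.map ((*) c) F"

inductive_set induced_relations ::
    "(complex \<Rightarrow> 'l::ab_group_add \<Rightarrow> 'l) \<Rightarrow> ('l \<Rightarrow> 'l \<Rightarrow> 'l) \<Rightarrow> 'l set \<Rightarrow>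
     (complex \<Rightarrow> 'm::ab_group_add \<Rightarrow> 'm) \<Rightarrow> ('l \<Rightarrow> 'm \<Rightarrow> 'm) \<Rightarrow>
     (('l list \<times> 'm) \<Rightarrow>\<^sub>0 complex) set"
  for scaleL brL P scaleM actM where
  letter_add:
    "symb (v @ [x + y] @ w) m - symb (v @ [x] @ w) m - symb (v @ [y] @ w) m
       \<in> induced_relations scaleL brL P scaleM actM"
| letter_scale:
    "symb (v @ [scaleL c x] @ w) m - free_scale c (symb (v @ [x] @ w) m)
       \<in> induced_relations scaleL brL P scaleM actM"
| bracket:
    "symb (v @ [x, y] @ w) m - symb (v @ [y, x] @ w) m - symb (v @ [brL x y] @ w) m
       \<in> induced_relations scaleL brL P scaleM actM"
| vector_add:
    "symb w (m + n) - symb w m - symb w n \<in> induced_relations scaleL brL P scaleM actM"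
| vector_scale:
    "symb w (scaleM c m) - free_scale c (symb w m) \<in> induced_relations scaleL brL P scaleM actM"
| balanced:
    "p \<in> P \<Longrightarrow>
     symb (w @ [p]) m - symb w (actM p m) \<in> induced_relations scaleL brL P scaleM actM"

text \<open>The vector space \<open>V\<close> together with the action \<open>act\<close> of \<open>L\<close> and the map \<open>tens\<close>, standing for
  \<open>(x\<^sub>1\<cdots>x\<^sub>r, m) \<mapsto> x\<^sub>1\<cdots>x\<^sub>r \<otimes> m\<close>, is a realization of \<open>U(L) \<otimes>\<^bsub>U(P)\<^esub> M\<close>: the linear extension
  of \<open>tens\<close> to the free vector space is surjective, its kernel is spanned by the relations, and
  \<open>L\<close> acts by left multiplication.\<close>

definition induced_module ::
    "(complex \<Rightarrow> 'l::ab_group_add \<Rightarrow> 'l) \<Rightarrow> ('l \<Rightarrow> 'l \<Rightarrow> 'l) \<Rightarrow> 'l set \<Rightarrow>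
     (complex \<Rightarrow> 'm::ab_group_add \<Rightarrow> 'm) \<Rightarrow> ('l \<Rightarrow> 'm \<Rightarrow> 'm) \<Rightarrow>
     (complex \<Rightarrow> 'v::ab_group_add \<Rightarrow> 'v) \<Rightarrow> ('l \<Rightarrow> 'v \<Rightarrow> 'v) \<Rightarrow> ('l list \<Rightarrow> 'm \<Rightarrow> 'v) \<Rightarrow> bool" where
  "induced_module scaleL brL P scaleM actM scaleV act tens \<longleftrightarrow>
     vector_space scaleV \<and>
     module.span scaleV {tens w m | w m. True} = UNIV \<and>
     (\<forall>F. (\<Sum>(w, m)\<in>Poly_Mapping.keys F. scaleV (Poly_Mapping.lookup F (w, m)) (tens w m)) = 0 \<longleftrightarrow>
          F \<in> module.span free_scale (induced_relations scaleL brL P scaleM actM)) \<and>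
     (\<forall>x. Vector_Spaces.linear scaleV scaleV (act x)) \<and>
     (\<forall>x w m. act x (tens w m) = tens (x # w) m)"


section \<open>Affine Lie algebras and universal affine vertex algebras\<close>

text \<open>The pair \<open>(f, c)\<close> stands for \<open>\<Sum>\<^sub>n f\<^sub>n \<otimes> t\<^sup>n + c K\<close>.\<close>

type_synonym 'g affine = "(int \<Rightarrow>\<^sub>0 'g) \<times> complex"

definition affine_scale ::
    "(complex \<Rightarrow> 'g::ab_group_add \<Rightarrow> 'g) \<Rightarrow> complex \<Rightarrow> 'g affine \<Rightarrow> 'g affine" where
  "affine_scale scaleG c = (\<lambda>(f, a). (Poly_Mapping.map (scaleG c) f, c * a))"

definition affine_br ::
    "('g::ab_group_add \<Rightarrow> 'g \<Rightarrow> 'g) \<Rightarrow> ('g \<Rightarrow> 'g \<Rightarrow> complex) \<Rightarrow>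
     'g affine \<Rightarrow> 'g affine \<Rightarrow> 'g affine" where
  "affine_br br form = (\<lambda>(f, a) (g, b).
     ((\<Sum>n\<in>Poly_Mapping.keys f. \<Sum>m\<in>Poly_Mapping.keys g.
         Poly_Mapping.single (n + m) (br (Poly_Mapping.lookup f n) (Poly_Mapping.lookup g m))),
      (\<Sum>n\<in>Poly_Mapping.keys f. \<Sum>m\<in>Poly_Mapping.keys g.
         if n + m = 0 then of_int n * form (Poly_Mapping.lookup f n) (Poly_Mapping.lookup g m) else 0)))"

definition mode :: "'g::ab_group_add \<Rightarrow> int \<Rightarrow> 'g affine" where
  "mode a n = (Poly_Mapping.single n a, 0)"

definition affine_nonneg :: "'g::ab_group_add affine set" where
  "affine_nonneg = {(f, c). \<forall>n\<in>Poly_Mapping.keys f. n \<ge> 0}"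

definition universal_affine_module ::
    "(complex \<Rightarrow> 'g::ab_group_add \<Rightarrow> 'g) \<Rightarrow> ('g \<Rightarrow> 'g \<Rightarrow> 'g) \<Rightarrow> ('g \<Rightarrow> 'g \<Rightarrow> complex) \<Rightarrow> complex \<Rightarrow>
     (complex \<Rightarrow> 'v::ab_group_add \<Rightarrow> 'v) \<Rightarrow> ('g affine \<Rightarrow> 'v \<Rightarrow> 'v) \<Rightarrow> ('g affine list \<Rightarrow> complex \<Rightarrow> 'v) \<Rightarrow>
     bool" where
  "universal_affine_module scaleG br form lev scaleV act tens \<longleftrightarrow>
     induced_module (affine_scale scaleG) (affine_br br form) affine_nonneg
       (*) (\<lambda>(f, c) z. c * lev * z) scaleV act tens"

text \<open>\<open>Y u n v\<close> is \<open>u\<^sub>n v\<close>, where \<open>Y(u, z) = \<Sum>\<^sub>n u\<^sub>n z\<^sup>-\<^sup>n\<^sup>-\<^sup>1\<close>. The last condition is the Jacobi identity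
  in components (Borcherds identity); by truncation its sums have only finitely many nonzero terms.\<close>

definition vertex_algebra ::
    "(complex \<Rightarrow> 'v::ab_group_add \<Rightarrow> 'v) \<Rightarrow> 'v \<Rightarrow> ('v \<Rightarrow> int \<Rightarrow> 'v \<Rightarrow> 'v) \<Rightarrow> bool" where
  "vertex_algebra scaleV vac Y \<longleftrightarrow>
     vector_space scaleV \<and>
     (\<forall>u n. Vector_Spaces.linear scaleV scaleV (Y u n)) \<and>
     (\<forall>n v. Vector_Spaces.linear scaleV scaleV (\<lambda>u. Y u n v)) \<and>
     (\<forall>u v. \<exists>N. \<forall>n\<ge>N. Y u n v = 0) \<and>
     (\<forall>n v. Y vac n v = (if n = - 1 then v else 0)) \<and>
     (\<forall>u. Y u (- 1) vac = u \<and> (\<forall>n\<ge>0. Y u n vac = 0)) \<and>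
     (\<forall>u v w k m n.
        Sum_any (\<lambda>i. scaleV (of_int m gchoose i) (Y (Y u (k + int i) v) (m + n - int i) w)) =
        Sum_any (\<lambda>i. scaleV ((- 1) ^ i * (of_int k gchoose i))
          (Y u (m + k - int i) (Y v (n + int i) w)
           - scaleV ((- 1) powi k) (Y v (n + k - int i) (Y u (m + int i) w)))))"

definition conformal_vector ::
    "(complex \<Rightarrow> 'v::ab_group_add \<Rightarrow> 'v) \<Rightarrow> ('g::ab_group_add affine \<Rightarrow> 'v \<Rightarrow> 'v) \<Rightarrow> 'v \<Rightarrow>
     ('d::finite \<Rightarrow> 'g) \<Rightarrow> complex \<Rightarrow> complex \<Rightarrow> 'v" where
  "conformal_vector scaleV act vac u lev h =
     scaleV (1 / (2 * (lev + h)))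
       (\<Sum>i\<in>UNIV. act (mode (u i) (- 1)) (act (mode (u i) (- 1)) vac))"

definition virasoro_mode :: "('v \<Rightarrow> int \<Rightarrow> 'v \<Rightarrow> 'v) \<Rightarrow> 'v \<Rightarrow> int \<Rightarrow> 'v \<Rightarrow> 'v" where
  "virasoro_mode Y \<omega> n = Y \<omega> (n + 1)"

text \<open>The vector \<open>a\<^sup>1(-n\<^sub>1)\<cdots>a\<^sup>r(-n\<^sub>r)\<one>\<close> for the list \<open>[(a\<^sup>1, n\<^sub>1), \<dots>, (a\<^sup>r, n\<^sub>r)]\<close>.\<close>

definition monomial_vector ::
    "('g::ab_group_add affine \<Rightarrow> 'v \<Rightarrow> 'v) \<Rightarrow> 'v \<Rightarrow> ('g \<times> nat) list \<Rightarrow> 'v" where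
  "monomial_vector act vac w = foldr (\<lambda>(a, n). act (mode a (- int n))) w vac"

definition acts_on_monomials ::
    "('g \<Rightarrow> 'g) set \<Rightarrow> (complex \<Rightarrow> 'v::ab_group_add \<Rightarrow> 'v) \<Rightarrow> ('g::ab_group_add affine \<Rightarrow> 'v \<Rightarrow> 'v) \<Rightarrow> 'v \<Rightarrow>
     (('g \<Rightarrow> 'g) \<Rightarrow> 'v \<Rightarrow> 'v) \<Rightarrow> bool" where
  "acts_on_monomials G scaleV act vac \<rho> \<longleftrightarrow>
     (\<forall>\<sigma>\<in>G. Vector_Spaces.linear scaleV scaleV (\<rho> \<sigma>) \<and>
       (\<forall>w. (\<forall>(a, n)\<in>set w. n \<ge> 1) \<longrightarrow>
          \<rho> \<sigma> (monomial_vector act vac w) =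
          monomial_vector act vac (map (\<lambda>(a, n). (\<sigma> a, n)) w)))"


section \<open>Quadratic forms on the dual space\<close>

definition dual_space ::
    "(complex \<Rightarrow> 'g::ab_group_add \<Rightarrow> 'g) \<Rightarrow> ('g \<Rightarrow> complex) set" where
  "dual_space scaleG = {\<xi>. Vector_Spaces.linear scaleG (*) \<xi>}"

text \<open>A quadratic form on the dual space is extended by \<open>0\<close> to all functions, so that it is
  determined by its values on the dual space.\<close>

definition quadratic_forms ::
    "(complex \<Rightarrow> 'g::ab_group_add \<Rightarrow> 'g) \<Rightarrow> (('g \<Rightarrow> complex) \<Rightarrow> complex) set" where
  "quadratic_forms scaleG = {q.
     (\<forall>\<xi>. \<xi> \<notin> dual_space scaleG \<longrightarrow> q \<xi> = 0) \<and>
     (\<forall>c. \<forall>\<xi>\<in>dual_space scaleG. q (\<lambda>x. c * \<xi> x) = c\<^sup>2 * q \<xi>) \<and>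
     (\<exists>B. (\<forall>\<xi>\<in>dual_space scaleG. \<forall>\<eta>\<in>dual_space scaleG.
             B \<xi> \<eta> = q (\<lambda>x. \<xi> x + \<eta> x) - q \<xi> - q \<eta>) \<and>
          (\<forall>\<xi>\<in>dual_space scaleG. \<forall>\<xi>'\<in>dual_space scaleG. \<forall>\<eta>\<in>dual_space scaleG.
             B (\<lambda>x. \<xi> x + \<xi>' x) \<eta> = B \<xi> \<eta> + B \<xi>' \<eta> \<and>
             B \<eta> (\<lambda>x. \<xi> x + \<xi>' x) = B \<eta> \<xi> + B \<eta> \<xi>') \<and>
          (\<forall>c. \<forall>\<xi>\<in>dual_space scaleG. \<forall>\<eta>\<in>dual_space scaleG.
             B (\<lambda>x. c * \<xi> x) \<eta> = c * B \<xi> \<eta> \<and> B \<eta> (\<lambda>x. c * \<xi> x) = c * B \<eta> \<xi>))}"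

definition dual_action :: "('g \<Rightarrow> 'g) \<Rightarrow> ('g \<Rightarrow> complex) \<Rightarrow> ('g \<Rightarrow> complex)" where
  "dual_action \<sigma> \<xi> = \<xi> \<circ> inv \<sigma>"

definition quadratic_action ::
    "('g \<Rightarrow> 'g) \<Rightarrow> (('g \<Rightarrow> complex) \<Rightarrow> complex) \<Rightarrow> (('g \<Rightarrow> complex) \<Rightarrow> complex)" where
  "quadratic_action \<sigma> q = q \<circ> dual_action (inv \<sigma>)"

definition function_scale :: "complex \<Rightarrow> ('a \<Rightarrow> complex) \<Rightarrow> ('a \<Rightarrow> complex)" where
  "function_scale c q = (\<lambda>\<xi>. c * q \<xi>)"

definition stable_subspace ::
    "'s set \<Rightarrow> (complex \<Rightarrow> 'v::ab_group_add \<Rightarrow> 'v) \<Rightarrow> ('s \<Rightarrow> 'v \<Rightarrow> 'v) \<Rightarrow> 'v set \<Rightarrow> bool" where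
  "stable_subspace G scaleV \<rho> W \<longleftrightarrow>
     module.subspace scaleV W \<and> (\<forall>\<sigma>\<in>G. \<forall>v\<in>W. \<rho> \<sigma> v \<in> W)"

definition isomorphic_modules ::
    "'s set \<Rightarrow>
     (complex \<Rightarrow> 'v::ab_group_add \<Rightarrow> 'v) \<Rightarrow> ('s \<Rightarrow> 'v \<Rightarrow> 'v) \<Rightarrow> 'v set \<Rightarrow>
     (complex \<Rightarrow> 'w::ab_group_add \<Rightarrow> 'w) \<Rightarrow> ('s \<Rightarrow> 'w \<Rightarrow> 'w) \<Rightarrow> 'w set \<Rightarrow> bool" where
  "isomorphic_modules G scaleV \<rho> V scaleW \<tau> W \<longleftrightarrow>
     stable_subspace G scaleV \<rho> V \<and> stable_subspace G scaleW \<tau> W \<and>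
     (\<exists>\<phi>. bij_betw \<phi> V W \<and>
        (\<forall>x\<in>V. \<forall>y\<in>V. \<phi> (x + y) = \<phi> x + \<phi> y) \<and>
        (\<forall>c. \<forall>x\<in>V. \<phi> (scaleV c x) = scaleW c (\<phi> x)) \<and>
        (\<forall>\<sigma>\<in>G. \<forall>x\<in>V. \<phi> (\<rho> \<sigma> x) = \<tau> \<sigma> (\<phi> x)))"

end

theory Submission
  imports Defs
begin

text \<open>Why the theorem holds. The space of weight two is spanned by the vectors \<open>b(-2)\<one>\<close> and
  \<open>a(-1)b(-1)\<one>\<close>, and \<open>a(-1)b(-1)\<one> - b(-1)a(-1)\<one> = [a,b](-2)\<one>\<close>; hence each of its elements is the sum
  of a quadratic vector \<open>\<Sum> a\<^sub>i\<^sub>j u\<^sup>i(-1)u\<^sup>j(-1)\<one>\<close> with symmetric matrix and of some \<open>b(-2)\<one>\<close>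
  (\<open>weight_2_decomposition\<close>). The operator \<open>L(1)\<close> kills the first summand, as it sends
  \<open>a(-1)b(-1)\<one>\<close> to \<open>[a,b](-1)\<one>\<close>, and sends the second one to \<open>2b(-1)\<one>\<close>. If that vanishes, then so does
  \<open>b(-2)\<one> = L(-1)b(-1)\<one>\<close>. The kernel of \<open>L(1)\<close> therefore consists of the symmetric quadratic vectors
  (\<open>quasi_primary_weight_2\<close>). Sending such a vector to the quadratic form
  \<open>\<xi> \<mapsto> \<Sum> a\<^sub>i\<^sub>j \<xi>(u\<^sup>i)\<xi>(u\<^sup>j)\<close> commutes with the group, since an automorphism changes the
  matrix in the same way on both sides.

  Two steps carry the weight of this argument.

  The first one is that \<open>L(n)\<close> satisfies \<open>[L(n), a(m)] = -m a(m+n)\<close>. By the commutator formula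
  only the vectors \<open>a(i)\<omega>\<close> with \<open>i \<ge> 0\<close> matter, and all of them vanish except \<open>a(1)\<omega>\<close>, which equals
  \<open>a(-1)\<one>\<close> precisely because the Casimir element acts on the adjoint module by twice the dual
  Coxeter number. Pairing the Casimir element with the form turns this into the identity
  \<open>killing = 2 h form\<close>. It suffices to compare both sides on root vectors \<open>x\<close>, \<open>y\<close> of weights
  \<open>\<theta>\<close> and \<open>-\<theta>\<close>. In the trace of \<open>ad x ad y\<close>, the root space of a positive root \<open>\<alpha>\<close> contributes
  \<open>\<alpha>(\<theta>\<^sup>\<or>)\<close>, the Cartan subalgebra contributes 2 and the negative root spaces contribute 0
  (\<open>killing_highest_root_vectors\<close>). Here every root counts once, since root spaces are lines; this
  and \<open>\<alpha>(t\<^sub>\<alpha>) \<noteq> 0\<close> follow from the fact that a commutator has trace zero on any subspace stable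
  under both factors.

  The second step is that a quadratic vector determines its symmetric matrix, at every level. In
  place of a basis of monomials, this uses one family of linear functionals on the module. The
  vacuum expectation value of a word in the affine Lie algebra can be computed by commuting the
  positive modes to the right; taking this as a recursive definition yields a functional that
  respects the relations of the induced module (\<open>expectation_bracket\<close>, \<open>expectation_vacuum\<close>), at any level. The matrix
  elements of \<open>u\<^sup>p(1)u\<^sup>q(1)\<close> at the given level \<open>\<ell>\<close> may be degenerate. But \<open>\<ell> = k + l\<close> with \<open>k\<close> and \<open>l\<close>
  nonzero, and the diagonal map into two copies of the affine Lie algebra, of levels \<open>k\<close> and \<open>l\<close>,
  allows one to apply \<open>u\<^sup>p(1)\<close> in the first copy and \<open>u\<^sup>q(1)\<close> in the second. This gives
  \<open>k l (a\<^sub>p\<^sub>q + a\<^sub>q\<^sub>p)\<close>, which recovers a symmetric matrix (\<open>quadratic_vector_inj\<close>).\<close>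

section \<open>Traces and eigenvectors\<close>

(* The product symbol for scalars and vectors of fixed dimension is reused below for scalar
   multiplication in an abstract vector space. *)
no_notation vector_scalar_mult (infixl "*s" 70)

definition basis_trace ::
    "('a::field \<Rightarrow> 'b::ab_group_add \<Rightarrow> 'b) \<Rightarrow> 'b set \<Rightarrow> ('b \<Rightarrow> 'b) \<Rightarrow> 'a" where
  "basis_trace s B f = (\<Sum>b\<in>B. module.representation s B (f b) b)"

context vector_space
begin

lemma representation_linear_image:
  assumes B: "finite B" "independent B" and C: "finite C" "independent C"
    and f: "Vector_Spaces.linear scale scale f" "f ` B \<subseteq> span C" and v: "v \<in> span B"
  shows "representation C (f v) c = (\<Sum>b\<in>B. representation B v b * representation C (f b) c)"
proof -
  interpret f: Vector_Spaces.linear scale scale f by fact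
  have "f v = f (\<Sum>b\<in>B. representation B v b *s b)"
    using sum_representation_eq[OF B(2) v B(1)] by simp
  also have "\<dots> = (\<Sum>b\<in>B. representation B v b *s f b)" by (simp add: f.sum f.scale)
  finally have "representation C (f v) c = representation C (\<Sum>b\<in>B. representation B v b *s f b) c"
    by (rule arg_cong)
  also have "\<dots> = (\<Sum>b\<in>B. representation C (representation B v b *s f b) c)"
    using f by (subst representation_sum[OF C(2)]) (auto intro: span_scale)
  also have "\<dots> = (\<Sum>b\<in>B. representation B v b * representation C (f b) c)"
    using f by (intro sum.cong refl, subst representation_scale[OF C(2)]) auto
  finally show ?thesis .
qed

lemma linear_image_span:
  assumes "Vector_Spaces.linear scale scale f" "f ` B \<subseteq> span C" "v \<in> span B"
  shows "f v \<in> span C"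
proof -
  interpret f: Vector_Spaces.linear scale scale f by fact
  show ?thesis using f.span_image[of B] assms(2,3) span_minimal[OF assms(2)] by auto
qed

text \<open>The double sum over matrix entries of \<open>f\<close> and \<open>g\<close> is symmetric. Allowing two different bases
  covers both the cyclicity of the trace and, with \<open>f\<close> the identity, its independence of the
  basis. Only a subspace is traced over: \<open>B\<close> and \<open>C\<close> need not span the whole space.\<close>

lemma basis_trace_swap:
  assumes B: "finite B" "independent B" and C: "finite C" "independent C"
    and f: "Vector_Spaces.linear scale scale f" "f ` B \<subseteq> span C"
    and g: "Vector_Spaces.linear scale scale g" "g ` C \<subseteq> span B"
  shows "basis_trace scale B (\<lambda>v. g (f v)) = basis_trace scale C (\<lambda>v. f (g v))"
proof -
  have "basis_trace scale B (\<lambda>v. g (f v)) =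
      (\<Sum>b\<in>B. \<Sum>c\<in>C. representation C (f b) c * representation B (g c) b)"
    unfolding basis_trace_def using f
    by (intro sum.cong refl representation_linear_image[OF C B g]) auto
  also have "\<dots> = (\<Sum>c\<in>C. \<Sum>b\<in>B. representation B (g c) b * representation C (f b) c)"
    by (subst sum.swap) (simp add: mult.commute)
  also have "\<dots> = basis_trace scale C (\<lambda>v. f (g v))"
    unfolding basis_trace_def using g
    by (intro sum.cong refl representation_linear_image[OF B C f, symmetric]) auto
  finally show ?thesis .
qed

lemma basis_trace_basis_independent:
  assumes B: "finite B" "independent B" and C: "finite C" "independent C"
    and span: "span B = span C"
    and f: "Vector_Spaces.linear scale scale f" "f ` B \<subseteq> span B"
  shows "basis_trace scale B f = basis_trace scale C f"
proof -
  have id: "Vector_Spaces.linear scale scale (\<lambda>x. x)" by (rule linear_ident)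
  have "basis_trace scale B (\<lambda>v. (\<lambda>x. x) (f v)) = basis_trace scale C (\<lambda>v. f ((\<lambda>x. x) v))"
    using f span span_base by (intro basis_trace_swap B C f id) auto
  then show ?thesis by simp
qed

lemma basis_trace_add:
  assumes "independent B" "f ` B \<subseteq> span B" "g ` B \<subseteq> span B"
  shows "basis_trace scale B (\<lambda>v. f v + g v) = basis_trace scale B f + basis_trace scale B g"
  unfolding basis_trace_def sum.distrib[symmetric] using assms
  by (intro sum.cong refl) (simp add: representation_add image_subset_iff)

lemma basis_trace_diff:
  assumes "independent B" "f ` B \<subseteq> span B" "g ` B \<subseteq> span B"
  shows "basis_trace scale B (\<lambda>v. f v - g v) = basis_trace scale B f - basis_trace scale B g"
  unfolding basis_trace_def sum_subtractf[symmetric] using assms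
  by (intro sum.cong refl) (simp add: representation_diff image_subset_iff)

lemma basis_trace_scale:
  assumes "independent B" "f ` B \<subseteq> span B"
  shows "basis_trace scale B (\<lambda>v. c *s f v) = c * basis_trace scale B f"
  unfolding basis_trace_def sum_distrib_left using assms
  by (intro sum.cong refl) (simp add: representation_scale image_subset_iff)

text \<open>The tool that replaces the representation theory of \<open>sl\<^sub>2\<close> in the study of roots: the subspace
  spanned by \<open>B\<close> only has to be stable under both factors.\<close>

lemma basis_trace_commutator:
  assumes B: "finite B" "independent B"
    and f: "Vector_Spaces.linear scale scale f" "f ` B \<subseteq> span B"
    and g: "Vector_Spaces.linear scale scale g" "g ` B \<subseteq> span B"
  shows "basis_trace scale B (\<lambda>v. f (g v) - g (f v)) = 0"
proof -
  have "f (g b) \<in> span B" "g (f b) \<in> span B" if "b \<in> B" for b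
    using linear_image_span[OF f, of "g b"] linear_image_span[OF g, of "f b"] that f(2) g(2) by auto
  then show ?thesis
    by (subst basis_trace_diff) (auto simp: B basis_trace_swap[OF B B f g])
qed

lemma basis_trace_eigenbasis:
  assumes "independent B" "\<And>b. b \<in> B \<Longrightarrow> f b = \<mu> b *s b"
  shows "basis_trace scale B f = (\<Sum>b\<in>B. \<mu> b)"
  unfolding basis_trace_def using assms
  by (intro sum.cong refl) (simp add: representation_scale span_base representation_basis)

text \<open>Applying \<open>T - k\<^sub>0\<close> removes the component of eigenvalue \<open>k\<^sub>0\<close> and multiplies the others by nonzero
  scalars, so that induction on the number of components applies. The consequence of interest is
  that \<open>T\<close> stays diagonalizable on stable subspaces.\<close>

lemma eigen_components_in_invariant_subspace:
  assumes T: "Vector_Spaces.linear scale scale T" and W: "subspace W" "\<And>w. w \<in> W \<Longrightarrow> T w \<in> W"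
  shows "finite K \<Longrightarrow> (\<And>k. k \<in> K \<Longrightarrow> T (x k) = k *s x k) \<Longrightarrow> (\<Sum>k\<in>K. x k) \<in> W \<Longrightarrow>
    \<forall>k\<in>K. x k \<in> W"
proof (induction K arbitrary: x rule: finite_induct)
  case empty
  then show ?case by simp
next
  case (insert k0 K)
  interpret T: Vector_Spaces.linear scale scale T by fact
  let ?v = "\<Sum>k\<in>insert k0 K. x k"
  let ?y = "\<lambda>k. (k - k0) *s x k"
  have "T ?v - k0 *s ?v = (\<Sum>k\<in>insert k0 K. ?y k)"
    unfolding T.sum scale_sum_right sum_subtractf[symmetric] using insert.prems(1)
    by (intro sum.cong refl) (simp add: scale_left_diff_distrib)
  also have "\<dots> = (\<Sum>k\<in>K. ?y k)" using insert.hyps by simp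
  finally have "(\<Sum>k\<in>K. ?y k) \<in> W"
    using subspace_diff[OF W(1) W(2)[OF insert.prems(2)] subspace_scale[OF W(1) insert.prems(2), of k0]]
    by (simp only:)
  moreover have "T (?y k) = k *s ?y k" if "k \<in> K" for k
    using insert.prems(1)[of k] that by (simp add: T.scale mult.commute)
  ultimately have y: "\<forall>k\<in>K. ?y k \<in> W" using insert.IH[of ?y] by blast
  have x: "x k \<in> W" if "k \<in> K" for k
  proof -
    have "k \<noteq> k0" using that insert.hyps by auto
    then have "inverse (k - k0) *s ?y k = x k" by simp
    then show ?thesis using subspace_scale[OF W(1), of "?y k" "inverse (k - k0)"] y that by metis
  qed
  have "x k0 = ?v - (\<Sum>k\<in>K. x k)" using insert.hyps by simp
  then have "x k0 \<in> W"
    using subspace_diff[OF W(1) insert.prems(2) subspace_sum[OF W(1), of K x]] x by simp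
  then show ?case using x by auto
qed

lemma eigenvector_decomposition:
  assumes T: "Vector_Spaces.linear scale scale T"
    and v: "v \<in> span E" and E: "\<And>e. e \<in> E \<Longrightarrow> T e = \<mu> e *s e"
  obtains K x where "finite K" "\<And>k. k \<in> K \<Longrightarrow> x k \<in> span {e\<in>E. \<mu> e = k}"
    "\<And>k. k \<in> K \<Longrightarrow> T (x k) = k *s x k" "v = (\<Sum>k\<in>K. x k)"
proof -
  obtain t r where t: "finite t" "t \<subseteq> E" "v = (\<Sum>a\<in>t. r a *s a)"
    using v unfolding span_explicit by auto
  interpret T: Vector_Spaces.linear scale scale T by fact
  define x where "x k = (\<Sum>a\<in>{a\<in>t. \<mu> a = k}. r a *s a)" for k
  have "v = (\<Sum>k\<in>\<mu> ` t. x k)"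
    unfolding x_def t(3) using t(1) by (rule sum.image_gen)
  moreover have "x k \<in> span {e\<in>E. \<mu> e = k}" for k
    unfolding x_def using t by (intro span_sum span_scale span_base) auto
  moreover have "T (x k) = k *s x k" for k
    unfolding x_def using E t(2)
    by (auto simp: T.sum T.scale scale_sum_right mult.commute intro!: sum.cong)
  ultimately show ?thesis using that[of "\<mu> ` t" x] t(1) by auto
qed

lemma eigenspace_of_span:
  assumes T: "Vector_Spaces.linear scale scale T"
    and E: "\<And>e. e \<in> E \<Longrightarrow> T e = \<mu> e *s e" and v: "v \<in> span E" "T v = c *s v"
  shows "v \<in> span {e\<in>E. \<mu> e = c}"
proof -
  interpret T: Vector_Spaces.linear scale scale T by fact
  obtain K x where K: "finite K" "\<And>k. k \<in> K \<Longrightarrow> x k \<in> span {e\<in>E. \<mu> e = k}"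
    "\<And>k. k \<in> K \<Longrightarrow> T (x k) = k *s x k" "v = (\<Sum>k\<in>K. x k)"
    by (rule eigenvector_decomposition[OF T v(1) E]) auto
  let ?W = "{w. T w = c *s w}"
  have "\<forall>k\<in>K. x k \<in> ?W"
  proof (rule eigen_components_in_invariant_subspace[OF T _ _ K(1,3)])
    show "subspace ?W" by (rule subspaceI) (auto simp: T.add T.scale scale_right_distrib mult.commute)
    show "T w \<in> ?W" if "w \<in> ?W" for w using that by (auto simp: T.scale)
    show "(\<Sum>k\<in>K. x k) \<in> ?W" using K(4) v(2) by auto
  qed auto
  then have "x k = 0" if "k \<in> K" "k \<noteq> c" for k
    using K(3)[of k] that by simp
  then have "x k \<in> span {e\<in>E. \<mu> e = c}" if "k \<in> K" for k
    using K(2)[of k] that span_zero by (cases "k = c") auto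
  then show ?thesis unfolding K(4) by (rule span_sum)
qed

end

section \<open>Lie algebras with an invariant form\<close>

context lie_algebra
begin

lemma linear_br: "Vector_Spaces.linear scale scale (br x)"
  by unfold_locales (auto simp: br_add_right br_scale_right)

lemma br_zero_right [simp]: "br x 0 = 0"
  using br_scale_right[of x 0 0] by simp

lemma br_zero_left [simp]: "br 0 x = 0"
  using br_scale_left[of 0 0 x] by simp

lemma br_swap: "br y x = - br x y"
proof -
  have "br y x + br x y = br (x + y) (x + y)"
    by (simp add: br_add_left br_add_right br_self[of x] br_self[of y] add.commute)
  then have "br y x + br x y = 0" by (simp only: br_self)
  then show ?thesis by (rule eq_neg_iff_add_eq_0[THEN iffD2])
qed

lemma br_minus_left: "br (- x) y = - br x y"
  using br_scale_left[of "-1" x y] by simp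

lemma br_minus_right: "br x (- y) = - br x y"
  using br_scale_right[of x "-1" y] by simp

lemma br_diff_left: "br (x - y) z = br x z - br y z"
  using br_add_left[of x "- y" z] by (simp add: br_minus_left)

lemma br_diff_right: "br x (y - z) = br x y - br x z"
  using br_add_right[of x y "- z"] by (simp add: br_minus_right)

lemma br_br: "br (br x y) z = br x (br y z) - br y (br x z)"
proof -
  have "br x (br y z) + br y (br z x) + br z (br x y) = 0" by (rule br_jacobi)
  then have "br x (br y z) - br y (br x z) - br (br x y) z = 0"
    by (simp add: br_swap[of x z] br_swap[of "br x y" z] br_minus_right)
  then show ?thesis by (simp add: algebra_simps)
qed

lemma linear_br_br: "Vector_Spaces.linear scale scale (\<lambda>z. br x (br y z))"
  by unfold_locales (auto simp: br_add_right br_scale_right)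

end

locale invariant_form_lie_algebra = lie_algebra scale br
  for scale :: "complex \<Rightarrow> 'g::ab_group_add \<Rightarrow> 'g" (infixr \<open>*s\<close> 75)
    and br :: "'g \<Rightarrow> 'g \<Rightarrow> 'g" +
  fixes form :: "'g \<Rightarrow> 'g \<Rightarrow> complex"
  assumes form_add_left: "form (x + y) z = form x z + form y z"
    and form_scale_left: "form (c *s x) z = c * form x z"
    and form_sym: "form x y = form y x"
    and form_invariant: "form (br x y) z = form x (br y z)"
begin

lemma form_add_right: "form z (x + y) = form z x + form z y"
  using form_add_left[of x y z] by (simp add: form_sym)

lemma form_scale_right: "form z (c *s x) = c * form z x"
  using form_scale_left[of c x z] by (simp add: form_sym)

lemma form_zero_left [simp]: "form 0 x = 0"
  using form_scale_left[of 0 0 x] by simp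

lemma form_zero_right [simp]: "form x 0 = 0"
  using form_sym[of x 0] by simp

lemma form_minus_left: "form (- x) y = - form x y"
  using form_scale_left[of "-1" x y] by simp

lemma form_minus_right: "form x (- y) = - form x y"
  using form_scale_right[of x "-1" y] by simp

lemma form_diff_right: "form x (y - z) = form x y - form x z"
  using form_add_right[of x "y - z" z] by simp

lemma form_sum_left: "form (\<Sum>i\<in>I. f i) y = (\<Sum>i\<in>I. form (f i) y)"
  by (induction I rule: infinite_finite_induct) (auto simp: form_add_left)

lemma form_sum_right: "form y (\<Sum>i\<in>I. f i) = (\<Sum>i\<in>I. form y (f i))"
  by (induction I rule: infinite_finite_induct) (auto simp: form_add_right)

end

section \<open>Invariance of the Killing form\<close>

context simple_lie_algebra
begin

lemma independent_imp_finite: "independent B \<Longrightarrow> finite B"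
  using finite_dimensional independent_span_bound by (metis subset_UNIV)

lemma chosen_basis:
  shows "independent (extend_basis {})" "span (extend_basis {}) = UNIV" "finite (extend_basis {})"
  using independent_extend_basis[OF independent_empty] span_extend_basis[OF independent_empty]
    independent_imp_finite by auto

lemma trace_of_eq_basis_trace:
  assumes "independent B" "span B = UNIV" "Vector_Spaces.linear scale scale f"
  shows "trace_of f = basis_trace scale B f"
  unfolding trace_of_def basis_trace_def[symmetric]
  by (rule basis_trace_basis_independent)
    (use assms in \<open>auto simp: chosen_basis independent_imp_finite\<close>)

lemma trace_of_swap:
  assumes "Vector_Spaces.linear scale scale f" "Vector_Spaces.linear scale scale g"
  shows "trace_of (\<lambda>v. f (g v)) = trace_of (\<lambda>v. g (f v))"
  unfolding trace_of_def basis_trace_def[symmetric]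
  by (rule basis_trace_swap)
    (use assms in \<open>auto simp: chosen_basis independent_imp_finite\<close>)

lemma trace_of_add: "trace_of (\<lambda>v. f v + g v) = trace_of f + trace_of g"
  unfolding trace_of_def basis_trace_def[symmetric]
  by (rule basis_trace_add) (auto simp: chosen_basis)

lemma trace_of_diff: "trace_of (\<lambda>v. f v - g v) = trace_of f - trace_of g"
  unfolding trace_of_def basis_trace_def[symmetric]
  by (rule basis_trace_diff) (auto simp: chosen_basis)

lemma trace_of_scale: "trace_of (\<lambda>v. c *s f v) = c * trace_of f"
  unfolding trace_of_def basis_trace_def[symmetric]
  by (rule basis_trace_scale) (auto simp: chosen_basis)

lemma killing_add_left: "killing (x + y) z = killing x z + killing y z"
  unfolding killing_def by (simp add: br_add_left trace_of_add)

lemma killing_scale_left: "killing (c *s x) z = c * killing x z"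
  unfolding killing_def by (simp add: br_scale_left trace_of_scale)

lemma killing_sym: "killing x y = killing y x"
  unfolding killing_def by (rule trace_of_swap[OF linear_br linear_br])

lemma killing_invariant: "killing (br x y) z = killing x (br y z)"
proof -
  have "trace_of (\<lambda>v. br y (br x (br z v))) = trace_of (\<lambda>v. br x (br z (br y v)))"
    by (rule trace_of_swap[OF linear_br linear_br_br])
  then show ?thesis
    unfolding killing_def by (simp add: br_br br_diff_right trace_of_diff)
qed

end

section \<open>Root spaces\<close>

locale normalized_lie_algebra = simple_lie_algebra scale br
  for scale :: "complex \<Rightarrow> 'g::ab_group_add \<Rightarrow> 'g" (infixr \<open>*s\<close> 75)
    and br :: "'g \<Rightarrow> 'g \<Rightarrow> 'g" +
  fixes H :: "'g set" and \<Delta> :: "('g \<Rightarrow> complex) set" and \<theta> :: "'g \<Rightarrow> complex"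
    and form :: "'g \<Rightarrow> 'g \<Rightarrow> complex" and u :: "'d::finite \<Rightarrow> 'g"
  assumes cartan: "cartan_subalgebra H"
    and base: "root_base H \<Delta>"
    and highest: "highest_root H \<Delta> \<theta>"
    and normalized: "normalized_killing_form H \<theta> form"
    and orthonormal: "orthonormal_basis form u"
begin

lemma form_multiple_of_killing:
  obtains c where "c \<noteq> 0" "\<forall>x y. form x y = c * killing x y"
proof -
  obtain c t where c: "\<forall>x y. form x y = c * killing x y" and t: "form t t = 2"
    using normalized unfolding normalized_killing_form_def by blast
  then have "c \<noteq> 0" by auto
  then show ?thesis using that c by blast
qed

sublocale invariant_form_lie_algebra scale br form
proof unfold_locales
  obtain c where "c \<noteq> 0" and c': "\<forall>x y. form x y = c * killing x y"
    by (rule form_multiple_of_killing)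
  note c = c'[rule_format]
  show "form (x + y) z = form x z + form y z" "form (c' *s x) z = c' * form x z"
    "form x y = form y x" "form (br x y) z = form x (br y z)" for x y z c'
    unfolding c by (simp_all add: killing_add_left killing_scale_left killing_sym[of x y] killing_invariant
        distrib_left)
qed

lemma form_basis: "form (u i) (u j) = (if i = j then 1 else 0)"
  and inj_basis: "inj u" and independent_basis: "independent (range u)"
  and span_basis: "span (range u) = UNIV"
  using orthonormal unfolding orthonormal_basis_def by auto

lemma basis_expansion: "v = (\<Sum>i\<in>UNIV. form v (u i) *s u i)"
proof -
  have "v \<in> span (range u)" using span_basis by simp
  then obtain r where "v = (\<Sum>b\<in>range u. r b *s b)"
    using span_finite[of "range u"] by auto
  then have v: "v = (\<Sum>i\<in>UNIV. r (u i) *s u i)"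
    using sum.reindex[OF inj_basis, of "\<lambda>b. r b *s b"] by simp
  have "form v (u j) = r (u j)" for j
    by (subst v) (simp add: form_sum_left form_scale_left form_basis if_distrib sum.delta cong: if_cong)
  then show ?thesis using v by simp
qed

lemma representation_basis_eq: "representation (range u) v (u i) = form v (u i)"
proof -
  have "representation (range u) v (u i) = (\<Sum>j\<in>UNIV. form v (u j) * (if u i = u j then 1 else 0))"
    by (subst basis_expansion[of v])
      (simp add: representation_sum representation_scale representation_basis independent_basis
        span_basis)
  also have "\<dots> = form v (u i)"
    using inj_basis by (simp add: inj_eq if_distrib cong: if_cong)
  finally show ?thesis .
qed

lemma form_nondegenerate: "(\<And>y. form x y = 0) \<Longrightarrow> x = 0"
  using basis_expansion[of x] by simp

lemma killing_eq_basis_sum: "killing a b = (\<Sum>i\<in>UNIV. form (br a (br b (u i))) (u i))"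
proof -
  have "killing a b = basis_trace scale (range u) (\<lambda>z. br a (br b z))"
    unfolding killing_def
    by (rule trace_of_eq_basis_trace[OF independent_basis span_basis linear_br_br])
  also have "\<dots> = (\<Sum>i\<in>UNIV. form (br a (br b (u i))) (u i))"
    unfolding basis_trace_def by (simp add: sum.reindex[OF inj_basis] representation_basis_eq)
  finally show ?thesis .
qed

text \<open>Moving one factor of the Casimir element to the other argument of the form leaves the trace of
  \<open>ad a ad b\<close> in an orthonormal basis.\<close>

lemma form_casimir: "form a (\<Sum>i\<in>UNIV. br (br b (u i)) (u i)) = killing a b"
  by (simp add: killing_eq_basis_sum form_sum_right form_invariant)

lemma casimir_scalar:
  assumes "\<And>x y. killing x y = k * form x y"
  shows "(\<Sum>i\<in>UNIV. br (br b (u i)) (u i)) = k *s b"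
proof -
  have "form ((\<Sum>i\<in>UNIV. br (br b (u i)) (u i)) - k *s b) a = 0" for a
    by (subst form_sym) (simp add: form_diff_right form_casimir assms form_scale_right)
  then show ?thesis using form_nondegenerate by fastforce
qed

lemma subspace_H: "subspace H"
  and abelian_H: "\<And>x y. x \<in> H \<Longrightarrow> y \<in> H \<Longrightarrow> br x y = 0"
  and centralizer_H: "\<And>x. (\<And>h. h \<in> H \<Longrightarrow> br h x = 0) \<Longrightarrow> x \<in> H"
  and diagonalizable_H: "\<And>h. h \<in> H \<Longrightarrow> span {v. \<exists>c. br h v = c *s v} = UNIV"
  using cartan unfolding cartan_subalgebra_def diagonalizable_def by blast+

text \<open>Commuting diagonalizable operators are simultaneously diagonalizable: the joint eigenspace of
  the operators from \<open>F\<close> through a given vector is stable under a further operator, hence contains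
  the components of that vector.\<close>

lemma joint_eigenvectors_span:
  assumes "finite F" "F \<subseteq> H"
  shows "span {v. \<forall>h\<in>F. \<exists>c. br h v = c *s v} = UNIV"
  using assms
proof (induction F rule: finite_induct)
  case empty
  then show ?case by simp
next
  case (insert h F)
  let ?J = "\<lambda>F. {v. \<forall>h\<in>F. \<exists>c. br h v = c *s v}"
  have "v \<in> span (?J (insert h F))" if "v \<in> ?J F" for v
  proof -
    have "\<forall>h'\<in>F. \<exists>c. br h' v = c *s v" using \<open>v \<in> ?J F\<close> by blast
    from bchoice[OF this] obtain w where w: "\<And>h'. h' \<in> F \<Longrightarrow> br h' v = w h' *s v" by blast
    define W where "W = {y. \<forall>h'\<in>F. br h' y = w h' *s y}"
    have W: "subspace W"
      unfolding W_def
      by (rule subspaceI) (auto simp: br_add_right br_scale_right scale_right_distrib mult.commute)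
    have inv: "br h y \<in> W" if "y \<in> W" for y
    proof -
      have "br h' (br h y) = w h' *s br h y" if "h' \<in> F" for h'
      proof -
        have "br (br h' h) y = 0" using abelian_H that insert.prems by auto
        then have "br h' (br h y) = br h (br h' y)" by (simp add: br_br)
        then show ?thesis using \<open>y \<in> W\<close> that by (simp add: W_def br_scale_right)
      qed
      then show ?thesis by (simp add: W_def)
    qed
    define \<mu> where "\<mu> e = (SOME c. br h e = c *s e)" for e
    have \<mu>: "br h e = \<mu> e *s e" if "e \<in> {v. \<exists>c. br h v = c *s v}" for e
      unfolding \<mu>_def using that by (metis (mono_tags) mem_Collect_eq someI_ex)
    have "v \<in> span {v. \<exists>c. br h v = c *s v}" using diagonalizable_H insert.prems by simp
    then obtain K x where "finite K" and
      "\<And>k. k \<in> K \<Longrightarrow> x k \<in> span {e \<in> {v. \<exists>c. br h v = c *s v}. \<mu> e = k}"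
      and eig: "\<And>k. k \<in> K \<Longrightarrow> br h (x k) = k *s x k" and v: "v = (\<Sum>k\<in>K. x k)"
      by (rule eigenvector_decomposition[OF linear_br _ \<mu>]) blast+
    have "\<forall>k\<in>K. x k \<in> W"
      by (rule eigen_components_in_invariant_subspace[OF linear_br W inv \<open>finite K\<close> eig])
        (use v w W_def in auto)
    then have "x k \<in> ?J (insert h F)" if "k \<in> K" for k
      using that eig unfolding W_def by auto
    then show ?thesis unfolding v by (intro span_sum span_base) auto
  qed
  then have "span (?J F) \<subseteq> span (?J (insert h F))"
    by (intro span_minimal) auto
  then show ?case using insert by auto
qed

definition weight_vector :: "'g \<Rightarrow> bool" where
  "weight_vector v \<longleftrightarrow> v \<noteq> 0 \<and> (\<exists>\<alpha>. v \<in> root_space H \<alpha>)"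

text \<open>The extension by 0 outside \<open>H\<close> is the one used for roots, so that \<open>weight v = \<alpha>\<close> is a
  meaningful equation between functions on the whole Lie algebra.\<close>

definition weight :: "'g \<Rightarrow> 'g \<Rightarrow> complex" where
  "weight v = (\<lambda>h. if h \<in> H then THE c. br h v = c *s v else 0)"

definition weight_basis :: "'g set \<Rightarrow> bool" where
  "weight_basis B \<longleftrightarrow> independent B \<and> span B = UNIV \<and> (\<forall>b\<in>B. weight_vector b)"

lemma weight_eq: "v \<in> root_space H \<alpha> \<Longrightarrow> v \<noteq> 0 \<Longrightarrow> h \<in> H \<Longrightarrow> weight v h = \<alpha> h"
  unfolding weight_def root_space_def by auto

lemma weight_outside: "h \<notin> H \<Longrightarrow> weight v h = 0"
  by (simp add: weight_def)

lemma weight_vector_root_space: "weight_vector v \<Longrightarrow> v \<in> root_space H (weight v)"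
  unfolding weight_vector_def using weight_eq by (fastforce simp: root_space_def)

lemma weight_vectors_span: "span {v. weight_vector v} = UNIV"
proof -
  obtain F where F: "F \<subseteq> H" "independent F" "H \<subseteq> span F"
    using maximal_independent_subset by blast
  have "v \<in> span {v. weight_vector v}" if "v \<in> {v. \<forall>h\<in>F. \<exists>c. br h v = c *s v}" for v
  proof (cases "v = 0")
    case False
    have "\<exists>c. br h v = c *s v" if "h \<in> span F" for h
      using that
    proof (induction h rule: span_induct_alt)
      case base
      show ?case by (auto intro: exI[of _ 0])
    next
      case (step a x y)
      then obtain d where "br y v = d *s v" by blast
      moreover obtain c where "br x v = c *s v"
        using \<open>v \<in> {v. \<forall>h\<in>F. \<exists>c. br h v = c *s v}\<close> step by auto
      ultimately have "br (a *s x + y) v = (a * c + d) *s v"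
        by (simp add: br_add_left br_scale_left scale_left_distrib)
      then show ?case by blast
    qed
    then have "\<forall>h\<in>H. \<exists>c. br h v = c *s v" using F by auto
    from bchoice[OF this] obtain \<alpha> where "\<forall>h\<in>H. br h v = \<alpha> h *s v" by blast
    then have "weight_vector v" using False by (auto simp: weight_vector_def root_space_def)
    then show ?thesis by (simp add: span_base)
  qed (simp add: span_zero)
  then have "span {v. \<forall>h\<in>F. \<exists>c. br h v = c *s v} \<subseteq> span {v. weight_vector v}"
    by (intro span_minimal) auto
  then show ?thesis
    using joint_eigenvectors_span[OF independent_imp_finite[OF F(2)] F(1)] by auto
qed

lemma weight_basis_extending:
  assumes "independent S" "\<And>s. s \<in> S \<Longrightarrow> weight_vector s"
  obtains B where "S \<subseteq> B" "weight_basis B"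
proof -
  obtain B where B: "S \<subseteq> B" "B \<subseteq> {v. weight_vector v}" "independent B" "{v. weight_vector v} \<subseteq> span B"
    using maximal_independent_subset_extend[of S "{v. weight_vector v}"] assms by blast
  have "span B = UNIV" using span_minimal[OF B(4)] weight_vectors_span by auto
  then show ?thesis using that B unfolding weight_basis_def by blast
qed

lemma weight_basisD:
  assumes "weight_basis B"
  shows "independent B" "span B = UNIV" "finite B" "\<And>b. b \<in> B \<Longrightarrow> b \<noteq> 0"
    "\<And>b. b \<in> B \<Longrightarrow> b \<in> root_space H (weight b)"
    "\<And>b h. b \<in> B \<Longrightarrow> h \<in> H \<Longrightarrow> br h b = weight b h *s b"
  using assms weight_vector_root_space independent_imp_finite unfolding weight_basis_def
  by (auto simp: weight_vector_def root_space_def)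

lemma root_space_in_span:
  assumes B: "weight_basis B" and x: "x \<in> root_space H \<alpha>"
  shows "x \<in> span {b\<in>B. \<forall>h\<in>H. weight b h = \<alpha> h}"
proof -
  let ?r = "representation B x"
  note D = weight_basisD[OF B]
  have "?r b *s b \<in> span {b\<in>B. \<forall>h\<in>H. weight b h = \<alpha> h}" if "b \<in> B" for b
  proof (cases "?r b = 0")
    case False
    have "weight b h = \<alpha> h" if h: "h \<in> H" for h
    proof -
      interpret l: Vector_Spaces.linear scale scale "br h" by (rule linear_br)
      have "representation B (br h x) b = (\<Sum>c\<in>B. ?r c * representation B (br h c) b)"
        by (rule representation_linear_image[OF D(3,1) D(3,1) linear_br]) (auto simp: D)
      also have "\<dots> = (\<Sum>c\<in>B. if c = b then ?r b * weight b h else 0)"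
        using \<open>b \<in> B\<close> h
        by (intro sum.cong refl) (simp add: D representation_scale representation_basis)
      also have "\<dots> = ?r b * weight b h" using \<open>b \<in> B\<close> D(3) by simp
      finally have "\<alpha> h * ?r b = ?r b * weight b h"
        using x h by (simp add: root_space_def representation_scale D)
      then show ?thesis using False by simp
    qed
    then show ?thesis using that by (intro span_scale span_base) auto
  qed (simp add: span_zero)
  then have "(\<Sum>b\<in>B. ?r b *s b) \<in> span {b\<in>B. \<forall>h\<in>H. weight b h = \<alpha> h}" by (rule span_sum)
  then show ?thesis using sum_representation_eq[of B x B] D by simp
qed

lemma subspace_root_space: "subspace (root_space H \<alpha>)"
  unfolding root_space_def
  by (rule subspaceI) (auto simp: br_add_right br_scale_right scale_right_distrib mult.commute)

lemma root_space_cong: "(\<And>h. h \<in> H \<Longrightarrow> \<alpha> h = \<beta> h) \<Longrightarrow> x \<in> root_space H \<alpha> \<Longrightarrow> x \<in> root_space H \<beta>"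
  by (simp add: root_space_def)

lemma br_root_spaces:
  assumes "x \<in> root_space H \<alpha>" "y \<in> root_space H \<beta>"
  shows "br x y \<in> root_space H (\<lambda>h. \<alpha> h + \<beta> h)"
proof -
  have "br h (br x y) = (\<alpha> h + \<beta> h) *s br x y" if "h \<in> H" for h
  proof -
    have "br h (br x y) = br (br h x) y + br x (br h y)" by (simp add: br_br)
    then show ?thesis using assms that
      by (simp add: root_space_def br_scale_left br_scale_right scale_left_distrib)
  qed
  then show ?thesis by (simp add: root_space_def)
qed

lemma root_space_zero: "(\<And>h. h \<in> H \<Longrightarrow> \<alpha> h = 0) \<Longrightarrow> root_space H \<alpha> = H"
  using centralizer_H abelian_H by (auto simp: root_space_def)

lemma form_root_spaces:
  assumes "x \<in> root_space H \<alpha>" "y \<in> root_space H \<beta>" "h \<in> H" "\<alpha> h + \<beta> h \<noteq> 0"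
  shows "form x y = 0"
proof -
  have "form (br x h) y = form x (br h y)" by (rule form_invariant)
  moreover have "br x h = - (\<alpha> h *s x)" "br h y = \<beta> h *s y"
    using assms br_swap[of x h] by (auto simp: root_space_def)
  ultimately have "(\<alpha> h + \<beta> h) * form x y = 0"
    by (simp add: form_minus_left form_scale_left form_scale_right distrib_right)
      (metis add.right_inverse)
  then show ?thesis using assms by simp
qed

text \<open>By invariance the form pairs the weight spaces of \<open>\<alpha>\<close> and \<open>\<beta>\<close> to zero unless \<open>\<alpha> + \<beta> = 0\<close> on
  \<open>H\<close>, so nondegeneracy leaves only the weight \<open>-\<alpha>\<close> to pair nontrivially with \<open>x\<close>.\<close>

lemma opposite_root_vector:
  assumes x: "x \<in> root_space H \<alpha>" "x \<noteq> 0"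
  obtains y where "y \<in> root_space H (\<lambda>h. - \<alpha> h)" "form x y = 1"
proof -
  obtain B where B: "weight_basis B"
    by (rule weight_basis_extending[OF independent_empty]) auto
  note D = weight_basisD[OF B]
  have "\<exists>b\<in>B. form x b \<noteq> 0"
  proof (rule ccontr)
    assume none: "\<not> ?thesis"
    have "form x z = 0" for z
    proof -
      have "form x z = form x (\<Sum>b\<in>B. representation B z b *s b)"
        using sum_representation_eq[of B z B] D by simp
      also have "\<dots> = 0" using none by (simp add: form_sum_right form_scale_right)
      finally show ?thesis .
    qed
    then show False using form_nondegenerate x by blast
  qed
  then obtain b where b: "b \<in> B" "form x b \<noteq> 0" by blast
  have "weight b h = - \<alpha> h" if "h \<in> H" for h
    using form_root_spaces[OF x(1) D(5)[OF b(1)] that] b(2)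
    unfolding eq_neg_iff_add_eq_0 add.commute[of "weight b h"] by blast
  then have "b \<in> root_space H (\<lambda>h. - \<alpha> h)"
    by (rule root_space_cong[OF _ D(5)[OF b(1)]])
  then have "(1 / form x b) *s b \<in> root_space H (\<lambda>h. - \<alpha> h)"
    by (rule subspace_scale[OF subspace_root_space])
  then show ?thesis by (rule that) (simp add: form_scale_right b)
qed

lemma form_nondegenerate_H:
  assumes "t \<in> H" "\<And>h. h \<in> H \<Longrightarrow> form t h = 0"
  shows "t = 0"
proof (rule ccontr)
  assume "t \<noteq> 0"
  moreover have "t \<in> root_space H (\<lambda>_. 0)" using assms root_space_zero by auto
  ultimately obtain y where "y \<in> root_space H (\<lambda>h. - 0)" "form t y = 1"
    using opposite_root_vector by blast
  then show False using assms(2) root_space_zero[of "\<lambda>_. - 0"] by auto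
qed

lemma br_opposite_root_vectors:
  assumes x: "x \<in> root_space H \<alpha>" and y: "y \<in> root_space H (\<lambda>h. - \<alpha> h)"
  shows "br x y \<in> H" and "h \<in> H \<Longrightarrow> form (br x y) h = form x y * \<alpha> h"
proof -
  show "br x y \<in> H"
    using br_root_spaces[OF x y] root_space_zero[of "\<lambda>h. \<alpha> h + - \<alpha> h"] by auto
  assume "h \<in> H"
  have "form (br x y) h = form (br h x) y"
    by (subst form_sym) (simp add: form_invariant)
  then show "form (br x y) h = form x y * \<alpha> h"
    using x \<open>h \<in> H\<close> by (simp add: root_space_def form_scale_left)
qed

lemma br_opposite_root_vectors_eq:
  assumes "x \<in> root_space H \<alpha>" "y \<in> root_space H (\<lambda>h. - \<alpha> h)"
    and t: "t \<in> H" "\<And>h. h \<in> H \<Longrightarrow> form t h = \<alpha> h"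
  shows "br x y = form x y *s t"
proof -
  have "br x y - form x y *s t = 0"
  proof (rule form_nondegenerate_H)
    show "br x y - form x y *s t \<in> H"
      by (intro subspace_diff subspace_scale subspace_H br_opposite_root_vectors[OF assms(1,2)] t)
    show "form (br x y - form x y *s t) h = 0" if "h \<in> H" for h
      using br_opposite_root_vectors[OF assms(1,2)] t that
      by (subst form_sym) (simp add: form_diff_right form_scale_right form_sym[of h])
  qed
  then show ?thesis by simp
qed

lemma root_triple:
  assumes "\<alpha> \<in> roots H"
  obtains x y t where "x \<in> root_space H \<alpha>" "x \<noteq> 0" "y \<in> root_space H (\<lambda>h. - \<alpha> h)" "y \<noteq> 0"
    "form x y = 1" "br x y = t" "t \<in> H" "\<forall>h\<in>H. form t h = \<alpha> h"
proof -
  obtain x where x: "x \<in> root_space H \<alpha>" "x \<noteq> 0"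
    using assms subspace_0[OF subspace_root_space[of \<alpha>]] unfolding roots_def by auto
  obtain y where y: "y \<in> root_space H (\<lambda>h. - \<alpha> h)" "form x y = 1"
    using opposite_root_vector[OF x] .
  then have "y \<noteq> 0" by auto
  then show ?thesis
    using that[of x y "br x y"] x y br_opposite_root_vectors[OF x(1) y(1)] by auto
qed

text \<open>The element \<open>t\<close> represents \<open>\<alpha>\<close> in \<open>H\<close>. It is the bracket of two root vectors, so it has trace zero
  on each \<open>\<alpha>\<close>-string of weight spaces. If \<open>\<alpha> t\<close> were zero, then \<open>t\<close> would act on the string through
  \<open>\<beta>\<close> by the scalar \<open>\<beta> t\<close>, which would have to vanish; then \<open>t\<close> would be central and hence zero.\<close>

lemma coroot_direction_nonzero:
  assumes \<alpha>: "\<alpha> \<in> roots H" and t: "t \<in> H" "\<And>h. h \<in> H \<Longrightarrow> form t h = \<alpha> h"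
  shows "\<alpha> t \<noteq> 0"
proof
  assume "\<alpha> t = 0"
  obtain x y where xy: "x \<in> root_space H \<alpha>" "x \<noteq> 0" "y \<in> root_space H (\<lambda>h. - \<alpha> h)" "form x y = 1"
    by (rule root_triple[OF \<alpha>]) (rule that; simp)
  have brt: "br x y = t" using br_opposite_root_vectors_eq[OF xy(1,3) t] xy(4) by simp
  obtain B where B: "weight_basis B"
    by (rule weight_basis_extending[OF independent_empty]) auto
  note D = weight_basisD[OF B]
  have "weight b0 t = 0" if "b0 \<in> B" for b0
  proof -
    define M where "M = {b\<in>B. \<exists>k::int. \<forall>h\<in>H. weight b h = weight b0 h + of_int k * \<alpha> h}"
    have "b0 \<in> M" using that by (auto simp: M_def intro!: exI[of _ 0])
    have M: "finite M" "independent M" using D independent_mono unfolding M_def by auto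
    have string: "z \<in> span M" if z: "z \<in> root_space H (\<lambda>h. weight b0 h + of_int k * \<alpha> h)" for z k
      using root_space_in_span[OF B z] span_mono[of "{b \<in> B. \<forall>h\<in>H. weight b h = weight b0 h + of_int k * \<alpha> h}" M]
      unfolding M_def by blast
    have stable: "br x ` M \<subseteq> span M" "br y ` M \<subseteq> span M"
    proof safe
      fix b assume "b \<in> M"
      then obtain k :: int where b: "b \<in> B" and k: "\<And>h. h \<in> H \<Longrightarrow> weight b h = weight b0 h + of_int k * \<alpha> h"
        by (auto simp: M_def)
      have "br x b \<in> root_space H (\<lambda>h. weight b0 h + of_int (k + 1) * \<alpha> h)"
        by (rule root_space_cong[OF _ br_root_spaces[OF xy(1) D(5)[OF b]]]) (simp add: k algebra_simps)
      then show "br x b \<in> span M" by (rule string)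
      have "br y b \<in> root_space H (\<lambda>h. weight b0 h + of_int (k - 1) * \<alpha> h)"
        by (rule root_space_cong[OF _ br_root_spaces[OF xy(3) D(5)[OF b]]]) (simp add: k algebra_simps)
      then show "br y b \<in> span M" by (rule string)
    qed
    have "0 = basis_trace scale M (\<lambda>v. br x (br y v) - br y (br x v))"
      using basis_trace_commutator[OF M linear_br stable(1) linear_br stable(2)] by simp
    also have "\<dots> = basis_trace scale M (br t)" by (simp add: brt[symmetric] br_br basis_trace_def)
    also have "\<dots> = (\<Sum>b\<in>M. weight b t)"
      by (rule basis_trace_eigenbasis[OF M(2)]) (use D t in \<open>auto simp: M_def\<close>)
    also have "\<dots> = (\<Sum>b\<in>M. weight b0 t)"
      by (rule sum.cong) (use t \<open>\<alpha> t = 0\<close> in \<open>auto simp: M_def\<close>)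
    finally have "of_nat (card M) * weight b0 t = 0" by simp
    then show ?thesis using \<open>b0 \<in> M\<close> M(1) by auto
  qed
  then have on_basis: "br t b = 0" if "b \<in> B" for b using D(6)[OF that t(1)] that by simp
  interpret adt: Vector_Spaces.linear scale scale "br t" by (rule linear_br)
  have central: "br t z = 0" for z
    using adt.eq_0_on_span[OF on_basis] D(2) by auto
  have "killing t z = 0" for z
    unfolding killing_def using trace_of_scale[of 0 "\<lambda>_. 0"] by (simp add: central)
  then have "form t z = 0" for z by (metis form_multiple_of_killing mult_zero_right)
  then show False using t(2) \<alpha> by (auto simp: roots_def)
qed


text \<open>Let \<open>M\<close> be spanned by \<open>y\<close>, \<open>t = [x,y]\<close> and the weight spaces of \<open>\<alpha>\<close>, \<open>2\<alpha>\<close>, \<open>3\<alpha>\<close> and so on. It is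
  stable under \<open>x\<close> and \<open>y\<close>, so \<open>t\<close> has trace zero on it: \<open>-\<alpha> t + 0 + \<Sum> k n\<^sub>k \<alpha> t = 0\<close>, where
  \<open>n\<^sub>k\<close> is the dimension of the weight space of \<open>k\<alpha>\<close>. Thus \<open>\<Sum> k n\<^sub>k = 1\<close>, which leaves \<open>n\<^sub>1 = 1\<close>.\<close>

lemma root_space_line:
  assumes \<alpha>: "\<alpha> \<in> roots H"
  obtains e where "root_space H \<alpha> = span {e}"
proof -
  obtain x y t where xyt: "x \<in> root_space H \<alpha>" "x \<noteq> 0" "y \<in> root_space H (\<lambda>h. - \<alpha> h)" "y \<noteq> 0"
    "form x y = 1" "br x y = t" "t \<in> H" and rep: "\<forall>h\<in>H. form t h = \<alpha> h"
    by (rule root_triple[OF \<alpha>])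
  have t: "\<And>h. h \<in> H \<Longrightarrow> form t h = \<alpha> h" using rep by blast
  have \<alpha>t: "\<alpha> t \<noteq> 0" by (rule coroot_direction_nonzero[OF \<alpha> xyt(7) t])
  have bry: "br t y = - (\<alpha> t *s y)" using xyt by (simp add: root_space_def)
  have brt: "br t t = 0" by (rule br_self)
  have t0: "t \<in> root_space H (\<lambda>_. 0)" using root_space_zero[of "\<lambda>_. 0"] xyt(7) by simp
  have "t \<noteq> 0" using t \<alpha> by (auto simp: roots_def)
  have "y \<notin> span {t}"
  proof
    assume "y \<in> span {t}"
    then have "br t y = 0" by (auto simp: span_singleton br_scale_right brt)
    then show False using bry \<alpha>t xyt(4) by simp
  qed
  then have ind: "independent {y, t}" and "y \<noteq> t"
    using \<open>t \<noteq> 0\<close> span_base[of t "{t}"] by (auto simp: independent_insert)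
  obtain B where B: "{y, t} \<subseteq> B" "weight_basis B"
    using weight_basis_extending[OF ind] xyt(3,4) t0 \<open>t \<noteq> 0\<close> unfolding weight_vector_def by blast
  note D = weight_basisD[OF B(2)]
  define N where "N = {b\<in>B. \<exists>k\<ge>1. \<forall>h\<in>H. weight b h = of_nat k * \<alpha> h}"
  define M where "M = insert y (insert t N)"
  have wy: "weight y h = - \<alpha> h" if "h \<in> H" for h by (rule weight_eq[OF xyt(3,4) that])
  have wt: "weight t h = 0" if "h \<in> H" for h by (rule weight_eq[OF t0 \<open>t \<noteq> 0\<close> that])
  have "y \<notin> N"
  proof
    assume "y \<in> N"
    then obtain k where "weight y t = of_nat k * \<alpha> t" using xyt(7) by (auto simp: N_def)
    then have "of_nat (Suc k) * \<alpha> t = 0" using wy[OF xyt(7)]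
      by (simp add: distrib_right) (metis add.right_inverse)
    then show False using \<alpha>t by (simp del: of_nat_Suc)
  qed
  have "t \<notin> N" using wt \<alpha>t xyt(7) by (force simp: N_def)
  have M: "M \<subseteq> B" "finite M" "independent M"
    using B(1) D(1,3) independent_mono[of B M] finite_subset[of M B] by (auto simp: M_def N_def)
  have string: "z \<in> span M" if z: "z \<in> root_space H (\<lambda>h. of_nat k * \<alpha> h)" and "k \<ge> 1" for z k
    using root_space_in_span[OF B(2) z] span_mono[of "{b\<in>B. \<forall>h\<in>H. weight b h = of_nat k * \<alpha> h}" M] \<open>k \<ge> 1\<close>
    unfolding N_def M_def by blast
  have tM: "c *s t \<in> span M" and yM: "c *s y \<in> span M" for c
    by (auto simp: M_def intro: span_scale span_base)
  have stable: "br x b \<in> span M" "br y b \<in> span M" if bM: "b \<in> M" for b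
  proof -
    consider "b = y" | "b = t" | "b \<in> N" using bM by (auto simp: M_def)
    then have "br x b \<in> span M \<and> br y b \<in> span M"
    proof cases
      case 1
      then show ?thesis using tM[of 1] by (simp add: br_self xyt(6) span_zero)
    next
      case 2
      have "br x t \<in> root_space H (\<lambda>h. of_nat 1 * \<alpha> h)"
        using br_root_spaces[OF xyt(1) t0] by simp
      moreover have "br y t = \<alpha> t *s y" using br_swap[of y t] bry by simp
      ultimately show ?thesis using 2 string[of _ 1] yM by simp
    next
      case 3
      then obtain k where b: "b \<in> B" and "k \<ge> 1" and k: "\<And>h. h \<in> H \<Longrightarrow> weight b h = of_nat k * \<alpha> h"
        by (auto simp: N_def)
      have "br x b \<in> root_space H (\<lambda>h. of_nat (Suc k) * \<alpha> h)"
        by (rule root_space_cong[OF _ br_root_spaces[OF xyt(1) D(5)[OF b]]]) (simp add: k algebra_simps)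
      moreover have "br y b \<in> span M"
      proof (cases "k = 1")
        case True
        have "b \<in> root_space H \<alpha>" by (rule root_space_cong[OF _ D(5)[OF b]]) (simp add: k True)
        then have "br b y = form b y *s t" by (rule br_opposite_root_vectors_eq[OF _ xyt(3,7) t])
        then show ?thesis using tM[of "- form b y"] br_swap[of y b] by simp
      next
        case False
        have "br y b \<in> root_space H (\<lambda>h. of_nat (k - 1) * \<alpha> h)"
          by (rule root_space_cong[OF _ br_root_spaces[OF xyt(3) D(5)[OF b]]])
            (use \<open>k \<ge> 1\<close> in \<open>simp add: k of_nat_diff algebra_simps\<close>)
        then show ?thesis by (rule string) (use False \<open>k \<ge> 1\<close> in simp)
      qed
      ultimately show ?thesis using string[of _ "Suc k"] by simp
    qed
    then show "br x b \<in> span M" "br y b \<in> span M" by auto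
  qed
  have "\<exists>k. \<forall>b\<in>N. k b \<ge> (1::nat) \<and> (\<forall>h\<in>H. weight b h = of_nat (k b) * \<alpha> h)"
    by (rule bchoice) (auto simp: N_def)
  then obtain k where k: "\<And>b. b \<in> N \<Longrightarrow> k b \<ge> (1::nat)"
    "\<And>b h. b \<in> N \<Longrightarrow> h \<in> H \<Longrightarrow> weight b h = of_nat (k b) * \<alpha> h" by blast
  have "0 = basis_trace scale M (\<lambda>v. br x (br y v) - br y (br x v))"
    using basis_trace_commutator[OF M(2,3) linear_br _ linear_br] stable by (auto simp: image_subset_iff)
  also have "\<dots> = basis_trace scale M (br t)" by (simp add: xyt(6)[symmetric] br_br basis_trace_def)
  also have "\<dots> = (\<Sum>b\<in>M. weight b t)"
    by (rule basis_trace_eigenbasis[OF M(3)]) (use D(6) xyt(7) M(1) in auto)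
  also have "\<dots> = - \<alpha> t + (\<Sum>b\<in>N. weight b t)"
    unfolding M_def using \<open>y \<notin> N\<close> \<open>t \<notin> N\<close> \<open>y \<noteq> t\<close> M(2) wy[OF xyt(7)] wt[OF xyt(7)] by (simp add: M_def)
  also have "(\<Sum>b\<in>N. weight b t) = of_nat (\<Sum>b\<in>N. k b) * \<alpha> t"
    unfolding of_nat_sum sum_distrib_right by (intro sum.cong refl k xyt(7))
  finally have "of_nat (\<Sum>b\<in>N. k b) * \<alpha> t = 1 * \<alpha> t" by simp
  then have "of_nat (\<Sum>b\<in>N. k b) = (of_nat 1 :: complex)" using \<alpha>t by (simp del: of_nat_sum)
  then have sum1: "(\<Sum>b\<in>N. k b) = 1" unfolding of_nat_eq_iff .
  have "card N \<le> (\<Sum>b\<in>N. k b)"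
    using sum_mono[of N "\<lambda>_. 1" k] k(1) by simp
  then have "card N \<le> 1" using sum1 by simp
  moreover have finN: "finite N" using M(2) by (simp add: M_def)
  moreover have "N \<noteq> {}" using sum1 by auto
  ultimately obtain e where e: "N = {e}" by (metis card_1_singletonE card_0_eq le_less_Suc_eq less_one One_nat_def linorder_neqE_nat not_less)
  have ke: "k e = 1" using sum1 e by simp
  have "root_space H \<alpha> = span {e}"
  proof (intro equalityI span_minimal subspace_root_space)
    have "weight e h = \<alpha> h" if "h \<in> H" for h using k(2)[of e h] that ke e by simp
    moreover have "e \<in> root_space H (weight e)" using e D(5) by (auto simp: N_def)
    ultimately show "{e} \<subseteq> root_space H \<alpha>" using root_space_cong by blast
    have "{b\<in>B. \<forall>h\<in>H. weight b h = \<alpha> h} \<subseteq> N" by (auto simp: N_def intro!: exI[of _ 1])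
    then show "root_space H \<alpha> \<subseteq> span {e}"
      using root_space_in_span[OF B(2)] span_mono e by blast
  qed
  then show ?thesis by (rule that)
qed

lemma weight_basis_root_unique:
  assumes B: "weight_basis B" and \<alpha>: "\<alpha> \<in> roots H"
  shows "\<exists>!b. b \<in> B \<and> weight b = \<alpha>"
proof -
  note D = weight_basisD[OF B]
  define N where "N = {b\<in>B. weight b = \<alpha>}"
  obtain e where e: "root_space H \<alpha> = span {e}" by (rule root_space_line[OF \<alpha>])
  have eq: "weight b = \<alpha> \<longleftrightarrow> (\<forall>h\<in>H. weight b h = \<alpha> h)" for b
  proof
    assume *: "\<forall>h\<in>H. weight b h = \<alpha> h"
    show "weight b = \<alpha>"
    proof
      fix h show "weight b h = \<alpha> h"
        using * \<alpha> weight_outside[of h b] by (cases "h \<in> H") (auto simp: roots_def)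
    qed
  qed simp
  have "N \<subseteq> span {e}" using D(5) unfolding N_def e[symmetric] by auto
  moreover have "independent N" using D(1) by (rule independent_mono) (auto simp: N_def)
  ultimately have "finite N" "card N \<le> 1" using independent_span_bound[of "{e}" N] by auto
  moreover have "N \<noteq> {}"
  proof
    assume "N = {}"
    then have "root_space H \<alpha> \<subseteq> {0}"
      using root_space_in_span[OF B, of _ \<alpha>] unfolding N_def eq by (metis span_empty subsetI)
    then show False using \<alpha> subspace_0[OF subspace_root_space[of \<alpha>]] by (auto simp: roots_def)
  qed
  ultimately have "card N = 1" by (metis card_0_eq le_neq_implies_less less_one)
  then obtain b where "N = {b}" by (rule card_1_singletonE)
  then show ?thesis unfolding N_def by (intro ex1I[of _ b]) auto
qed

section \<open>The Killing form on the highest root\<close>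

lemma nonneg_combination_cancel:
  assumes "\<beta> \<in> nonneg_combinations \<Delta>" "\<gamma> \<in> nonneg_combinations \<Delta>"
    and sum: "\<And>h. of_nat k * \<beta> h + \<gamma> h = 0" and "k \<ge> 1"
  shows "\<beta> h = 0"
proof -
  obtain n m :: "('g \<Rightarrow> complex) \<Rightarrow> nat"
    where n: "\<beta> = (\<lambda>h. \<Sum>\<alpha>\<in>\<Delta>. of_nat (n \<alpha>) * \<alpha> h)" and m: "\<gamma> = (\<lambda>h. \<Sum>\<alpha>\<in>\<Delta>. of_nat (m \<alpha>) * \<alpha> h)"
    using assms unfolding nonneg_combinations_def by auto
  have "(\<Sum>\<alpha>\<in>\<Delta>. of_nat (k * n \<alpha> + m \<alpha>) * \<alpha> h) = 0" for h
    using sum[of h] unfolding n m by (simp add: sum_distrib_left sum.distrib[symmetric] algebra_simps)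
  moreover have "\<forall>c. (\<forall>h. (\<Sum>\<alpha>\<in>\<Delta>. c \<alpha> * \<alpha> h) = 0) \<longrightarrow> (\<forall>\<alpha>\<in>\<Delta>. c \<alpha> = 0)"
    using base unfolding root_base_def by (elim conjE)
  ultimately have "\<forall>\<alpha>\<in>\<Delta>. of_nat (k * n \<alpha> + m \<alpha>) = (0::complex)"
    by (auto dest: spec[of _ "\<lambda>\<alpha>. of_nat (k * n \<alpha> + m \<alpha>)"])
  then have "\<forall>\<alpha>\<in>\<Delta>. n \<alpha> = 0" using \<open>k \<ge> 1\<close> unfolding of_nat_eq_0_iff by auto
  then show ?thesis unfolding n by simp
qed

lemma positive_root_cases:
  assumes "\<beta> \<in> roots H"
  shows "\<beta> \<in> positive_roots H \<Delta> \<or> (\<lambda>h. - \<beta> h) \<in> positive_roots H \<Delta>"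
proof -
  have "(\<lambda>h. - \<beta> h) \<in> roots H"
  proof -
    obtain y where "y \<in> root_space H (\<lambda>h. - \<beta> h)" "y \<noteq> 0"
      by (rule root_triple[OF assms]) (rule that; assumption)
    then show ?thesis using assms by (auto simp: roots_def)
  qed
  then show ?thesis using base assms unfolding root_base_def positive_roots_def by auto
qed

lemma positive_root_not_negative:
  assumes "\<beta> \<in> positive_roots H \<Delta>"
  shows "(\<lambda>h. - \<beta> h) \<notin> positive_roots H \<Delta>"
  using nonneg_combination_cancel[of \<beta> "\<lambda>h. - \<beta> h" 1] assms
  by (auto simp: positive_roots_def roots_def)

text \<open>A weight \<open>\<gamma> = \<theta> + \<beta>\<close> that is a root makes \<open>\<theta> - \<gamma> = -\<beta>\<close> a nonnegative combination of simple
  roots, like \<open>\<beta>\<close>. If instead \<open>\<gamma> = 0\<close>, then the same holds for \<open>\<theta> - \<beta> = -2\<beta>\<close>.\<close>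

lemma root_space_above_highest:
  assumes \<beta>: "\<beta> \<in> positive_roots H \<Delta>"
  shows "root_space H (\<lambda>h. \<theta> h + \<beta> h) = {0}"
proof (rule ccontr)
  let ?\<gamma> = "\<lambda>h. \<theta> h + \<beta> h"
  assume ne: "root_space H ?\<gamma> \<noteq> {0}"
  have \<theta>: "\<theta> \<in> roots H" and le: "\<And>\<beta>. \<beta> \<in> roots H \<Longrightarrow> (\<lambda>h. \<theta> h - \<beta> h) \<in> nonneg_combinations \<Delta>"
    using highest unfolding highest_root_def by auto
  have \<beta>': "\<beta> \<in> roots H" "\<beta> \<in> nonneg_combinations \<Delta>" using \<beta> by (auto simp: positive_roots_def)
  obtain h0 where nz: "\<beta> h0 \<noteq> 0" using \<beta>' by (auto simp: roots_def)
  have out: "\<And>h. h \<notin> H \<Longrightarrow> ?\<gamma> h = 0" using \<theta> \<beta>' by (auto simp: roots_def)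
  show False
  proof (cases "\<exists>h\<in>H. ?\<gamma> h \<noteq> 0")
    case True
    then have "?\<gamma> \<in> roots H" using out ne unfolding roots_def by blast
    then have "\<beta> h0 = 0"
      by (intro nonneg_combination_cancel[OF \<beta>'(2) le, of _ 1]) (simp_all add: algebra_simps)
    then show False using nz by simp
  next
    case False
    then have opp: "\<theta> h = - \<beta> h" for h using out[of h] by (cases "h \<in> H") (auto simp: eq_neg_iff_add_eq_0)
    have "\<beta> h0 = 0"
      by (rule nonneg_combination_cancel[OF \<beta>'(2) le[OF \<beta>'(1)], of 2]) (simp_all add: opp)
    then show False using nz by simp
  qed
qed

lemma highest_root_raising:
  assumes "x \<in> root_space H \<theta>" "\<beta> \<in> positive_roots H \<Delta>" "b \<in> root_space H \<beta>"
  shows "br x b = 0"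
  using br_root_spaces[OF assms(1,3)] root_space_above_highest[OF assms(2)] by simp

lemma lowest_root_lowering:
  assumes y: "y \<in> root_space H (\<lambda>h. - \<theta> h)"
    and \<beta>: "\<beta> \<in> positive_roots H \<Delta>" and b: "b \<in> root_space H (\<lambda>h. - \<beta> h)"
  shows "br y b = 0"
proof (rule ccontr)
  assume "br y b \<noteq> 0"
  with br_root_spaces[OF y b] obtain z
    where "z \<in> root_space H (\<lambda>h. - (- \<theta> h + - \<beta> h))" "form (br y b) z = 1"
    by (rule opposite_root_vector)
  moreover have "(\<lambda>h. - (- \<theta> h + - \<beta> h)) = (\<lambda>h. \<theta> h + \<beta> h)" by (simp add: add.commute)
  ultimately have "z = 0" using root_space_above_highest[OF \<beta>] by auto
  then show False using \<open>form (br y b) z = 1\<close> by simp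
qed

lemma normalized_element:
  obtains t where "t \<in> H" "\<forall>h\<in>H. form t h = \<theta> h" "form t t = 2"
  using normalized unfolding normalized_killing_form_def by blast

lemma coroot_highest:
  assumes t: "t \<in> H" "\<And>h. h \<in> H \<Longrightarrow> form t h = \<theta> h" "form t t = 2"
  shows "coroot H \<theta> = t"
proof -
  let ?S = "{br x y | x y. x \<in> root_space H \<theta> \<and> y \<in> root_space H (\<lambda>h. - \<theta> h)}"
  have "\<theta> \<in> roots H" using highest by (simp add: highest_root_def)
  then obtain x y where xy: "x \<in> root_space H \<theta>" "y \<in> root_space H (\<lambda>h. - \<theta> h)" "form x y = 1"
    by (rule root_triple) (rule that; assumption)
  then have "t = br x y" using br_opposite_root_vectors_eq[OF xy(1,2) t(1,2)] by simp
  then have "t \<in> ?S" using xy by blast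
  have "?S \<subseteq> span {t}"
    using br_opposite_root_vectors_eq[OF _ _ t(1,2)] by (auto simp: span_singleton)
  then have S: "span ?S \<subseteq> span {t}" by (rule span_minimal) simp
  have "\<theta> (c *s t) = c * 2" for c
    using t(2)[of "c *s t"] t(1,3) subspace_H subspace_scale by (simp add: form_scale_right)
  then have "h = t" if "h \<in> span ?S" "\<theta> h = 2" for h
    using that S by (auto simp: span_singleton)
  then show ?thesis
    unfolding coroot_def using \<open>t \<in> ?S\<close> t by (intro the_equality) (auto intro: span_base)
qed

text \<open>The trace of \<open>ad x ad y\<close> in a basis of weight vectors. On a positive root space \<open>x\<close> acts by
  zero, so \<open>ad x ad y\<close> reduces to the action of \<open>[x,y] = t\<close>. On a negative root space \<open>y\<close> acts by
  zero. On the Cartan subalgebra the operator is \<open>b \<mapsto> \<theta>(b) t\<close>, of trace \<open>\<theta>(t) = 2\<close>.\<close>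

lemma killing_highest_root_vectors:
  assumes x: "x \<in> root_space H \<theta>" and y: "y \<in> root_space H (\<lambda>h. - \<theta> h)" and xy: "form x y = 1"
    and t: "t \<in> H" "\<And>h. h \<in> H \<Longrightarrow> form t h = \<theta> h" "form t t = 2"
  shows "killing x y = 2 + (\<Sum>\<alpha>\<in>positive_roots H \<Delta>. \<alpha> t)"
proof -
  obtain B where B: "weight_basis B"
    by (rule weight_basis_extending[OF independent_empty]) auto
  note D = weight_basisD[OF B]
  let ?P = "positive_roots H \<Delta>"
  let ?r = "\<lambda>b. representation B (br x (br y b)) b"
  define Bp where "Bp = {b\<in>B. weight b \<in> ?P}"
  define Bn where "Bn = {b\<in>B. (\<lambda>h. - weight b h) \<in> ?P}"
  define B0 where "B0 = {b\<in>B. \<forall>h\<in>H. weight b h = 0}"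
  have brt: "br x y = t" using br_opposite_root_vectors_eq[OF x y t(1,2)] xy by simp
  have t0: "t \<in> root_space H (\<lambda>_. 0)" using root_space_zero[of "\<lambda>_. 0"] t(1) by simp
  have "B \<subseteq> Bp \<union> Bn \<union> B0"
  proof
    fix b assume b: "b \<in> B"
    then have "b \<in> B0 \<or> weight b \<in> roots H"
      using D(4,5)[OF b] weight_outside[of _ b] by (auto simp: B0_def roots_def)
    then show "b \<in> Bp \<union> Bn \<union> B0"
      using positive_root_cases[of "weight b"] b by (auto simp: Bp_def Bn_def)
  qed
  then have BU: "B = Bp \<union> (Bn \<union> B0)" by (auto simp: Bp_def Bn_def B0_def)
  have disj: "Bp \<inter> (Bn \<union> B0) = {}" "Bn \<inter> B0 = {}"
    using positive_root_not_negative by (auto simp: Bp_def Bn_def B0_def positive_roots_def roots_def)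
  have fin: "finite Bp" "finite Bn" "finite B0" using D(3) by (auto simp: Bp_def Bn_def B0_def)
  have p: "?r b = weight b t" if "b \<in> Bp" for b
  proof -
    have b: "b \<in> B" "weight b \<in> ?P" using that by (auto simp: Bp_def)
    have "br x b = 0" by (rule highest_root_raising[OF x b(2) D(5)[OF b(1)]])
    then have "br x (br y b) = br t b" unfolding brt[symmetric] br_br by simp
    also have "\<dots> = weight b t *s b" using D(6) b t by simp
    finally show ?thesis
      using D b by (simp add: representation_scale representation_basis)
  qed
  have n: "?r b = 0" if "b \<in> Bn" for b
  proof -
    have b: "b \<in> B" "(\<lambda>h. - weight b h) \<in> ?P" using that by (auto simp: Bn_def)
    have "b \<in> root_space H (\<lambda>h. - (- weight b h))" using D(5)[OF b(1)] by simp
    then have "br y b = 0" by (rule lowest_root_lowering[OF y b(2)])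
    then show ?thesis by (simp add: representation_zero)
  qed
  have z: "?r b = representation B t b * form t b" if "b \<in> B0" for b
  proof -
    have b: "b \<in> B" "\<And>h. h \<in> H \<Longrightarrow> weight b h = 0" using that by (auto simp: B0_def)
    have "b \<in> root_space H (\<lambda>_. 0)" by (rule root_space_cong[OF b(2) D(5)[OF b(1)]])
    then have "b \<in> H" using root_space_zero[of "\<lambda>_. 0"] by simp
    have "br y b = \<theta> b *s y" using y \<open>b \<in> H\<close> br_swap[of y b] by (simp add: root_space_def)
    then have "br x (br y b) = \<theta> b *s t" by (simp add: br_scale_right brt)
    then show ?thesis using D \<open>b \<in> H\<close> t(2) by (simp add: representation_scale)
  qed
  have o: "representation B t b * form t b = 0" if "b \<in> B - B0" for b
  proof -
    obtain h where "h \<in> H" "weight b h \<noteq> 0" using \<open>b \<in> B - B0\<close> by (auto simp: B0_def)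
    then have "form t b = 0" using form_root_spaces[OF t0 D(5), of b h] that by auto
    then show ?thesis by simp
  qed
  \<comment> \<open>The trace on the Cartan subalgebra is the expansion of \<open>form t t\<close> in the basis \<open>B\<close>.\<close>
  have "(\<Sum>b\<in>B0. ?r b) = (\<Sum>b\<in>B0. representation B t b * form t b)" by (rule sum.cong) (auto simp: z)
  also have "\<dots> = (\<Sum>b\<in>B. representation B t b * form t b)"
    by (rule sum.mono_neutral_left) (use D(3) o in \<open>auto simp: B0_def\<close>)
  also have "\<dots> = form t (\<Sum>b\<in>B. representation B t b *s b)"
    by (simp add: form_sum_right form_scale_right)
  also have "\<dots> = 2" using sum_representation_eq[of B t B] D t(3) by simp
  finally have zero: "(\<Sum>b\<in>B0. ?r b) = 2" .
  \<comment> \<open>Root spaces are lines, so the basis vectors of positive weight correspond to positive roots.\<close>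
  have bij: "bij_betw weight Bp ?P"
  proof (rule bij_betw_imageI)
    show "inj_on weight Bp"
      using weight_basis_root_unique[OF B] by (fastforce simp: inj_on_def Bp_def positive_roots_def)
    show "weight ` Bp = ?P"
      using weight_basis_root_unique[OF B] by (fastforce simp: Bp_def positive_roots_def)
  qed
  have "(\<Sum>b\<in>Bp. ?r b) = (\<Sum>b\<in>Bp. weight b t)" by (rule sum.cong) (auto simp: p)
  also have "\<dots> = (\<Sum>\<alpha>\<in>?P. \<alpha> t)" by (rule sum.reindex_bij_betw[OF bij])
  finally have pos: "(\<Sum>b\<in>Bp. ?r b) = (\<Sum>\<alpha>\<in>?P. \<alpha> t)" .
  have "killing x y = basis_trace scale B (\<lambda>v. br x (br y v))"
    unfolding killing_def by (rule trace_of_eq_basis_trace[OF D(1,2) linear_br_br])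
  also have "\<dots> = (\<Sum>b\<in>Bp. ?r b) + ((\<Sum>b\<in>Bn. ?r b) + (\<Sum>b\<in>B0. ?r b))"
    unfolding basis_trace_def sum.union_disjoint[OF fin(2,3) disj(2), symmetric]
      sum.union_disjoint[OF fin(1) finite_UnI[OF fin(2,3)] disj(1), symmetric] BU[symmetric] ..
  also have "(\<Sum>b\<in>Bn. ?r b) = 0" by (rule sum.neutral) (auto simp: n)
  finally show ?thesis using pos zero by simp
qed

text \<open>The two forms are proportional, so one pair of opposite root vectors decides.\<close>

theorem killing_eq_dual_coxeter: "killing x y = 2 * dual_coxeter_number H \<Delta> \<theta> * form x y"
proof -
  obtain c where c: "c \<noteq> 0" "\<forall>x y. form x y = c * killing x y"
    by (rule form_multiple_of_killing)
  obtain t where t1: "t \<in> H" "\<forall>h\<in>H. form t h = \<theta> h" "form t t = 2"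
    by (rule normalized_element)
  note t = t1(1) t1(2)[rule_format] t1(3)
  have "\<theta> \<in> roots H" using highest by (simp add: highest_root_def)
  then obtain x' y' where xy: "x' \<in> root_space H \<theta>" "y' \<in> root_space H (\<lambda>h. - \<theta> h)" "form x' y' = 1"
    by (rule root_triple) (rule that; assumption)
  have "coroot H \<theta> = t" by (rule coroot_highest[OF t])
  moreover have "killing x' y' = 2 + (\<Sum>\<alpha>\<in>positive_roots H \<Delta>. \<alpha> t)"
    by (rule killing_highest_root_vectors[OF xy t])
  ultimately have "killing x' y' = 2 * dual_coxeter_number H \<Delta> \<theta>"
    unfolding dual_coxeter_number_def by simp
  then have "c * (2 * dual_coxeter_number H \<Delta> \<theta>) = 1" using c(2) xy(3) by metis
  then show ?thesis using c(2) by (simp add: mult.left_commute mult.commute)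
qed

corollary casimir_on_adjoint:
  "(\<Sum>i\<in>UNIV. br (br a (u i)) (u i)) = (2 * dual_coxeter_number H \<Delta> \<theta>) *s a"
  by (rule casimir_scalar) (rule killing_eq_dual_coxeter)

end

section \<open>Vacuum expectation functionals\<close>

text \<open>The terms of the Leibniz rule for the derivation \<open>brL a\<close> applied to a word.\<close>

fun derived_words :: "('l \<Rightarrow> 'l \<Rightarrow> 'l) \<Rightarrow> 'l \<Rightarrow> 'l list \<Rightarrow> 'l list list" where
  "derived_words brL a [] = []"
| "derived_words brL a (x # w) = (brL a x # w) # map ((#) x) (derived_words brL a w)"

lemma length_derived_words: "w' \<in> set (derived_words brL a w) \<Longrightarrow> length w' = length w"
  by (induction w arbitrary: w') auto

lemma derived_words_append:
  "derived_words brL a (v @ w) =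
    map (\<lambda>v'. v' @ w) (derived_words brL a v) @ map ((@) v) (derived_words brL a w)"
  by (induction v) (auto simp: comp_def)

text \<open>The splitting of a Lie algebra into a subalgebra of positive elements, the image of \<open>pos\<close>, and a
  complementary subalgebra of nonpositive ones, on which \<open>\<kappa>\<close> is a character. The example in mind is
  an affine Lie algebra, where \<open>\<kappa>\<close> reads off the level.\<close>

locale triangular_lie_algebra = lie_algebra scale br
  for scale :: "complex \<Rightarrow> 'l::ab_group_add \<Rightarrow> 'l" (infixr \<open>*s\<close> 75)
    and br :: "'l \<Rightarrow> 'l \<Rightarrow> 'l" +
  fixes pos :: "'l \<Rightarrow> 'l" and \<kappa> :: "'l \<Rightarrow> complex"
  assumes pos_add: "pos (x + y) = pos x + pos y"
    and pos_scale: "pos (c *s x) = c *s pos x"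
    and kappa_add: "\<kappa> (x + y) = \<kappa> x + \<kappa> y"
    and kappa_scale: "\<kappa> (c *s x) = c * \<kappa> x"
    and pos_br: "pos (br (pos x) (pos y)) = br (pos x) (pos y)" "\<kappa> (br (pos x) (pos y)) = 0"
    and nonpos_br: "pos (br (x - pos x) (y - pos y)) = 0" "\<kappa> (br (x - pos x) (y - pos y)) = 0"
begin

text \<open>The vacuum expectation value of a word. Its first letter is split into its positive part, which
  is commuted to the right until it annihilates the vacuum, and the rest, which acts on the
  dual vacuum by \<open>\<kappa>\<close>. Each term of the recursion is a word shorter by one letter.\<close>

function expectation :: "'l list \<Rightarrow> complex" where
  "expectation [] = 1"
| "expectation (x # w) =
    sum_list (map expectation (derived_words br (pos x) w)) + \<kappa> x * expectation w"
  by pat_completeness auto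
termination
  by (relation "Wellfounded.measure length") (auto dest: length_derived_words)

definition derivative :: "('l list \<Rightarrow> complex) \<Rightarrow> 'l \<Rightarrow> 'l list \<Rightarrow> complex" where
  "derivative F a w = sum_list (map F (derived_words br a w))"

text \<open>Linearity in every letter of words of length at most \<open>n\<close>. The bound is there because linearity
  of the expectation value is proved by induction on the length, with facts about derivatives of
  shorter words used in the inductive step.\<close>

definition multilinear_on :: "nat \<Rightarrow> ('l list \<Rightarrow> complex) \<Rightarrow> bool" where
  "multilinear_on n F \<longleftrightarrow> (\<forall>v w c x y. length v + length w < n \<longrightarrow>
     F (v @ [c *s x + y] @ w) = c * F (v @ [x] @ w) + F (v @ [y] @ w))"

lemma multilinear_onD:
  "multilinear_on n F \<Longrightarrow> length v + length w < n \<Longrightarrow>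
    F (v @ [c *s x + y] @ w) = c * F (v @ [x] @ w) + F (v @ [y] @ w)"
  unfolding multilinear_on_def by blast

lemma multilinear_on_prefix:
  assumes "multilinear_on (length p + n) F"
  shows "multilinear_on n (\<lambda>w. F (p @ w))"
  unfolding multilinear_on_def
proof (intro allI impI)
  fix v w :: "'l list" and c x y assume "length v + length w < n"
  then show "F (p @ v @ [c *s x + y] @ w) = c * F (p @ v @ [x] @ w) + F (p @ v @ [y] @ w)"
    using multilinear_onD[OF assms, of "p @ v" w] by simp
qed

lemma derivative_Nil [simp]: "derivative F a [] = 0"
  by (simp add: derivative_def)

lemma derivative_Cons:
  "derivative F a (x # w) = F (br a x # w) + derivative (\<lambda>w. F (x # w)) a w"
  by (simp add: derivative_def comp_def)

lemma derivative_append: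
  "derivative F a (v @ w) = derivative (\<lambda>v. F (v @ w)) a v + derivative (\<lambda>w. F (v @ w)) a w"
  by (simp add: derivative_def derived_words_append comp_def)

lemma derivative_cong:
  "(\<And>w'. length w' = length w \<Longrightarrow> F w' = F' w') \<Longrightarrow> derivative F a w = derivative F' a w"
  unfolding derivative_def by (intro arg_cong[where f = sum_list] map_cong) (auto dest: length_derived_words)

lemma derivative_add:
  "derivative (\<lambda>w. F w + F' w) a w = derivative F a w + derivative F' a w"
  by (simp add: derivative_def sum_list_addf)

lemma derivative_mult: "derivative (\<lambda>w. c * F w) a w = c * derivative F a w"
  by (simp add: derivative_def sum_list_const_mult)

lemma derivative_diff:
  "derivative (\<lambda>w. F w - F' w) a w = derivative F a w - derivative F' a w"
  by (simp add: derivative_def sum_list_subtractf)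

lemma derivative_linear:
  "multilinear_on (length w) F \<Longrightarrow>
    derivative F (c *s a + b) w = c * derivative F a w + derivative F b w"
proof (induction w arbitrary: F)
  case (Cons x w)
  have "multilinear_on (length w) (\<lambda>w. F (x # w))"
    using multilinear_on_prefix[of "[x]" "length w" F] Cons.prems by simp
  moreover have "F (br (c *s a + b) x # w) = c * F (br a x # w) + F (br b x # w)"
    using multilinear_onD[OF Cons.prems, of "[]" w c "br a x" "br b x"]
    by (simp add: br_add_left br_scale_left)
  ultimately show ?case using Cons.IH by (simp add: derivative_Cons distrib_left)
qed simp

lemma multilinear_on_add:
  "multilinear_on n F \<Longrightarrow> length v + length w < n \<Longrightarrow>
    F (v @ [x + y] @ w) = F (v @ [x] @ w) + F (v @ [y] @ w)"
  using multilinear_onD[of n F v w 1 x y] by simp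

text \<open>Derivatives at two different letters commute, so only the terms where both act on the same
  letter survive in the difference, and there the Jacobi identity applies.\<close>

lemma derivative_commutator:
  "multilinear_on (length w) F \<Longrightarrow>
    derivative (derivative F a) b w - derivative (derivative F b) a w = derivative F (br a b) w"
proof (induction w arbitrary: F)
  case (Cons x w)
  let ?G = "\<lambda>w. F (x # w)"
  have G: "multilinear_on (length w) ?G"
    using multilinear_on_prefix[of "[x]" "length w" F] Cons.prems by simp
  have expand: "derivative (derivative F a) b (x # w) =
      F (br a (br b x) # w) + derivative (\<lambda>w. F (br b x # w)) a w
      + derivative (\<lambda>w. F (br a x # w)) b w + derivative (derivative ?G a) b w" for a b
  proof -
    have "derivative (\<lambda>w. derivative F a (x # w)) b w =
        derivative (\<lambda>w. F (br a x # w)) b w + derivative (derivative ?G a) b w"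
      unfolding derivative_Cons derivative_add by (simp add: eta_contract_eq)
    then show ?thesis by (simp add: derivative_Cons)
  qed
  have "br a (br b x) = br (br a b) x + br b (br a x)" by (simp add: br_br)
  then have "F (br a (br b x) # w) = F (br (br a b) x # w) + F (br b (br a x) # w)"
    using multilinear_on_add[OF Cons.prems, of "[]" w] by simp
  then show ?case
    using Cons.IH[OF G] unfolding expand derivative_Cons[of F "br a b"] by (simp add: algebra_simps)
qed simp

lemma expectation_Cons: "expectation (x # w) = derivative expectation (pos x) w + \<kappa> x * expectation w"
  by (simp add: derivative_def)

declare expectation.simps(2) [simp del]

lemma multilinear_expectation: "multilinear_on n expectation"
proof (induction n)
  case 0
  show ?case by (simp add: multilinear_on_def)
next
  case (Suc n)
  have step: "expectation (v @ [c *s x + y] @ w) = c * expectation (v @ [x] @ w) + expectation (v @ [y] @ w)"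
    if len: "length v + length w < Suc n" for v w c x y
  proof (cases v)
    case Nil
    have "multilinear_on (length w) expectation"
      using Suc.IH len Nil unfolding multilinear_on_def by simp
    from derivative_linear[OF this, of c "pos x" "pos y"] show ?thesis using Nil
      by (simp add: expectation_Cons pos_add pos_scale kappa_add kappa_scale distrib_left distrib_right)
  next
    case (Cons z v')
    let ?p = "pos z"
    have l: "length v' + length w < n" using len Cons by simp
    have lin: "expectation (v @ [c *s x + y] @ w) = c * expectation (v @ [x] @ w) + expectation (v @ [y] @ w)"
      if "length v + length w < n" for v w x y
      using multilinear_onD[OF Suc.IH that] .
    have 1: "derivative (\<lambda>v. expectation (v @ [c *s x + y] @ w)) ?p v' =
        c * derivative (\<lambda>v. expectation (v @ [x] @ w)) ?p v' + derivative (\<lambda>v. expectation (v @ [y] @ w)) ?p v'"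
      unfolding derivative_mult[symmetric] derivative_add[symmetric]
      by (rule derivative_cong) (use lin l in auto)
    have 2: "derivative (\<lambda>w. expectation (v' @ [c *s x + y] @ w)) ?p w =
        c * derivative (\<lambda>w. expectation (v' @ [x] @ w)) ?p w + derivative (\<lambda>w. expectation (v' @ [y] @ w)) ?p w"
      unfolding derivative_mult[symmetric] derivative_add[symmetric]
      by (rule derivative_cong) (use lin l in auto)
    have 3: "expectation (v' @ [br ?p (c *s x + y)] @ w) =
        c * expectation (v' @ [br ?p x] @ w) + expectation (v' @ [br ?p y] @ w)"
      using lin[OF l] by (simp add: br_add_right br_scale_right)
    have expand: "expectation (v @ [u] @ w) = derivative (\<lambda>v. expectation (v @ [u] @ w)) ?p v'
        + expectation (v' @ [br ?p u] @ w) + derivative (\<lambda>w. expectation (v' @ [u] @ w)) ?p w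
        + \<kappa> z * expectation (v' @ [u] @ w)" for u
      unfolding Cons append_Cons expectation_Cons derivative_append by (simp add: derivative_Cons)
    show ?thesis unfolding expand 1 2 3 lin[OF l] by (simp add: algebra_simps)
  qed
  show ?case unfolding multilinear_on_def using step by blast
qed

lemma expectation_linear:
  "expectation (v @ [c *s x + y] @ w) = c * expectation (v @ [x] @ w) + expectation (v @ [y] @ w)"
  using multilinear_onD[OF multilinear_expectation[of "Suc (length v + length w)"]] by simp

lemma expectation_add:
  "expectation (v @ [x + y] @ w) = expectation (v @ [x] @ w) + expectation (v @ [y] @ w)"
  using expectation_linear[of v 1 x y w] by simp

lemma expectation_zero: "expectation (v @ [0] @ w) = 0"
  using expectation_add[of v 0 0 w] by simp

lemma expectation_scale: "expectation (v @ [c *s x] @ w) = c * expectation (v @ [x] @ w)"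
  using expectation_linear[of v c x 0 w] expectation_zero by simp

lemma expectation_diff:
  "expectation (v @ [x - y] @ w) = expectation (v @ [x] @ w) - expectation (v @ [y] @ w)"
  using expectation_add[of v "x - y" y w] by simp

text \<open>Both words are expanded by the recursion twice. What remains is governed by
  \<open>z = [x\<^sub>+, y] - [y\<^sub>+, x] - [x, y]\<close>, which equals \<open>[x\<^sub>+, y\<^sub>+] - [x - x\<^sub>+, y - y\<^sub>+]\<close>: its positive part
  is \<open>[x\<^sub>+, y\<^sub>+]\<close>, and \<open>\<kappa>\<close> vanishes on it.\<close>

lemma expectation_bracket_head:
  "expectation (x # y # w) - expectation (y # x # w) = expectation (br x y # w)"
proof -
  let ?E = expectation
  define z where "z = br (pos x) y - br (pos y) x - br x y"
  have "br x y - br (pos x) y - br x (pos y) + br (pos x) (pos y) = br (x - pos x) (y - pos y)"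
    by (simp add: br_diff_left br_diff_right)
  then have z: "z = br (pos x) (pos y) - br (x - pos x) (y - pos y)"
    unfolding z_def br_swap[of "pos y" x] by (simp add: algebra_simps)
  have pos_diff: "pos (a - b) = pos a - pos b" for a b using pos_add[of "a - b" b] by simp
  have kappa_diff: "\<kappa> (a - b) = \<kappa> a - \<kappa> b" for a b using kappa_add[of "a - b" b] by simp
  have "?E (z # w) = derivative ?E (br (pos x) (pos y)) w"
    unfolding expectation_Cons z pos_diff kappa_diff pos_br nonpos_br by simp
  also have "\<dots> = derivative (derivative ?E (pos x)) (pos y) w - derivative (derivative ?E (pos y)) (pos x) w"
    by (rule derivative_commutator[OF multilinear_expectation, symmetric])
  finally have *: "?E (br (pos x) y # w) - ?E (br (pos y) x # w) - ?E (br x y # w) = \<dots>"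
    using expectation_diff[of "[]" _ _ w] unfolding z_def by simp
  have expand: "?E (x # y # w) = ?E (br (pos x) y # w) + derivative (derivative ?E (pos y)) (pos x) w
      + \<kappa> y * derivative ?E (pos x) w + \<kappa> x * derivative ?E (pos y) w + \<kappa> x * \<kappa> y * ?E w" for x y
  proof -
    have "?E (x # y # w) = ?E (br (pos x) y # w) + derivative (\<lambda>w. ?E (y # w)) (pos x) w + \<kappa> x * ?E (y # w)"
      by (simp add: expectation_Cons[of x] derivative_Cons)
    moreover have "derivative (\<lambda>w. ?E (y # w)) (pos x) w =
        derivative (derivative ?E (pos y)) (pos x) w + \<kappa> y * derivative ?E (pos x) w"
      unfolding expectation_Cons derivative_add derivative_mult by (simp add: eta_contract_eq)
    ultimately show ?thesis by (simp add: expectation_Cons[of y] algebra_simps)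
  qed
  show ?thesis unfolding expand[of x y] expand[of y x] using * by (simp add: algebra_simps)
qed

text \<open>A positive first letter differentiates the rest of the word, and differentiation is compatible
  with the relation by the Jacobi identity; so the relation passes from the head of a word to any
  position.\<close>

lemma expectation_bracket:
  "expectation (v @ [x, y] @ w) - expectation (v @ [y, x] @ w) = expectation (v @ [br x y] @ w)"
proof (induction "length v" arbitrary: v x y w)
  case 0
  then show ?case using expectation_bracket_head by simp
next
  case (Suc n)
  then obtain z v' where v: "v = z # v'" and n: "n = length v'" by (cases v) auto
  let ?p = "pos z" and ?E = expectation
  note IH = Suc.hyps(1)[OF n]
  have IH': "?E (v'' @ [x, y] @ w) - ?E (v'' @ [y, x] @ w) = ?E (v'' @ [br x y] @ w)"
    if "length v'' = length v'" for v'' x y w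
    using Suc.hyps(1)[of v''] that n by simp
  have 1: "derivative (\<lambda>v. ?E (v @ [x, y] @ w)) ?p v' - derivative (\<lambda>v. ?E (v @ [y, x] @ w)) ?p v' =
      derivative (\<lambda>v. ?E (v @ [br x y] @ w)) ?p v'"
    unfolding derivative_diff[symmetric] by (rule derivative_cong) (rule IH')
  have 2: "derivative (\<lambda>w. ?E (v' @ [x, y] @ w)) ?p w - derivative (\<lambda>w. ?E (v' @ [y, x] @ w)) ?p w =
      derivative (\<lambda>w. ?E (v' @ [br x y] @ w)) ?p w"
    unfolding derivative_diff[symmetric] by (rule derivative_cong) (rule IH)
  have "br ?p (br x y) = br (br ?p x) y + br x (br ?p y)" by (simp add: br_br)
  then have 3: "?E (v' @ [br ?p (br x y)] @ w) = ?E (v' @ [br (br ?p x) y] @ w) + ?E (v' @ [br x (br ?p y)] @ w)"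
    using expectation_add by simp
  have expand2: "?E (v @ [a, b] @ w) = derivative (\<lambda>v. ?E (v @ [a, b] @ w)) ?p v'
      + ?E (v' @ [br ?p a, b] @ w) + ?E (v' @ [a, br ?p b] @ w)
      + derivative (\<lambda>w. ?E (v' @ [a, b] @ w)) ?p w + \<kappa> z * ?E (v' @ [a, b] @ w)" for a b
    unfolding v append_Cons expectation_Cons derivative_append by (simp add: derivative_Cons)
  have expand1: "?E (v @ [a] @ w) = derivative (\<lambda>v. ?E (v @ [a] @ w)) ?p v'
      + ?E (v' @ [br ?p a] @ w) + derivative (\<lambda>w. ?E (v' @ [a] @ w)) ?p w
      + \<kappa> z * ?E (v' @ [a] @ w)" for a
    unfolding v append_Cons expectation_Cons derivative_append by (simp add: derivative_Cons)
  show ?case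
    unfolding expand2 expand1 3
    using 1 2 IH[of x y w] IH[of "br ?p x" y w] IH[of x "br ?p y" w] by (simp add: algebra_simps)
qed

text \<open>The defining property of a vacuum vector: \<open>P\<close> acts on it through \<open>\<kappa>\<close>. A first letter of the word
  creates the additional last letter \<open>[z\<^sub>+, p]\<close>, which has expectation value zero by the hypothesis
  on \<open>P\<close>.\<close>

lemma expectation_vacuum:
  assumes P: "\<And>p z. p \<in> P \<Longrightarrow> br (pos z) p \<in> P \<and> \<kappa> (br (pos z) p) = 0" and "p \<in> P"
  shows "expectation (w @ [p]) = \<kappa> p * expectation w"
  using \<open>p \<in> P\<close>
proof (induction "length w" arbitrary: w p)
  case 0
  then show ?case by (simp add: expectation_Cons)
next
  case (Suc n)
  then obtain z w' where w: "w = z # w'" and n: "n = length w'" by (cases w) auto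
  have IH: "expectation (w'' @ [p]) = \<kappa> p * expectation w''"
    if "length w'' = length w'" "p \<in> P" for w'' p
    using Suc.hyps(1)[of w''] that n by simp
  have "derivative (\<lambda>w. expectation (w @ [p])) (pos z) w' = \<kappa> p * derivative expectation (pos z) w'"
    unfolding derivative_mult[symmetric] by (rule derivative_cong) (rule IH[OF _ Suc.prems])
  moreover have "expectation (w' @ [br (pos z) p]) = 0"
    using IH[of w' "br (pos z) p"] P[OF Suc.prems] by simp
  ultimately show ?case
    unfolding w append_Cons expectation_Cons derivative_append
    by (simp add: derivative_Cons IH[OF refl Suc.prems] algebra_simps)
qed

end

section \<open>Affine Lie algebras\<close>

lemma affine_induct [case_names mode central add]:
  assumes mode: "\<And>a n. P (mode a n)" and central: "\<And>c. P (0, c)"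
    and add: "\<And>x y. P x \<Longrightarrow> P y \<Longrightarrow> P (x + y)"
  shows "P (x :: 'g::ab_group_add affine)"
proof -
  have "P (f, 0)" for f :: "int \<Rightarrow>\<^sub>0 'g"
  proof (induction f rule: update_induct)
    case const
    show ?case by (rule central)
  next
    case (update f a b)
    have "Poly_Mapping.update a b f = f + Poly_Mapping.single a b"
      using update(1)
      by (intro poly_mapping_eqI) (auto simp: update.rep_eq lookup_add lookup_single when_def in_keys_iff)
    then have "(Poly_Mapping.update a b f, 0 :: complex) = (f, 0) + mode b a" by (simp add: mode_def)
    then show ?case using add[OF update(3) mode] by simp
  qed
  from add[OF this central] show ?thesis by (cases x) simp
qed

text \<open>The extension to Laurent polynomials of a family of maps on coefficients. Both components of the
  affine bracket have this shape.\<close>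

definition bilinear_extension ::
    "(int \<Rightarrow> int \<Rightarrow> 'a::ab_group_add \<Rightarrow> 'b::ab_group_add \<Rightarrow> 'c::ab_group_add) \<Rightarrow>
      (int \<Rightarrow>\<^sub>0 'a) \<Rightarrow> (int \<Rightarrow>\<^sub>0 'b) \<Rightarrow> 'c" where
  "bilinear_extension F f g = (\<Sum>n\<in>Poly_Mapping.keys f. \<Sum>m\<in>Poly_Mapping.keys g.
     F n m (Poly_Mapping.lookup f n) (Poly_Mapping.lookup g m))"

lemma bilinear_extension_add_left:
  assumes "\<And>n m x y z. F n m (x + y) z = F n m x z + F n m y z"
  shows "bilinear_extension F (f + f') g = bilinear_extension F f g + bilinear_extension F f' g"
proof -
  have "F n m 0 z = 0" for n m z using assms[of n m 0 0 z] by simp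
  then show ?thesis unfolding bilinear_extension_def
    by (intro setsum_keys_plus_distrib[of "\<lambda>n x. \<Sum>m\<in>Poly_Mapping.keys g. F n m x (Poly_Mapping.lookup g m)"])
      (simp_all add: assms sum.distrib)
qed

lemma bilinear_extension_add_right:
  assumes "\<And>n m x y z. F n m z (x + y) = F n m z x + F n m z y"
  shows "bilinear_extension F f (g + g') = bilinear_extension F f g + bilinear_extension F f g'"
proof -
  have "F n m z 0 = 0" for n m z using assms[of n m z 0 0] by simp
  then show ?thesis unfolding bilinear_extension_def sum.distrib[symmetric]
    by (intro sum.cong refl setsum_keys_plus_distrib) (simp_all add: assms)
qed

lemma bilinear_extension_single:
  assumes "\<And>n m z. F n m 0 z = 0" "\<And>n m z. F n m z 0 = 0"
  shows "bilinear_extension F (Poly_Mapping.single n x) (Poly_Mapping.single m y) = F n m x y"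
  by (simp add: bilinear_extension_def assms)

context invariant_form_lie_algebra
begin

abbreviation abr :: "'g affine \<Rightarrow> 'g affine \<Rightarrow> 'g affine" where
  "abr \<equiv> affine_br br form"

abbreviation ascale :: "complex \<Rightarrow> 'g affine \<Rightarrow> 'g affine" where
  "ascale \<equiv> affine_scale scale"

lemma affine_br_eq:
  "abr (f, a) (g, b) =
    (bilinear_extension (\<lambda>n m x y. Poly_Mapping.single (n + m) (br x y)) f g,
     bilinear_extension (\<lambda>n m x y. if n + m = 0 then of_int n * form x y else 0) f g)"
  by (simp add: affine_br_def bilinear_extension_def)

lemma affine_br_add_left: "abr (x + y) z = abr x z + abr y z"
  by (cases x; cases y; cases z)
    (simp add: affine_br_eq bilinear_extension_add_left br_add_left single_add form_add_left distrib_left)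

lemma affine_br_add_right: "abr z (x + y) = abr z x + abr z y"
  by (cases x; cases y; cases z)
    (simp add: affine_br_eq bilinear_extension_add_right br_add_right single_add form_add_right distrib_left)

lemma affine_br_zero [simp]: "abr 0 x = 0" "abr x 0 = 0"
  using affine_br_add_left[of 0 0 x] affine_br_add_right[of x 0 0] by simp_all

lemma affine_br_mode:
  "abr (mode a n) (mode b m) =
    (Poly_Mapping.single (n + m) (br a b), if n + m = 0 then of_int n * form a b else 0)"
  by (simp add: mode_def affine_br_eq bilinear_extension_single)

lemma affine_br_central [simp]: "abr (0, c) x = 0" "abr x (0, c) = 0"
  by (cases x; simp add: affine_br_eq bilinear_extension_def zero_prod_def)+

lemma mode_add: "mode (a + b) n = mode a n + mode b n"
  by (simp add: mode_def single_add)

lemma affine_scale_mode: "ascale c (mode a n) = mode (c *s a) n"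
  by (simp add: affine_scale_def mode_def)

lemma affine_scale_central: "ascale c (0, a) = (0, c * a)"
  by (simp add: affine_scale_def map_eq_zero_iff)

lemma vector_space_affine: "vector_space ascale"
proof
  fix a b and x y :: "'g affine"
  have lookup: "Poly_Mapping.lookup (Poly_Mapping.map (scale a) f) k = a *s Poly_Mapping.lookup f k"
    for a k and f :: "int \<Rightarrow>\<^sub>0 'g"
    by (simp add: map.rep_eq when_def)
  show "ascale a (x + y) = ascale a x + ascale a y"
    by (cases x; cases y) (auto simp: affine_scale_def lookup lookup_add scale_right_distrib
        distrib_left intro!: poly_mapping_eqI)
  show "ascale (a + b) x = ascale a x + ascale b x"
    by (cases x) (auto simp: affine_scale_def lookup lookup_add scale_left_distrib
        distrib_right intro!: poly_mapping_eqI)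
  show "ascale a (ascale b x) = ascale (a * b) x"
    by (cases x) (auto simp: affine_scale_def lookup intro!: poly_mapping_eqI)
  show "ascale 1 x = x"
    by (cases x) (auto simp: affine_scale_def lookup intro!: poly_mapping_eqI)
qed

interpretation affine: vector_space ascale by (rule vector_space_affine)

lemma affine_br_scale_left: "abr (ascale c x) y = ascale c (abr x y)"
proof (induction x rule: affine_induct)
  case (mode a n)
  show ?case
  proof (induction y rule: affine_induct)
    case (mode b m)
    show ?case
      by (simp add: affine_scale_mode affine_br_mode br_scale_left form_scale_left)
        (simp add: affine_scale_def)
  qed (simp_all add: affine_br_add_right affine.scale_right_distrib)
qed (simp_all add: affine_br_add_left affine.scale_right_distrib affine_scale_central)

lemma affine_br_skew: "abr y x = - abr x y"
proof (induction x rule: affine_induct)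
  case (mode a n)
  show ?case
  proof (induction y rule: affine_induct)
    case (mode b m)
    have "of_int m * form b a = - (of_int n * form a b)" if "n + m = 0"
      using that form_sym[of b a] by (simp add: eq_neg_iff_add_eq_0[symmetric])
    then show ?case
      by (auto simp: affine_br_mode br_swap[of b a] single_uminus[symmetric] add.commute)
  qed (simp_all add: affine_br_add_right affine_br_add_left)
qed (simp_all add: affine_br_add_left affine_br_add_right)

lemma affine_br_self: "abr x x = 0"
proof -
  have "abr x x + abr x x = 0" using affine_br_skew[of x x] by (metis add.right_inverse)
  then have "ascale 2 (abr x x) = 0" using affine.scale_left_distrib[of 1 1 "abr x x"] by simp
  then show ?thesis by simp
qed

text \<open>For three modes the central component is \<open>(n + m + k)\<langle>a, [b,c]\<rangle>\<close>, by invariance of the form, and it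
  only occurs when \<open>n + m + k = 0\<close>.\<close>

lemma affine_br_jacobi: "abr x (abr y z) + abr y (abr z x) + abr z (abr x y) = 0" (is "?J x y z = 0")
proof -
  have add: "?J (x + x') y z = ?J x y z + ?J x' y z" "?J x (y + y') z = ?J x y z + ?J x y' z"
    "?J x y (z + z') = ?J x y z + ?J x y z'" for x x' y y' z z'
    by (simp_all add: affine_br_add_left affine_br_add_right algebra_simps)
  show ?thesis
  proof (induction x rule: affine_induct)
    case (mode a n)
    show ?case
    proof (induction y rule: affine_induct)
      case (mode b m)
      show ?case
      proof (induction z rule: affine_induct)
        case (mode c k)
        have split: "abr (mode a n) (Poly_Mapping.single l v, w) = abr (mode a n) (mode v l)" for a n l v w
        proof -
          have "(Poly_Mapping.single l v, w) = mode v l + (0, w)" by (simp add: mode_def)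
          then show ?thesis by (simp add: affine_br_add_right)
        qed
        have f: "form b (br c a) = form a (br b c)" "form c (br a b) = form a (br b c)"
          using form_invariant[of b c a] form_sym[of "br b c" a] form_invariant[of a b c]
            form_sym[of "br a b" c] by simp_all
        have j: "Poly_Mapping.single (n + (m + k)) (br a (br b c)) +
            Poly_Mapping.single (m + (k + n)) (br b (br c a)) +
            Poly_Mapping.single (k + (n + m)) (br c (br a b)) = 0"
        proof -
          have "m + (k + n) = n + (m + k)" "k + (n + m) = n + (m + k)" by simp_all
          then show ?thesis using br_jacobi[of a b c] by (simp only: single_add[symmetric]) simp
        qed
        have "of_int n + of_int m + of_int k = (0::complex)" if "n + (m + k) = 0"
        proof -
          have "of_int (n + (m + k)) = (0::complex)" unfolding that by simp
          then show ?thesis by (simp add: add.assoc)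
        qed
        then have "(of_int n + of_int m + of_int k) * form a (br b c) = 0" if "n + (m + k) = 0"
          using that by simp
        then show ?case
          unfolding affine_br_mode split using j
          by (auto simp: f algebra_simps zero_prod_def)
      qed (simp_all add: add del: add.assoc)
    qed (simp_all add: add)
  qed (simp_all add: add)
qed

lemma affine_br_scale_right: "abr x (ascale c y) = ascale c (abr x y)"
  using affine_br_skew[of "ascale c y" x] affine_br_skew[of y x]
  by (simp add: affine_br_scale_left)

definition positive_part :: "'g affine \<Rightarrow> 'g affine" where
  "positive_part = (\<lambda>(f, c). (Poly_Mapping.mapp (\<lambda>n x. if n > 0 then x else 0) f, 0))"

definition nonneg_part :: "'g affine \<Rightarrow> 'g affine" where
  "nonneg_part = (\<lambda>(f, c). (Poly_Mapping.mapp (\<lambda>n x. if n \<ge> 0 then x else 0) f, c))"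

lemma lookup_restriction:
  "Poly_Mapping.lookup (Poly_Mapping.mapp (\<lambda>n x. if Q n then x else 0) f) k =
    (if Q k then Poly_Mapping.lookup f k else (0 :: 'g))"
  by (auto simp: lookup_mapp when_def in_keys_iff)

lemma positive_part_add: "positive_part (x + y) = positive_part x + positive_part y"
  by (cases x; cases y) (auto simp: positive_part_def lookup_restriction lookup_add intro!: poly_mapping_eqI)

lemma positive_part_scale: "positive_part (ascale c x) = ascale c (positive_part x)"
  by (cases x) (auto simp: positive_part_def affine_scale_def lookup_restriction map.rep_eq when_def
      intro!: poly_mapping_eqI)

lemma positive_part_mode: "positive_part (mode a n) = (if n > 0 then mode a n else 0)"
  by (auto simp: positive_part_def mode_def lookup_restriction lookup_single when_def zero_prod_def
      intro!: poly_mapping_eqI)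

lemma positive_part_central [simp]: "positive_part (0, c) = 0"
  by (auto simp: positive_part_def lookup_restriction zero_prod_def intro!: poly_mapping_eqI)

lemma positive_part_zero [simp]: "positive_part 0 = 0"
  using positive_part_central[of 0] by (simp add: zero_prod_def)

lemma nonneg_part_add: "nonneg_part (x + y) = nonneg_part x + nonneg_part y"
  by (cases x; cases y) (auto simp: nonneg_part_def lookup_restriction lookup_add intro!: poly_mapping_eqI)

lemma nonneg_part_mode: "nonneg_part (mode a n) = (if n \<ge> 0 then mode a n else 0)"
  by (auto simp: nonneg_part_def mode_def lookup_restriction lookup_single when_def zero_prod_def
      intro!: poly_mapping_eqI)

lemma nonneg_part_central: "nonneg_part (0, c) = (0, c)"
  by (auto simp: nonneg_part_def lookup_restriction intro!: poly_mapping_eqI)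

lemma nonneg_part_eq: "x \<in> affine_nonneg \<Longrightarrow> nonneg_part x = x"
  by (cases x) (fastforce simp: nonneg_part_def affine_nonneg_def lookup_restriction in_keys_iff
      intro!: poly_mapping_eqI)

lemma affine_nonneg_add: "x \<in> affine_nonneg \<Longrightarrow> y \<in> affine_nonneg \<Longrightarrow> x + y \<in> (affine_nonneg :: 'g affine set)"
  using keys_add by (cases x; cases y) (fastforce simp: affine_nonneg_def)

lemma single_in_affine_nonneg: "n \<ge> 0 \<Longrightarrow> (Poly_Mapping.single n a, c) \<in> affine_nonneg"
  by (simp add: affine_nonneg_def)

lemma positive_part_single: "positive_part (Poly_Mapping.single n a, c) = (if n > 0 then mode a n else 0)"
proof -
  have "(Poly_Mapping.single n a, c) = mode a n + (0, c)" by (simp add: mode_def)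
  then show ?thesis by (simp add: positive_part_add positive_part_mode)
qed

lemma affine_br_single:
  "abr (mode a n) (Poly_Mapping.single m b, c) = abr (mode a n) (mode b m)"
proof -
  have "(Poly_Mapping.single m b, c) = mode b m + (0, c)" by (simp add: mode_def)
  then show ?thesis by (simp add: affine_br_add_right)
qed

lemma pos_bracket: "positive_part (abr (positive_part x) (positive_part y)) = abr (positive_part x) (positive_part y) \<and> snd (abr (positive_part x) (positive_part y)) = 0"
proof (induction x rule: affine_induct)
  case (mode a n)
  show ?case
  proof (induction y rule: affine_induct)
    case (mode b m)
    show ?case by (auto simp: positive_part_mode affine_br_mode positive_part_single) (simp add: mode_def)
  qed (simp_all add: positive_part_add affine_br_add_right)
qed (simp_all add: positive_part_add affine_br_add_left)

text \<open>Two nonpositive modes have degrees summing to zero only if both degrees are zero, and then the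
  central term vanishes, too.\<close>

lemma nonpos_bracket: "positive_part (abr (x - positive_part x) (y - positive_part y)) = 0 \<and> snd (abr (x - positive_part x) (y - positive_part y)) = 0"
proof (induction x rule: affine_induct)
  case (mode a n)
  show ?case
  proof (induction y rule: affine_induct)
    case (mode b m)
    show ?case by (auto simp: positive_part_mode affine_br_mode positive_part_single)
  next
    case (add x y)
    have "x + y - positive_part (x + y) = (x - positive_part x) + (y - positive_part y)" by (simp add: positive_part_add algebra_simps)
    then show ?case using add by (simp only: affine_br_add_right positive_part_add) simp
  qed simp_all
next
  case (add x y)
  have "x + y - positive_part (x + y) = (x - positive_part x) + (y - positive_part y)" by (simp add: positive_part_add algebra_simps)
  then show ?case using add by (simp only: affine_br_add_left positive_part_add) simp
qed simp_all

lemma pos_nonneg_bracket: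
  assumes "p \<in> affine_nonneg"
  shows "abr (positive_part z) p \<in> affine_nonneg \<and> snd (abr (positive_part z) p) = 0"
proof -
  have zero: "(0 :: 'g affine) \<in> affine_nonneg" by (simp add: zero_prod_def affine_nonneg_def)
  have "abr (positive_part z) (nonneg_part p) \<in> affine_nonneg \<and> snd (abr (positive_part z) (nonneg_part p)) = 0"
  proof (induction z rule: affine_induct)
    case (mode a n)
    show ?case
    proof (induction p rule: affine_induct)
      case (mode b m)
      show ?case by (auto simp: positive_part_mode nonneg_part_mode affine_br_mode single_in_affine_nonneg zero)
    qed (simp_all add: nonneg_part_add affine_br_add_right affine_nonneg_add nonneg_part_central zero)
  qed (simp_all add: positive_part_add affine_br_add_left affine_nonneg_add zero)
  then show ?thesis using nonneg_part_eq[OF assms] by simp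
qed

text \<open>Two copies of the affine Lie algebra, with levels \<open>k\<close> and \<open>l\<close>. The diagonal copy inside has level
  \<open>k + l\<close>.\<close>

definition pair_scale :: "complex \<Rightarrow> 'g affine \<times> 'g affine \<Rightarrow> 'g affine \<times> 'g affine" where
  "pair_scale c x = (ascale c (fst x), ascale c (snd x))"

definition pair_br :: "'g affine \<times> 'g affine \<Rightarrow> 'g affine \<times> 'g affine \<Rightarrow> 'g affine \<times> 'g affine" where
  "pair_br x y = (abr (fst x) (fst y), abr (snd x) (snd y))"

definition pair_pos :: "'g affine \<times> 'g affine \<Rightarrow> 'g affine \<times> 'g affine" where
  "pair_pos x = (positive_part (fst x), positive_part (snd x))"

definition pair_level :: "complex \<Rightarrow> complex \<Rightarrow> 'g affine \<times> 'g affine \<Rightarrow> complex" where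
  "pair_level k l x = k * snd (fst x) + l * snd (snd x)"

lemma snd_ascale: "snd (ascale c x) = c * snd x"
  by (cases x) (simp add: affine_scale_def)

lemma triangular_pair: "triangular_lie_algebra pair_scale pair_br pair_pos (pair_level k l)"
proof -
  show ?thesis
    by unfold_locales
      (auto simp: pair_scale_def pair_br_def pair_pos_def pair_level_def prod_eq_iff[symmetric]
        affine.scale_right_distrib affine.scale_left_distrib affine_br_add_left affine_br_add_right
        affine_br_scale_left affine_br_scale_right affine_br_self affine_br_jacobi
        positive_part_add positive_part_scale pos_bracket nonpos_bracket snd_ascale zero_prod_def[symmetric] distrib_left)
qed

text \<open>The matrix coefficient of a word, acting diagonally on the tensor product of vacuum modules of
  levels \<open>k\<close> and \<open>l\<close>, that is obtained by applying \<open>a(1)\<close> in the first factor and \<open>b(1)\<close> in the second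
  one.\<close>

definition word_functional :: "complex \<Rightarrow> complex \<Rightarrow> 'g \<Rightarrow> 'g \<Rightarrow> 'g affine list \<Rightarrow> complex" where
  "word_functional k l a b w =
    triangular_lie_algebra.expectation pair_br pair_pos (pair_level k l)
      ([(mode a 1, 0), (0, mode b 1)] @ map (\<lambda>x. (x, x)) w)"

lemma word_functional_letter:
  "word_functional k l a b (v @ [x + y] @ w) =
    word_functional k l a b (v @ [x] @ w) + word_functional k l a b (v @ [y] @ w)"
  "word_functional k l a b (v @ [ascale c x] @ w) = c * word_functional k l a b (v @ [x] @ w)"
  "word_functional k l a b (v @ [x, y] @ w) - word_functional k l a b (v @ [y, x] @ w) =
    word_functional k l a b (v @ [abr x y] @ w)"
  "p \<in> affine_nonneg \<Longrightarrow> word_functional k l a b (w @ [p]) = snd p * (k + l) * word_functional k l a b w"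
proof -
  interpret T: triangular_lie_algebra pair_scale pair_br pair_pos "pair_level k l" by (rule triangular_pair)
  let ?p = "[(mode a 1, 0), (0, mode b 1)]" and ?d = "\<lambda>x::'g affine. (x, x)"
  note wf = word_functional_def
  show "word_functional k l a b (v @ [x + y] @ w) =
      word_functional k l a b (v @ [x] @ w) + word_functional k l a b (v @ [y] @ w)"
    using T.expectation_add[of "?p @ map ?d v" "?d x" "?d y" "map ?d w"] by (simp add: wf)
  show "word_functional k l a b (v @ [ascale c x] @ w) = c * word_functional k l a b (v @ [x] @ w)"
    using T.expectation_scale[of "?p @ map ?d v" c "?d x" "map ?d w"] by (simp add: wf pair_scale_def)
  show "word_functional k l a b (v @ [x, y] @ w) - word_functional k l a b (v @ [y, x] @ w) =
      word_functional k l a b (v @ [abr x y] @ w)"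
    using T.expectation_bracket[of "?p @ map ?d v" "?d x" "?d y" "map ?d w"] by (simp add: wf pair_br_def)
  assume "p \<in> affine_nonneg"
  then have "T.expectation ((?p @ map ?d w) @ [?d p]) = pair_level k l (?d p) * T.expectation (?p @ map ?d w)"
    by (intro T.expectation_vacuum[where P = "affine_nonneg \<times> affine_nonneg"])
      (auto simp: pair_br_def pair_pos_def pair_level_def pos_nonneg_bracket)
  then show "word_functional k l a b (w @ [p]) = snd p * (k + l) * word_functional k l a b w"
    by (simp add: wf pair_level_def algebra_simps)
qed

text \<open>In the tensor product the word splits its two letters between the factors, in two ways; each
  way gives a product of two pairings, one of level \<open>k\<close> and one of level \<open>l\<close>.\<close>

lemma word_functional_value:
  "word_functional k l a b [mode c (- 1), mode d (- 1)] =
    k * l * (form a c * form b d + form a d * form b c)"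
proof -
  interpret T: triangular_lie_algebra pair_scale pair_br pair_pos "pair_level k l" by (rule triangular_pair)
  have z: "T.expectation ((0, 0) # w) = 0" "T.expectation (x # (0, 0) # w) = 0" for x w
    using T.expectation_zero[of "[]" w] T.expectation_zero[of "[x]" w] by (simp_all add: zero_prod_def)
  have snd_mode: "snd (mode x n) = 0" for x :: 'g and n by (simp add: mode_def)
  show ?thesis
    unfolding word_functional_def
    by (simp add: T.expectation_Cons T.derivative_Cons pair_br_def pair_pos_def pair_level_def
        positive_part_mode positive_part_single affine_br_mode affine_br_single z snd_mode algebra_simps)
qed

end

section \<open>Linear functionals on induced modules\<close>

definition free_extension ::
    "(complex \<Rightarrow> 'v::ab_group_add \<Rightarrow> 'v) \<Rightarrow> ('x \<Rightarrow> 'v) \<Rightarrow> ('x \<Rightarrow>\<^sub>0 complex) \<Rightarrow> 'v" where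
  "free_extension s \<psi> F = (\<Sum>x\<in>Poly_Mapping.keys F. s (Poly_Mapping.lookup F x) (\<psi> x))"

lemma lookup_free_scale: "Poly_Mapping.lookup (free_scale c F) x = c * Poly_Mapping.lookup F x"
  by (simp add: free_scale_def map.rep_eq when_def)

lemma vector_space_free_scale: "vector_space free_scale"
  by unfold_locales
    (auto simp: lookup_free_scale lookup_add algebra_simps intro!: poly_mapping_eqI)

lemma linear_free_extension:
  assumes "vector_space s"
  shows "Vector_Spaces.linear free_scale s (free_extension s \<psi>)"
proof -
  interpret f: vector_space free_scale by (rule vector_space_free_scale)
  interpret v: vector_space s by fact
  show ?thesis
  proof unfold_locales
    show "free_extension s \<psi> (F + G) = free_extension s \<psi> F + free_extension s \<psi> G" for F G
      unfolding free_extension_def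
      by (rule setsum_keys_plus_distrib) (simp_all add: v.scale_left_distrib)
    show "free_extension s \<psi> (free_scale c F) = s c (free_extension s \<psi> F)" for c F
    proof -
      have "free_extension s \<psi> (free_scale c F) =
          (\<Sum>x\<in>Poly_Mapping.keys F. s (Poly_Mapping.lookup (free_scale c F) x) (\<psi> x))"
        unfolding free_extension_def
        by (rule sum.mono_neutral_left) (auto simp: in_keys_iff lookup_free_scale)
      also have "\<dots> = s c (free_extension s \<psi> F)"
        unfolding free_extension_def v.scale_sum_right
        by (intro sum.cong refl) (simp add: lookup_free_scale)
      finally show ?thesis .
    qed
  qed
qed

lemma free_extension_single:
  assumes "vector_space s"
  shows "free_extension s \<psi> (Poly_Mapping.single x c) = s c (\<psi> x)"
proof -
  interpret v: vector_space s by fact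
  show ?thesis by (simp add: free_extension_def)
qed

text \<open>A function on words that respects the relations descends to the induced module. It is phrased
  for linear dependencies, the form in which it is applied.\<close>

lemma induced_module_functional:
  fixes \<psi> :: "'l::ab_group_add list \<Rightarrow> 'm::ab_group_add \<Rightarrow> complex"
  assumes ind: "induced_module scaleL brL P scaleM actM scaleV act tens"
    and \<psi>: "\<And>v x y w m. \<psi> (v @ [x + y] @ w) m = \<psi> (v @ [x] @ w) m + \<psi> (v @ [y] @ w) m"
      "\<And>v c x w m. \<psi> (v @ [scaleL c x] @ w) m = c * \<psi> (v @ [x] @ w) m"
      "\<And>v x y w m. \<psi> (v @ [x, y] @ w) m - \<psi> (v @ [y, x] @ w) m = \<psi> (v @ [brL x y] @ w) m"
      "\<And>w m n. \<psi> w (m + n) = \<psi> w m + \<psi> w n"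
      "\<And>w c m. \<psi> w (scaleM c m) = c * \<psi> w m"
      "\<And>w p m. p \<in> P \<Longrightarrow> \<psi> (w @ [p]) m = \<psi> w (actM p m)"
    and zero: "(\<Sum>i\<in>I. scaleV (c i) (tens (w i) (m i))) = 0"
  shows "(\<Sum>i\<in>I. c i * \<psi> (w i) (m i)) = 0"
proof -
  have V: "vector_space scaleV" using ind by (simp add: induced_module_def)
  have C: "vector_space ((*) :: complex \<Rightarrow> complex \<Rightarrow> complex)" by unfold_locales (auto simp: algebra_simps)
  interpret V: vector_space scaleV by (rule V)
  let ?E = "free_extension scaleV (\<lambda>(w, m). tens w m)" and ?F = "free_extension (*) (\<lambda>(w, m). \<psi> w m)"
  interpret E: Vector_Spaces.linear free_scale scaleV ?E by (rule linear_free_extension[OF V])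
  interpret F: Vector_Spaces.linear free_scale "(*)" ?F by (rule linear_free_extension[OF C])
  let ?G = "\<Sum>i\<in>I. free_scale (c i) (symb (w i) (m i))"
  note singles = free_extension_single[OF V] free_extension_single[OF C]
  have "?E ?G = 0"
    using zero by (simp add: E.sum E.scale singles V.scale_one)
  then have "?G \<in> module.span free_scale (induced_relations scaleL brL P scaleM actM)"
    using ind unfolding induced_module_def free_extension_def by (simp add: case_prod_unfold)
  moreover have "?F R = 0" if "R \<in> induced_relations scaleL brL P scaleM actM" for R
    using that by induction (simp_all add: F.diff F.scale singles \<psi>[simplified] \<psi>)
  ultimately have "?F ?G = 0" by (rule F.eq_0_on_span[rotated])
  then show ?thesis by (simp add: F.sum F.scale singles)
qed

section \<open>Universal affine vertex algebras\<close>

locale affine_vacuum_module = invariant_form_lie_algebra scale br form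
  for scale :: "complex \<Rightarrow> 'g::ab_group_add \<Rightarrow> 'g" (infixr \<open>*s\<close> 75)
    and br :: "'g \<Rightarrow> 'g \<Rightarrow> 'g"
    and form :: "'g \<Rightarrow> 'g \<Rightarrow> complex" +
  fixes lev :: complex
    and scaleV :: "complex \<Rightarrow> 'v::ab_group_add \<Rightarrow> 'v" (infixr \<open>\<odot>\<close> 75)
    and act :: "'g affine \<Rightarrow> 'v \<Rightarrow> 'v" and tens :: "'g affine list \<Rightarrow> complex \<Rightarrow> 'v"
  assumes universal: "universal_affine_module scale br form lev scaleV act tens"
begin

lemma induced: "induced_module ascale abr affine_nonneg (*) (\<lambda>(f, c) z. c * lev * z) scaleV act tens"
  using universal by (simp add: universal_affine_module_def)

sublocale V: vector_space scaleV
  using induced by (simp add: induced_module_def)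

lemma tens_relation:
  assumes "R \<in> induced_relations ascale abr affine_nonneg (*) (\<lambda>(f, c) z. c * lev * z)"
  shows "free_extension scaleV (\<lambda>(w, m). tens w m) R = 0"
proof -
  interpret f: vector_space free_scale by (rule vector_space_free_scale)
  have "R \<in> f.span (induced_relations ascale abr affine_nonneg (*) (\<lambda>(f, c) z. c * lev * z))"
    using assms by (rule f.span_base)
  then show ?thesis
    using induced unfolding induced_module_def free_extension_def by (simp add: case_prod_unfold)
qed

lemma tens_relations:
  "tens (v @ [x + y] @ w) m = tens (v @ [x] @ w) m + tens (v @ [y] @ w) m"
  "tens (v @ [ascale c x] @ w) m = c \<odot> tens (v @ [x] @ w) m"
  "tens (v @ [x, y] @ w) m - tens (v @ [y, x] @ w) m = tens (v @ [abr x y] @ w) m"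
  "tens w (c * m) = c \<odot> tens w m"
  "p \<in> affine_nonneg \<Longrightarrow> tens (w @ [p]) m = tens w (snd p * lev * m)"
proof -
  interpret E: Vector_Spaces.linear free_scale scaleV "free_extension scaleV (\<lambda>(w, m). tens w m)"
    by (rule linear_free_extension[OF V.vector_space_axioms])
  note simps = E.diff E.scale free_extension_single[OF V.vector_space_axioms]
  show "tens (v @ [x + y] @ w) m = tens (v @ [x] @ w) m + tens (v @ [y] @ w) m"
    using tens_relation[OF induced_relations.letter_add, of v x y w m] by (simp add: simps diff_eq_eq add.commute)
  show "tens (v @ [ascale c x] @ w) m = c \<odot> tens (v @ [x] @ w) m"
    using tens_relation[OF induced_relations.letter_scale, of v c x w m] by (simp add: simps)
  show "tens (v @ [x, y] @ w) m - tens (v @ [y, x] @ w) m = tens (v @ [abr x y] @ w) m"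
    using tens_relation[OF induced_relations.bracket, of v x y w m] by (simp add: simps)
  show "tens w (c * m) = c \<odot> tens w m"
    using tens_relation[OF induced_relations.vector_scale, of w c m] by (simp add: simps)
  assume "p \<in> affine_nonneg"
  from tens_relation[OF induced_relations.balanced[OF this], of w m]
  show "tens (w @ [p]) m = tens w (snd p * lev * m)" by (cases p) (simp add: simps)
qed

lemma linear_act: "Vector_Spaces.linear scaleV scaleV (act x)"
  using induced unfolding induced_module_def by blast

lemma act_tens: "act x (tens w m) = tens (x # w) m"
  using induced unfolding induced_module_def by blast

lemma act_add_right: "act x (v + w) = act x v + act x w"
proof -
  interpret a: Vector_Spaces.linear scaleV scaleV "act x" by (rule linear_act)
  show ?thesis by (rule a.add)
qed

lemma act_scale_right: "act x (c \<odot> v) = c \<odot> act x v"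
proof -
  interpret a: Vector_Spaces.linear scaleV scaleV "act x" by (rule linear_act)
  show ?thesis by (rule a.scale)
qed

lemma act_zero_right [simp]: "act x 0 = 0"
  using act_add_right[of x 0 0] by simp

lemma act_diff_right: "act x (v - w) = act x v - act x w"
  using act_add_right[of x "v - w" w] by simp

lemma act_sum_right: "act x (\<Sum>i\<in>I. f i) = (\<Sum>i\<in>I. act x (f i))"
  by (induction I rule: infinite_finite_induct) (auto simp: act_add_right)

lemma tens_induct [case_names tens add scale]:
  assumes "\<And>w m. P (tens w m)" "\<And>v w. P v \<Longrightarrow> P w \<Longrightarrow> P (v + w)" "\<And>c v. P v \<Longrightarrow> P (c \<odot> v)"
  shows "P v"
proof -
  have "v \<in> V.span {tens w m | w m. True}" using induced by (simp add: induced_module_def)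
  then show ?thesis
  proof (induction rule: V.span_induct_alt)
    case base
    show ?case using assms(3)[OF assms(1), of 0] by simp
  next
    case (step c x y)
    then show ?case using assms by blast
  qed
qed

lemma act_add_left: "act (x + y) v = act x v + act y v"
proof (induction v rule: tens_induct)
  case (tens w m)
  show ?case using tens_relations(1)[of "[]" x y w m] by (simp add: act_tens)
qed (simp_all add: act_add_right act_scale_right V.scale_right_distrib)

lemma act_zero_left [simp]: "act 0 v = 0"
  using act_add_left[of 0 0 v] by simp

lemma act_scale_left: "act (ascale c x) v = c \<odot> act x v"
proof (induction v rule: tens_induct)
  case (tens w m)
  show ?case using tens_relations(2)[of "[]" c x w m] by (simp add: act_tens)
qed (simp_all add: act_add_right act_scale_right V.scale_right_distrib mult.commute)

lemma act_bracket: "act x (act y v) - act y (act x v) = act (abr x y) v"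
proof (induction v rule: tens_induct)
  case (tens w m)
  show ?case using tens_relations(3)[of "[]" x y w m] by (simp add: act_tens)
next
  case (add v w)
  then show ?case by (simp add: act_add_right algebra_simps)
next
  case (scale c v)
  then show ?case by (simp add: act_scale_right V.scale_right_diff_distrib[symmetric])
qed

abbreviation vac :: 'v where "vac \<equiv> tens [] 1"

lemma tens_Nil: "tens [] m = m \<odot> vac"
  using tens_relations(4)[of "[]" m 1] by simp

lemma act_nonneg_vac: "p \<in> affine_nonneg \<Longrightarrow> act p vac = (snd p * lev) \<odot> vac"
  using tens_relations(5)[of p "[]" 1] tens_Nil[of "snd p * lev"] by (simp add: act_tens)

lemma act_central: "act (0, c) v = (c * lev) \<odot> v"
proof (induction v rule: tens_induct)
  case (tens w m)
  show ?case
  proof (induction w)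
    case Nil
    have "act (0, c) vac = (c * lev) \<odot> vac" by (subst act_nonneg_vac) (simp_all add: affine_nonneg_def)
    then show ?case unfolding tens_Nil[of m] by (simp add: act_scale_right mult.commute)
  next
    case (Cons x w)
    have "act (0, c) (act x (tens w m)) = act x (act (0, c) (tens w m))"
      using act_bracket[of "(0, c)" x "tens w m"] by simp
    then show ?case using Cons by (simp add: act_tens[symmetric] act_scale_right)
  qed
qed (simp_all add: act_add_right act_scale_right V.scale_right_distrib mult.commute)

abbreviation current :: "'g \<Rightarrow> int \<Rightarrow> 'v \<Rightarrow> 'v" where
  "current a n \<equiv> act (mode a n)"

lemma current_add: "current (a + b) n v = current a n v + current b n v"
  by (simp add: mode_add act_add_left)

lemma current_scale: "current (c *s a) n v = c \<odot> current a n v"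
  by (simp add: affine_scale_mode[symmetric] act_scale_left)

lemma current_zero [simp]: "current 0 n v = 0"
  using current_add[of 0 0 n v] by simp

lemma current_sum: "current (\<Sum>i\<in>I. f i) n v = (\<Sum>i\<in>I. current (f i) n v)"
  by (induction I rule: infinite_finite_induct) (auto simp: current_add)

lemma current_nonneg_vac [simp]: "n \<ge> 0 \<Longrightarrow> current a n vac = 0"
  using act_nonneg_vac[of "mode a n"] by (simp add: mode_def affine_nonneg_def)

lemma current_commutator:
  "current a n (current b m v) = current b m (current a n v) + current (br a b) (n + m) v +
    (if n + m = 0 then of_int n * form a b * lev else 0) \<odot> v"
proof -
  have "abr (mode a n) (mode b m) = mode (br a b) (n + m) + (0, if n + m = 0 then of_int n * form a b else 0)"
    unfolding affine_br_mode by (simp add: mode_def)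
  then have "act (abr (mode a n) (mode b m)) v =
      current (br a b) (n + m) v + (if n + m = 0 then of_int n * form a b * lev else 0) \<odot> v"
    by (simp add: act_add_left act_central)
  then show ?thesis using act_bracket[of "mode a n" "mode b m" v] by (simp add: diff_eq_eq algebra_simps)
qed

definition lowering_words :: "('g \<times> nat) list set" where
  "lowering_words = {w. \<forall>(a, n)\<in>set w. n \<ge> 1}"

lemma monomial_vector_Nil: "monomial_vector act vac [] = vac"
  and monomial_vector_Cons:
    "monomial_vector act vac ((a, n) # w) = current a (- int n) (monomial_vector act vac w)"
  by (simp_all add: monomial_vector_def)

text \<open>The straightforward half of the Poincare-Birkhoff-Witt theorem: a nonnegative mode can be moved
  to the right through a monomial, where it dies on the vacuum, at the cost of shorter monomials.\<close>

lemma monomials_span: "V.span (monomial_vector act vac ` lowering_words) = UNIV"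
proof -
  let ?M = "monomial_vector act vac" and ?S = "V.span (monomial_vector act vac ` lowering_words)"
  have "vac \<in> ?M ` lowering_words"
    by (rule image_eqI[of _ _ "[]"]) (simp_all add: lowering_words_def monomial_vector_Nil)
  then have vacS: "vac \<in> ?S" by (rule V.span_base)
  have stable: "act x v \<in> ?S" if v: "v \<in> ?S" and x: "\<And>w. w \<in> lowering_words \<Longrightarrow> act x (?M w) \<in> ?S" for x v
  proof -
    interpret a: Vector_Spaces.linear scaleV scaleV "act x" by (rule linear_act)
    show ?thesis using v x by (induction rule: V.span_induct_alt)
      (auto simp: a.add a.scale intro: V.span_add V.span_scale V.span_zero)
  qed
  have neg: "current a (- int n) v \<in> ?S" if "v \<in> ?S" "n \<ge> 1" for a n v
  proof (rule stable[OF that(1)])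
    fix w assume "w \<in> lowering_words"
    then have "(a, n) # w \<in> lowering_words" using that by (simp add: lowering_words_def)
    then show "current a (- int n) (?M w) \<in> ?S"
      unfolding monomial_vector_Cons[symmetric] by (intro V.span_base) blast
  qed
  have cur: "current a n (?M w) \<in> ?S" if "w \<in> lowering_words" for a n w
    using that
  proof (induction w arbitrary: a n)
    case Nil
    show ?case
      using neg[OF vacS, of "nat (- n)" a] by (cases "n \<ge> 0") (simp_all add: monomial_vector_Nil V.span_zero)
  next
    case (Cons bm w)
    obtain b m where bm: "bm = (b, m)" by force
    have w: "w \<in> lowering_words" and "m \<ge> 1" using Cons.prems bm by (auto simp: lowering_words_def)
    show ?case
      unfolding bm monomial_vector_Cons current_commutator[of a n]
      by (intro V.span_add V.span_scale neg Cons.IH w \<open>m \<ge> 1\<close> V.span_base imageI)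
  qed
  have S: "act x v \<in> ?S" if "v \<in> ?S" for x v
  proof (induction x rule: affine_induct)
    case (mode a n)
    show ?case by (rule stable[OF that cur])
  next
    case (central c)
    show ?case unfolding act_central using that by (rule V.span_scale)
  next
    case (add x y)
    then show ?case unfolding act_add_left by (rule V.span_add)
  qed
  have "tens w m \<in> ?S" for w m
  proof (induction w)
    case Nil
    show ?case
      unfolding tens_Nil[of m] using vacS by (rule V.span_scale)
  next
    case (Cons x w)
    then show ?case using S by (simp add: act_tens[symmetric])
  qed
  then have "v \<in> ?S" for v by (induction v rule: tens_induct) (auto intro: V.span_add V.span_scale)
  then show ?thesis by auto
qed

abbreviation quadratic :: "'g \<Rightarrow> 'g \<Rightarrow> 'v" where
  "quadratic a b \<equiv> current a (- 1) (current b (- 1) vac)"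

lemma quadratic_commutator: "quadratic a b = quadratic b a + current (br a b) (- 2) vac"
  using current_commutator[of a "-1" b "-1" vac] by simp

text \<open>The level is split into nonzero parts \<open>k\<close> and \<open>l\<close>, so that the factor \<open>k l\<close> in
  \<open>word_functional_value\<close> can be cancelled, whatever the level.\<close>

lemma quadratic_independent:
  assumes zero: "(\<Sum>i\<in>I. c i \<odot> quadratic (f i) (g i)) = 0"
  shows "(\<Sum>i\<in>I. c i * (form a (f i) * form b (g i) + form a (g i) * form b (f i))) = 0"
proof -
  \<comment> \<open>The choice \<open>k = 1\<close> works unless the level is 1, which would leave \<open>l = 0\<close>.\<close>
  obtain k l where kl: "k + l = lev" "k \<noteq> 0" "l \<noteq> 0"
  proof (cases "lev = 1")
    case True
    then show ?thesis using that[of 2 "-1"] by simp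
  next
    case False
    then show ?thesis using that[of 1 "lev - 1"] by simp
  qed
  have zero': "(\<Sum>i\<in>I. c i \<odot> tens [mode (f i) (- 1), mode (g i) (- 1)] 1) = 0"
    using zero by (simp add: act_tens)
  have "(\<Sum>i\<in>I. c i * (1 * word_functional k l a b [mode (f i) (- 1), mode (g i) (- 1)])) = 0"
  proof (rule induced_module_functional[OF induced, where \<psi> = "\<lambda>w m. m * word_functional k l a b w", OF _ _ _ _ _ _ zero'])
    fix v x y w m
    show "m * word_functional k l a b (v @ [x, y] @ w) - m * word_functional k l a b (v @ [y, x] @ w) =
        m * word_functional k l a b (v @ [abr x y] @ w)"
      by (simp only: word_functional_letter(3)[symmetric] right_diff_distrib)
  next
    fix w m and p :: "'g affine" assume "p \<in> affine_nonneg"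
    from word_functional_letter(4)[OF this, of k l a b w]
    show "m * word_functional k l a b (w @ [p]) = (case p of (f, c) \<Rightarrow> \<lambda>z. c * lev * z) m * word_functional k l a b w"
      by (simp add: case_prod_unfold kl(1) algebra_simps)
  qed (simp_all only: word_functional_letter distrib_left distrib_right mult.left_commute mult.assoc)
  then have "k * l * (\<Sum>i\<in>I. c i * (form a (f i) * form b (g i) + form a (g i) * form b (f i))) = 0"
    unfolding word_functional_value sum_distrib_left by (simp add: mult.left_commute mult.assoc)
  then show ?thesis using kl by simp
qed

end

text \<open>What the vertex algebra has to know about the Lie algebra: an orthonormal basis, in the form of
  the expansion of vectors in it, and the Casimir eigenvalue on the adjoint module.\<close>

locale universal_affine_vertex_algebra = affine_vacuum_module scale br form lev scaleV act tens
  for scale :: "complex \<Rightarrow> 'g::ab_group_add \<Rightarrow> 'g" (infixr \<open>*s\<close> 75)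
    and br :: "'g \<Rightarrow> 'g \<Rightarrow> 'g"
    and form :: "'g \<Rightarrow> 'g \<Rightarrow> complex" and lev :: complex
    and scaleV :: "complex \<Rightarrow> 'v::ab_group_add \<Rightarrow> 'v" (infixr \<open>\<odot>\<close> 75)
    and act :: "'g affine \<Rightarrow> 'v \<Rightarrow> 'v" and tens :: "'g affine list \<Rightarrow> complex \<Rightarrow> 'v" +
  fixes h :: complex and u :: "'d::finite \<Rightarrow> 'g" and Y :: "'v \<Rightarrow> int \<Rightarrow> 'v \<Rightarrow> 'v"
  assumes noncritical: "lev + h \<noteq> 0"
    and casimir: "(\<Sum>i\<in>UNIV. br (br a (u i)) (u i)) = (2 * h) *s a"
    and form_u: "form (u i) (u j) = (if i = j then 1 else 0)"
    and expansion: "a = (\<Sum>i\<in>UNIV. form a (u i) *s u i)"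
    and vertex: "vertex_algebra scaleV vac Y"
    and Y_current: "Y (current a (- 1) vac) n v = current a n v"
begin

abbreviation \<omega> :: 'v where "\<omega> \<equiv> conformal_vector scaleV act vac u lev h"

abbreviation L :: "int \<Rightarrow> 'v \<Rightarrow> 'v" where "L \<equiv> virasoro_mode Y \<omega>"

lemma linear_Y: "Vector_Spaces.linear scaleV scaleV (Y v n)"
  and linear_Y_left: "Vector_Spaces.linear scaleV scaleV (\<lambda>v. Y v n w)"
  and Y_vacuum: "n \<ge> 0 \<Longrightarrow> Y v n vac = 0"
  using vertex by (auto simp: vertex_algebra_def)

text \<open>The Borcherds identity for \<open>u = a(-1)\<one>\<close> and \<open>k = 0\<close>, where the binomial coefficients on the right
  hand side vanish for \<open>i > 0\<close>.\<close>

lemma borcherds_commutator: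
  "Sum_any (\<lambda>i. (of_int m gchoose i) \<odot> Y (current a (int i) v) (m + n - int i) w) =
    current a m (Y v n w) - Y v n (current a m w)"
proof -
  let ?a = "current a (- 1) vac"
  have "Sum_any (\<lambda>i. (of_int m gchoose i) \<odot> Y (Y ?a (0 + int i) v) (m + n - int i) w) =
      Sum_any (\<lambda>i. ((- 1) ^ i * (of_int 0 gchoose i)) \<odot>
          (Y ?a (m + 0 - int i) (Y v (n + int i) w)
           - ((- 1) powi 0) \<odot> (Y v (n + 0 - int i) (Y ?a (m + int i) w))))"
    using vertex unfolding vertex_algebra_def by blast
  also have "\<dots> = (\<Sum>i\<in>{0}. ((- 1) ^ i * (of_int 0 gchoose i)) \<odot>
          (Y ?a (m + 0 - int i) (Y v (n + int i) w)
           - ((- 1) powi 0) \<odot> (Y v (n + 0 - int i) (Y ?a (m + int i) w))))"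
  proof (rule Sum_any.expand_superset)
    show "{i. ((- 1) ^ i * (of_int 0 gchoose i)) \<odot>
          (Y ?a (m + 0 - int i) (Y v (n + int i) w)
           - ((- 1) powi 0) \<odot> (Y v (n + 0 - int i) (Y ?a (m + int i) w))) \<noteq> 0} \<subseteq> {0}"
      by (auto simp: gbinomial_0_left split: if_splits)
  qed simp
  also have "\<dots> = current a m (Y v n w) - Y v n (current a m w)"
    by (simp add: Y_current)
  finally show ?thesis by (simp add: Y_current)
qed

text \<open>The tensor \<open>\<Sum> u\<^sup>j \<otimes> u\<^sup>j\<close> is invariant, because \<open>ad a\<close> has a skew-symmetric matrix in an
  orthonormal basis.\<close>

lemma quadratic_invariant: "(\<Sum>j\<in>UNIV. quadratic (u j) (br a (u j)) + quadratic (br a (u j)) (u j)) = 0"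
proof -
  let ?f = "\<lambda>j k. form (br a (u j)) (u k)"
  have f: "?f k j = - ?f j k" for j k
    by (simp add: form_invariant br_swap[of "u k" "u j"] form_minus_right)
  have "quadratic (u j) (br a (u j)) = (\<Sum>k\<in>UNIV. ?f j k \<odot> quadratic (u j) (u k))"
    and "quadratic (br a (u j)) (u j) = (\<Sum>k\<in>UNIV. ?f j k \<odot> quadratic (u k) (u j))" for j
    by (subst expansion[of "br a (u j)"], simp add: current_sum current_scale act_sum_right act_scale_right)+
  then have "(\<Sum>j\<in>UNIV. quadratic (u j) (br a (u j)) + quadratic (br a (u j)) (u j)) =
      (\<Sum>j\<in>UNIV. \<Sum>k\<in>UNIV. ?f j k \<odot> quadratic (u j) (u k)) + (\<Sum>j\<in>UNIV. \<Sum>k\<in>UNIV. ?f j k \<odot> quadratic (u k) (u j))"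
    by (simp add: sum.distrib)
  also have "(\<Sum>j\<in>UNIV. \<Sum>k\<in>UNIV. ?f j k \<odot> quadratic (u k) (u j)) =
      (\<Sum>k\<in>UNIV. \<Sum>j\<in>UNIV. - (?f k j \<odot> quadratic (u k) (u j)))"
  proof (subst sum.swap, intro sum.cong refl)
    fix j k show "?f j k \<odot> quadratic (u k) (u j) = - (?f k j \<odot> quadratic (u k) (u j))"
      unfolding f[of j k] by simp
  qed
  finally show ?thesis by (simp add: sum_negf)
qed

text \<open>In the middle equation \<open>a(1)\<close> meets the two factors of \<open>u\<^sup>j(-1)u\<^sup>j(-1)\<one>\<close>. The central terms add up to
  twice the level times \<open>a(-1)\<one>\<close>, the brackets to the Casimir element applied to \<open>a\<close>, which is \<open>2h a\<close>;
  the normalization of \<open>\<omega>\<close> cancels \<open>2(lev + h)\<close>.\<close>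

lemma current_omega:
  "current a 0 \<omega> = 0" "current a 1 \<omega> = current a (- 1) vac" "n \<ge> 2 \<Longrightarrow> current a n \<omega> = 0"
proof -
  define s where "s = 1 / (2 * (lev + h))"
  have omega: "current a n \<omega> = s \<odot> (\<Sum>j\<in>UNIV. current a n (quadratic (u j) (u j)))" for n
    by (simp add: conformal_vector_def s_def act_scale_right act_sum_right)
  have "current a 0 (quadratic (u j) (u j)) = quadratic (u j) (br a (u j)) + quadratic (br a (u j)) (u j)" for j
    by (simp add: current_commutator[of a 0] act_add_right)
  then show "current a 0 \<omega> = 0" unfolding omega by (simp add: quadratic_invariant)
  have ea: "current a (- 1) vac = (\<Sum>j\<in>UNIV. current (form a (u j) *s u j) (- 1) vac)"
    by (subst expansion[of a]) (simp only: current_sum)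
  have "current a 1 (quadratic (u j) (u j)) =
      (2 * lev) \<odot> current (form a (u j) *s u j) (- 1) vac + current (br (br a (u j)) (u j)) (- 1) vac" for j
  proof -
    have "current a 1 (current (u j) (- 1) vac) = (form a (u j) * lev) \<odot> vac"
      by (simp add: current_commutator[of a 1])
    moreover have "current (br a (u j)) 0 (current (u j) (- 1) vac) = current (br (br a (u j)) (u j)) (- 1) vac"
      by (simp add: current_commutator[of _ 0])
    ultimately show ?thesis
      by (simp add: current_commutator[of a 1] act_scale_right current_scale V.scale_left_distrib[symmetric])
  qed
  then have "(\<Sum>j\<in>UNIV. current a 1 (quadratic (u j) (u j))) =
      (2 * lev) \<odot> current a (- 1) vac + current ((2 * h) *s a) (- 1) vac"
    unfolding casimir[symmetric] current_sum ea by (simp add: sum.distrib V.scale_sum_right)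
  also have "\<dots> = (2 * (lev + h)) \<odot> current a (- 1) vac"
    by (simp add: current_scale V.scale_left_distrib[symmetric] distrib_left)
  finally have sum: "(\<Sum>j\<in>UNIV. current a 1 (quadratic (u j) (u j))) = (2 * (lev + h)) \<odot> current a (- 1) vac" .
  have "s * (2 * (lev + h)) = 1" using noncritical by (simp add: s_def del: distrib_left_numeral)
  then show "current a 1 \<omega> = current a (- 1) vac"
    unfolding omega sum V.scale_scale by simp
  assume n: "n \<ge> 2"
  have "current a n (quadratic (u j) (u j)) = 0" for j
  proof -
    have "form (br a (u j)) (u j) = 0" by (simp add: form_invariant br_self)
    then have "current (br a (u j)) (n - 1) (current (u j) (- 1) vac) = 0"
      using n by (simp add: current_commutator[of _ "n - 1"])
    moreover have "current a n (current (u j) (- 1) vac) = 0"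
      using n by (simp add: current_commutator[of _ n])
    ultimately show ?thesis using n by (simp add: current_commutator[of a n])
  qed
  then show "current a n \<omega> = 0" unfolding omega by simp
qed

text \<open>Only the term \<open>i = 1\<close> of the commutator formula survives, by \<open>current_omega\<close>.\<close>

lemma L_current: "L n (current a m v) = current a m (L n v) - of_int m \<odot> current a (m + n) v"
proof -
  let ?t = "\<lambda>i. (of_int m gchoose i) \<odot> Y (current a (int i) \<omega>) (m + (n + 1) - int i) v"
  interpret Yl: Vector_Spaces.linear scaleV scaleV "\<lambda>x. Y x k v" for k by (rule linear_Y_left)
  have "?t i = 0" if "i \<noteq> 1" for i
    using that current_omega(1)[of a] current_omega(3)[of "int i" a] by (cases "i = 0") (simp_all add: Yl.zero)
  then have "{i. ?t i \<noteq> 0} \<subseteq> {1}" by blast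
  then have "Sum_any ?t = (\<Sum>i\<in>{1}. ?t i)" by (intro Sum_any.expand_superset) simp_all
  also have "\<dots> = of_int m \<odot> current a (m + n) v"
    by (simp add: current_omega(2) Y_current)
  finally show ?thesis
    using borcherds_commutator[of m a \<omega> "n + 1" v] by (simp add: virasoro_mode_def algebra_simps)
qed

lemma L_vacuum: "n \<ge> - 1 \<Longrightarrow> L n vac = 0"
  by (simp add: virasoro_mode_def Y_vacuum)

lemma linear_L: "Vector_Spaces.linear scaleV scaleV (L n)"
  unfolding virasoro_mode_def by (rule linear_Y)

sublocale L: Vector_Spaces.linear scaleV scaleV "L n" for n by (rule linear_L)

lemma L0_monomial:
  "L 0 (monomial_vector act vac w) = of_nat (sum_list (map snd w)) \<odot> monomial_vector act vac w"
proof (induction w)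
  case Nil
  show ?case by (simp add: monomial_vector_Nil L_vacuum)
next
  case (Cons x w)
  then show ?case
    by (cases x) (simp add: monomial_vector_Cons L_current act_scale_right V.scale_left_distrib add.commute)
qed

lemma lowering_words_weight_2:
  assumes "w \<in> lowering_words" "sum_list (map snd w) = 2"
  obtains a where "w = [(a, 2)]" | a b where "w = [(a, 1), (b, 1)]"
proof -
  obtain a n w' where w: "w = (a, n) # w'" using assms(2) by (cases w) auto
  show ?thesis
  proof (cases w')
    case Nil
    then show ?thesis using assms w that(1) by simp
  next
    case (Cons bm w'')
    obtain b m where "bm = (b, m)" by force
    moreover have "w'' = []" using assms w Cons calculation by (cases w'') (auto simp: lowering_words_def)
    ultimately show ?thesis using assms w Cons that(2) by (auto simp: lowering_words_def)
  qed
qed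

text \<open>Monomials span the module and are eigenvectors of \<open>L(0)\<close>, so the eigenspace is spanned by the
  monomials of weight two.\<close>

lemma weight_2_span:
  assumes "L 0 v = 2 \<odot> v"
  shows "v \<in> V.span ({current a (- 2) vac | a. True} \<union> {quadratic a b | a b. True})" (is "_ \<in> V.span ?T")
proof -
  let ?M = "monomial_vector act vac"
  define \<mu> where "\<mu> e = (SOME c. L 0 e = c \<odot> e)" for e
  have "L 0 e = \<mu> e \<odot> e" if "e \<in> ?M ` lowering_words" for e
    unfolding \<mu>_def by (rule someI_ex) (use that L0_monomial in blast)
  then have "v \<in> V.span {e \<in> ?M ` lowering_words. \<mu> e = 2}"
    using assms monomials_span by (intro V.eigenspace_of_span[OF linear_L[of 0]]) auto
  moreover have "{e \<in> ?M ` lowering_words. \<mu> e = 2} \<subseteq> V.span ?T"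
  proof
    fix e assume e: "e \<in> {e \<in> ?M ` lowering_words. \<mu> e = 2}"
    then obtain w where w: "w \<in> lowering_words" "e = ?M w" by auto
    show "e \<in> V.span ?T"
    proof (cases "e = 0")
      case False
      have "L 0 e = 2 \<odot> e" using e \<open>\<And>e. e \<in> ?M ` lowering_words \<Longrightarrow> L 0 e = \<mu> e \<odot> e\<close> by auto
      then have "of_nat (sum_list (map snd w)) = (of_nat 2 :: complex)"
        using L0_monomial[of w] w(2) False by simp
      then have "sum_list (map snd w) = 2" unfolding of_nat_eq_iff .
      then show ?thesis
        by (rule lowering_words_weight_2[OF w(1)])
          (auto simp: w(2) monomial_vector_Cons monomial_vector_Nil intro!: V.span_base)
    qed (simp add: V.span_zero)
  qed
  ultimately show ?thesis using V.span_minimal[OF _ V.subspace_span] by blast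
qed

definition quadratic_vector :: "complex ^ 'd ^ 'd \<Rightarrow> 'v" where
  "quadratic_vector A = (\<Sum>i\<in>UNIV. \<Sum>j\<in>UNIV. (A $ i $ j) \<odot> quadratic (u i) (u j))"

lemma quadratic_vector_add: "quadratic_vector (A + B) = quadratic_vector A + quadratic_vector B"
  by (simp add: quadratic_vector_def V.scale_left_distrib sum.distrib)

lemma quadratic_vector_scale: "quadratic_vector (\<chi> i j. c * A $ i $ j) = c \<odot> quadratic_vector A"
  by (simp add: quadratic_vector_def V.scale_sum_right)

lemma quadratic_expansion:
  "quadratic a b = (\<Sum>i\<in>UNIV. \<Sum>j\<in>UNIV. (form a (u i) * form b (u j)) \<odot> quadratic (u i) (u j))"
  by (subst expansion[of a], subst expansion[of b])
    (simp add: current_sum current_scale act_sum_right act_scale_right V.scale_sum_right,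
      subst sum.swap, simp add: mult.commute)

text \<open>Symmetrization: \<open>2 a(-1)b(-1)\<one>\<close> is the sum of \<open>a(-1)b(-1)\<one> + b(-1)a(-1)\<one>\<close>, whose coefficient matrix is
  symmetric, and of \<open>[a,b](-2)\<one>\<close>.\<close>

lemma weight_2_decomposition:
  assumes "L 0 v = 2 \<odot> v"
  obtains A b where "transpose A = A" "v = quadratic_vector A + current b (- 2) vac"
proof -
  have "\<exists>A b. transpose A = A \<and> v = quadratic_vector A + current b (- 2) vac"
    using weight_2_span[OF assms]
  proof (induction rule: V.span_induct_alt)
    case base
    show ?case
      by (rule exI[of _ 0], rule exI[of _ 0]) (simp add: transpose_def vec_eq_iff quadratic_vector_def)
  next
    case (step c x y)
    then obtain A b where A: "transpose A = A" "y = quadratic_vector A + current b (- 2) vac" by blast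
    have "\<exists>A b. transpose A = A \<and> x = quadratic_vector A + current b (- 2) vac"
    proof -
      consider a where "x = current a (- 2) vac" | a b where "x = quadratic a b" using step by blast
      then show ?thesis
      proof cases
        case 1
        then show ?thesis
          by (intro exI[of _ 0] exI[of _ a]) (simp add: transpose_def vec_eq_iff quadratic_vector_def)
      next
        case 2
        define S :: "complex ^ 'd ^ 'd" where
          "S = (\<chi> i j. (form a (u i) * form b (u j) + form b (u i) * form a (u j)) / 2)"
        have "quadratic a b + quadratic b a = 2 \<odot> quadratic_vector S"
        proof -
          have S2: "2 * S $ i $ j = form a (u i) * form b (u j) + form b (u i) * form a (u j)" for i j
            unfolding S_def by simp
          have "2 \<odot> quadratic_vector S = (\<Sum>i\<in>UNIV. \<Sum>j\<in>UNIV. (2 * S $ i $ j) \<odot> quadratic (u i) (u j))"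
            by (simp add: quadratic_vector_def V.scale_sum_right)
          then show ?thesis
            unfolding quadratic_expansion[of a b] quadratic_expansion[of b a] S2
            by (simp add: V.scale_left_distrib sum.distrib)
        qed
        then have "2 \<odot> quadratic a b = 2 \<odot> quadratic_vector S + current (br a b) (- 2) vac"
          using quadratic_commutator[of a b] V.scale_left_distrib[of 1 1 "quadratic a b"] by (simp add: algebra_simps)
        then have "(1 / 2) \<odot> (2 \<odot> quadratic a b) =
            (1 / 2) \<odot> (2 \<odot> quadratic_vector S) + (1 / 2) \<odot> current (br a b) (- 2) vac"
          by (simp only: V.scale_right_distrib)
        then have "quadratic a b = quadratic_vector S + current ((1 / 2) *s br a b) (- 2) vac"
          by (simp add: current_scale)
        moreover have "transpose S = S" by (simp add: S_def transpose_def vec_eq_iff mult.commute add.commute)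
        ultimately show ?thesis using 2 by blast
      qed
    qed
    then obtain A' b' where A': "transpose A' = A'" "x = quadratic_vector A' + current b' (- 2) vac" by blast
    show ?case
    proof (intro exI conjI)
      show "transpose ((\<chi> i j. c * A' $ i $ j) + A) = (\<chi> i j. c * A' $ i $ j) + A"
        using A(1) A'(1) by (simp add: transpose_def vec_eq_iff)
      show "c \<odot> x + y = quadratic_vector ((\<chi> i j. c * A' $ i $ j) + A) + current (c *s b' + b) (- 2) vac"
        by (simp add: A(2) A'(2) quadratic_vector_add quadratic_vector_scale current_add current_scale
            V.scale_right_distrib)
    qed
  qed
  then show ?thesis using that by blast
qed

lemma L1_quadratic: "L 1 (quadratic a b) = current (br a b) (- 1) vac"
  by (simp add: L_current L_vacuum current_commutator[of a 0])

lemma L0_quadratic: "L 0 (quadratic a b) = 2 \<odot> quadratic a b"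
  using V.scale_left_distrib[of 1 1 "quadratic a b"]
  by (simp add: L_current L_vacuum act_diff_right)

lemma L1_quadratic_vector:
  assumes "transpose A = A"
  shows "L 1 (quadratic_vector A) = 0"
proof -
  let ?t = "\<lambda>i j. (A $ i $ j) \<odot> current (br (u i) (u j)) (- 1) vac"
  have sym: "A $ j $ i = A $ i $ j" for i j
    using assms by (metis transpose_def vec_lambda_beta)
  have t: "?t j i = - ?t i j" for i j
    using current_scale[of "-1" "br (u i) (u j)" "-1" vac] by (simp add: sym[of j i] br_swap[of "u j" "u i"])
  have "(\<Sum>i\<in>UNIV. \<Sum>j\<in>UNIV. ?t i j) = - (\<Sum>i\<in>UNIV. \<Sum>j\<in>UNIV. ?t i j)"
    unfolding sum_negf[symmetric] by (subst sum.swap) (intro sum.cong refl t)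
  then have "2 \<odot> (\<Sum>i\<in>UNIV. \<Sum>j\<in>UNIV. ?t i j) = 0"
    using V.scale_left_distrib[of 1 1 "\<Sum>i\<in>UNIV. \<Sum>j\<in>UNIV. ?t i j"] by (simp add: eq_neg_iff_add_eq_0)
  then show ?thesis by (simp add: quadratic_vector_def L.sum L.scale L1_quadratic)
qed

text \<open>Apply \<open>L(-1)\<close>, which annihilates the vacuum.\<close>

lemma current_minus_2_zero:
  assumes "current b (- 1) vac = 0"
  shows "current b (- 2) vac = 0"
  using L_current[of "-1" b "-1" vac] by (simp add: assms L_vacuum L.zero)

theorem quasi_primary_weight_2:
  "{v. L 1 v = 0} \<inter> {v. L 0 v = 2 \<odot> v} = quadratic_vector ` {A. transpose A = A}"
proof (intro equalityI subsetI)
  fix v assume v: "v \<in> {v. L 1 v = 0} \<inter> {v. L 0 v = 2 \<odot> v}"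
  then have "L 0 v = 2 \<odot> v" by simp
  then obtain A b where A: "transpose A = A" "v = quadratic_vector A + current b (- 2) vac"
    by (rule weight_2_decomposition)
  have "L 1 v = 2 \<odot> current b (- 1) vac"
    unfolding A(2) L.add L1_quadratic_vector[OF A(1)] by (simp add: L_current L_vacuum)
  then have "current b (- 1) vac = 0" using v by simp
  then show "v \<in> quadratic_vector ` {A. transpose A = A}"
    using A current_minus_2_zero by auto
next
  fix v assume "v \<in> quadratic_vector ` {A. transpose A = A}"
  then obtain A where A: "transpose A = A" "v = quadratic_vector A" by blast
  have "L 0 v = 2 \<odot> v"
    unfolding A(2) quadratic_vector_def L.sum L.scale L0_quadratic V.scale_sum_right
    by (simp add: mult.commute)
  then show "v \<in> {v. L 1 v = 0} \<inter> {v. L 0 v = 2 \<odot> v}" using A L1_quadratic_vector by simp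
qed

lemma sum_basis_form:
  "(\<Sum>i\<in>UNIV. \<Sum>j\<in>UNIV. F i j * (form (u k) (u i) * form (u l) (u j))) = F k l"
proof -
  have indicator: "x * (if P then 1 else 0) = (if P then x else 0)" for x :: complex and P by simp
  have "(\<Sum>i\<in>UNIV. \<Sum>j\<in>UNIV. F i j * (form (u k) (u i) * form (u l) (u j))) =
      (\<Sum>i\<in>UNIV. if k = i then \<Sum>j\<in>UNIV. if l = j then F i j else 0 else 0)"
  proof (intro sum.cong refl)
    fix i show "(\<Sum>j\<in>UNIV. F i j * (form (u k) (u i) * form (u l) (u j))) =
        (if k = i then \<Sum>j\<in>UNIV. if l = j then F i j else 0 else 0)"
      by (cases "k = i") (simp_all add: form_u indicator)
  qed
  then show ?thesis by simp
qed

text \<open>Pairing with \<open>u\<^sup>k(1) \<otimes> u\<^sup>l(1)\<close> extracts the symmetric part of the difference of the matrices.\<close>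

theorem quadratic_vector_inj: "inj_on quadratic_vector {A. transpose A = A}"
proof (rule inj_onI)
  fix A B :: "complex ^ 'd ^ 'd"
  assume AB: "A \<in> {A. transpose A = A}" "B \<in> {A. transpose A = A}" and eq: "quadratic_vector A = quadratic_vector B"
  let ?D = "\<lambda>i j. A $ i $ j - B $ i $ j"
  have sym: "?D j i = ?D i j" for i j
  proof -
    have "A $ j $ i = transpose A $ i $ j" "B $ j $ i = transpose B $ i $ j" by (simp_all add: transpose_def)
    then show ?thesis using AB by simp
  qed
  have "(\<Sum>p\<in>UNIV. ?D (fst p) (snd p) \<odot> quadratic (u (fst p)) (u (snd p))) = 0"
  proof -
    have "(\<Sum>p\<in>UNIV. ?D (fst p) (snd p) \<odot> quadratic (u (fst p)) (u (snd p))) =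
        (\<Sum>i\<in>UNIV. \<Sum>j\<in>UNIV. ?D i j \<odot> quadratic (u i) (u j))"
      by (simp only: sum.cartesian_product case_prod_unfold UNIV_Times_UNIV)
    also have "\<dots> = quadratic_vector A - quadratic_vector B"
      by (simp add: quadratic_vector_def V.scale_left_diff_distrib sum_subtractf)
    finally show ?thesis using eq by simp
  qed
  from quadratic_independent[OF this]
  have "(\<Sum>i\<in>UNIV. \<Sum>j\<in>UNIV. ?D i j * (form a (u i) * form b (u j) + form a (u j) * form b (u i))) = 0" for a b
    by (simp only: sum.cartesian_product case_prod_unfold UNIV_Times_UNIV)
  note D = this
  note pick = sum_basis_form[of ?D]
  have pick': "(\<Sum>i\<in>UNIV. \<Sum>j\<in>UNIV. ?D i j * (form (u k) (u j) * form (u l) (u i))) = ?D l k" for k l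
    unfolding mult.commute[of "form (u k) (u j)" "form (u l) (u i)" for i j] by (rule pick)
  have "?D k l = 0" for k l
  proof -
    have "0 = (\<Sum>i\<in>UNIV. \<Sum>j\<in>UNIV. ?D i j * (form (u k) (u i) * form (u l) (u j) + form (u k) (u j) * form (u l) (u i)))"
      using D by simp
    also have "\<dots> = ?D k l + ?D l k"
      unfolding distrib_left sum.distrib pick pick' ..
    also have "\<dots> = 2 * ?D k l" by (simp add: sym[of l k])
    finally show ?thesis by simp
  qed
  then show "A = B" by (simp add: vec_eq_iff)
qed

end

section \<open>Quadratic forms on the dual space\<close>

context universal_affine_vertex_algebra
begin

definition matrix_form :: "complex ^ 'd ^ 'd \<Rightarrow> ('g \<Rightarrow> complex) \<Rightarrow> complex" where
  "matrix_form A \<xi> = (if \<xi> \<in> dual_space scale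
     then \<Sum>i\<in>UNIV. \<Sum>j\<in>UNIV. A $ i $ j * (\<xi> (u i) * \<xi> (u j)) else 0)"

lemma dual_spaceD:
  assumes "\<xi> \<in> dual_space scale"
  shows "\<xi> (x + y) = \<xi> x + \<xi> y" "\<xi> (c *s x) = c * \<xi> x" "\<xi> (\<Sum>i\<in>I. f i) = (\<Sum>i\<in>I. \<xi> (f i))"
proof -
  interpret x: Vector_Spaces.linear scale "(*)" \<xi> using assms by (simp add: dual_space_def)
  show "\<xi> (x + y) = \<xi> x + \<xi> y" "\<xi> (c *s x) = c * \<xi> x" "\<xi> (\<Sum>i\<in>I. f i) = (\<Sum>i\<in>I. \<xi> (f i))"
    by (rule x.add x.scale x.sum)+
qed

lemma dual_spaceI:
  assumes "\<And>x y. \<xi> (x + y) = \<xi> x + \<xi> y" "\<And>c x. \<xi> (c *s x) = c * \<xi> x"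
  shows "\<xi> \<in> dual_space scale"
  unfolding dual_space_def mem_Collect_eq by unfold_locales (auto simp: assms algebra_simps)

lemma dual_space_closed:
  assumes "\<xi> \<in> dual_space scale" "\<eta> \<in> dual_space scale"
  shows "(\<lambda>x. \<xi> x + \<eta> x) \<in> dual_space scale" "(\<lambda>x. c * \<xi> x) \<in> dual_space scale"
  using dual_spaceD[OF assms(1)] dual_spaceD[OF assms(2)]
  by (auto intro!: dual_spaceI simp: algebra_simps)

lemma coordinate_in_dual: "(\<lambda>x. form x (u k)) \<in> dual_space scale"
  by (rule dual_spaceI) (simp_all add: form_add_left form_scale_left)

lemma dual_expansion:
  assumes "\<xi> \<in> dual_space scale"
  shows "\<xi> x = (\<Sum>k\<in>UNIV. \<xi> (u k) * form x (u k))"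
  by (subst expansion[of x]) (simp add: dual_spaceD[OF assms] mult.commute)

lemma matrix_form_in_quadratic_forms: "matrix_form A \<in> quadratic_forms scale"
proof -
  let ?B = "\<lambda>\<xi> \<eta>. \<Sum>i\<in>UNIV. \<Sum>j\<in>UNIV. A $ i $ j * (\<xi> (u i) * \<eta> (u j) + \<eta> (u i) * \<xi> (u j))"
  have "matrix_form A (\<lambda>x. c * \<xi> x) = c\<^sup>2 * matrix_form A \<xi>" if "\<xi> \<in> dual_space scale" for c \<xi>
    using that dual_space_closed(2)[OF that that, of c]
    by (simp add: matrix_form_def sum_distrib_left power2_eq_square algebra_simps)
  moreover have "?B \<xi> \<eta> = matrix_form A (\<lambda>x. \<xi> x + \<eta> x) - matrix_form A \<xi> - matrix_form A \<eta>"
    if "\<xi> \<in> dual_space scale" "\<eta> \<in> dual_space scale" for \<xi> \<eta>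
    using that dual_space_closed(1)[OF that]
    by (simp add: matrix_form_def sum_subtractf[symmetric] algebra_simps)
  moreover have "?B (\<lambda>x. \<xi> x + \<xi>' x) \<eta> = ?B \<xi> \<eta> + ?B \<xi>' \<eta>" "?B \<eta> (\<lambda>x. \<xi> x + \<xi>' x) = ?B \<eta> \<xi> + ?B \<eta> \<xi>'"
    "?B (\<lambda>x. c * \<xi> x) \<eta> = c * ?B \<xi> \<eta>" "?B \<eta> (\<lambda>x. c * \<xi> x) = c * ?B \<eta> \<xi>" for \<xi> \<xi>' \<eta> :: "'g \<Rightarrow> complex" and c
    by (simp_all add: sum.distrib[symmetric] sum_distrib_left algebra_simps)
  moreover have "matrix_form A \<xi> = 0" if "\<xi> \<notin> dual_space scale" for \<xi>
    using that by (simp add: matrix_form_def)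
  ultimately show ?thesis
    unfolding quadratic_forms_def mem_Collect_eq by (intro conjI exI[of _ ?B]) blast+
qed

text \<open>The matrix is half the polar form evaluated on the basis of coordinate functions. Since the polar
  form is only constrained on linear functionals, every argument has to be shown linear.\<close>

lemma quadratic_form_matrix:
  assumes "q \<in> quadratic_forms scale"
  obtains A where "transpose A = A" "q = matrix_form A"
proof -
  let ?D = "dual_space scale"
  obtain B where out: "\<forall>\<xi>. \<xi> \<notin> ?D \<longrightarrow> q \<xi> = 0"
    and hom: "\<forall>c. \<forall>\<xi>\<in>?D. q (\<lambda>x. c * \<xi> x) = c\<^sup>2 * q \<xi>"
    and B: "\<forall>\<xi>\<in>?D. \<forall>\<eta>\<in>?D. B \<xi> \<eta> = q (\<lambda>x. \<xi> x + \<eta> x) - q \<xi> - q \<eta>"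
    and add': "\<forall>\<xi>\<in>?D. \<forall>\<xi>'\<in>?D. \<forall>\<eta>\<in>?D. B (\<lambda>x. \<xi> x + \<xi>' x) \<eta> = B \<xi> \<eta> + B \<xi>' \<eta> \<and>
        B \<eta> (\<lambda>x. \<xi> x + \<xi>' x) = B \<eta> \<xi> + B \<eta> \<xi>'"
    and mult': "\<forall>c. \<forall>\<xi>\<in>?D. \<forall>\<eta>\<in>?D. B (\<lambda>x. c * \<xi> x) \<eta> = c * B \<xi> \<eta> \<and>
        B \<eta> (\<lambda>x. c * \<xi> x) = c * B \<eta> \<xi>"
    using assms unfolding quadratic_forms_def mem_Collect_eq by (elim conjE exE) (rule that)
  note out = out[rule_format] and hom = hom[rule_format] and B = B[rule_format]
  have add: "B (\<lambda>x. \<xi> x + \<xi>' x) \<eta> = B \<xi> \<eta> + B \<xi>' \<eta>" "B \<eta> (\<lambda>x. \<xi> x + \<xi>' x) = B \<eta> \<xi> + B \<eta> \<xi>'"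
    if "\<xi> \<in> ?D" "\<xi>' \<in> ?D" "\<eta> \<in> ?D" for \<xi> \<xi>' \<eta>
    using add' that by (simp_all only: Ball_def)
  have mult: "B (\<lambda>x. c * \<xi> x) \<eta> = c * B \<xi> \<eta>" "B \<eta> (\<lambda>x. c * \<xi> x) = c * B \<eta> \<xi>"
    if "\<xi> \<in> ?D" "\<eta> \<in> ?D" for c \<xi> \<eta>
    using mult' that by (simp_all only: Ball_def)
  let ?e = "\<lambda>k x. form x (u k)"
  define A :: "complex ^ 'd ^ 'd" where "A = (\<chi> i j. B (?e i) (?e j) / 2)"
  have zero: "(\<lambda>x. 0) \<in> ?D" by (rule dual_spaceI) simp_all
  have sum_dual: "(\<lambda>x. \<Sum>k\<in>I. c k * ?e k x) \<in> ?D" for I c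
    by (rule dual_spaceI)
      (simp_all add: form_add_left form_scale_left distrib_left sum.distrib sum_distrib_left mult.left_commute)
  have left: "B (\<lambda>x. \<Sum>k\<in>I. c k * ?e k x) \<eta> = (\<Sum>k\<in>I. c k * B (?e k) \<eta>)" if "finite I" "\<eta> \<in> ?D" for I c \<eta>
    using that(1)
  proof (induction I rule: finite_induct)
    case empty
    show ?case using mult(1)[OF zero that(2), of 0] by simp
  next
    case (insert k I)
    have "B (\<lambda>x. c k * ?e k x + (\<Sum>k\<in>I. c k * ?e k x)) \<eta> = B (\<lambda>x. c k * ?e k x) \<eta> + B (\<lambda>x. \<Sum>k\<in>I. c k * ?e k x) \<eta>"
      by (rule add(1)[OF dual_space_closed(2)[OF coordinate_in_dual coordinate_in_dual] sum_dual that(2)])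
    then show ?case using insert mult(1)[OF coordinate_in_dual that(2)] by simp
  qed
  have right: "B \<eta> (\<lambda>x. \<Sum>k\<in>I. c k * ?e k x) = (\<Sum>k\<in>I. c k * B \<eta> (?e k))" if "finite I" "\<eta> \<in> ?D" for I c \<eta>
    using that(1)
  proof (induction I rule: finite_induct)
    case empty
    show ?case using mult(2)[OF zero that(2), of 0] by simp
  next
    case (insert k I)
    have "B \<eta> (\<lambda>x. c k * ?e k x + (\<Sum>k\<in>I. c k * ?e k x)) = B \<eta> (\<lambda>x. c k * ?e k x) + B \<eta> (\<lambda>x. \<Sum>k\<in>I. c k * ?e k x)"
      by (rule add(2)[OF dual_space_closed(2)[OF coordinate_in_dual coordinate_in_dual] sum_dual that(2)])
    then show ?case using insert mult(2)[OF coordinate_in_dual that(2)] by simp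
  qed
  have "q \<xi> = matrix_form A \<xi>" for \<xi>
  proof (cases "\<xi> \<in> ?D")
    case True
    have exp: "\<xi> = (\<lambda>x. \<Sum>k\<in>UNIV. \<xi> (u k) * ?e k x)"
      by (rule ext) (rule dual_expansion[OF True])
    have "B \<xi> \<xi> = q (\<lambda>x. 2 * \<xi> x) - q \<xi> - q \<xi>" unfolding mult_2 by (rule B[OF True True])
    then have "2 * q \<xi> = B \<xi> \<xi>" using hom[OF True, of 2] by simp
    also have "B \<xi> \<xi> = B (\<lambda>x. \<Sum>k\<in>UNIV. \<xi> (u k) * ?e k x) \<xi>" by (simp only: exp[symmetric])
    also have "\<dots> = (\<Sum>k\<in>UNIV. \<xi> (u k) * B (?e k) \<xi>)" by (rule left[OF _ True]) simp
    also have "\<dots> = (\<Sum>k\<in>UNIV. \<xi> (u k) * B (?e k) (\<lambda>x. \<Sum>k\<in>UNIV. \<xi> (u k) * ?e k x))" by (simp only: exp[symmetric])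
    also have "\<dots> = (\<Sum>k\<in>UNIV. \<xi> (u k) * (\<Sum>l\<in>UNIV. \<xi> (u l) * B (?e k) (?e l)))"
      by (intro sum.cong refl arg_cong[where f = "(*) _"] right coordinate_in_dual) simp
    also have "\<dots> = 2 * matrix_form A \<xi>"
      using True by (simp add: matrix_form_def A_def sum_distrib_left algebra_simps)
    finally show ?thesis by simp
  qed (simp add: out matrix_form_def)
  moreover have "B (?e i) (?e j) = B (?e j) (?e i)" for i j
    by (simp add: B coordinate_in_dual add.commute)
  then have "transpose A = A" by (simp add: A_def transpose_def vec_eq_iff)
  ultimately show ?thesis using that[of A] by blast
qed

lemma quadratic_forms_eq: "quadratic_forms scale = matrix_form ` {A. transpose A = A}"
  using matrix_form_in_quadratic_forms quadratic_form_matrix by blast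

lemma matrix_form_inj: "inj_on matrix_form {A. transpose A = A}"
proof (rule inj_onI)
  fix A B :: "complex ^ 'd ^ 'd"
  assume AB: "A \<in> {A. transpose A = A}" "B \<in> {A. transpose A = A}" and eq: "matrix_form A = matrix_form B"
  let ?e = "\<lambda>k x. form x (u k)"
  have pick: "(\<Sum>i\<in>UNIV. \<Sum>j\<in>UNIV. F i j * (form (u i) (u k) * form (u j) (u l))) = F k l" for F k l
    unfolding form_sym[of "u i" "u k" for i] form_sym[of "u j" "u l" for j] by (rule sum_basis_form)
  have diag: "matrix_form C (?e k) = C $ k $ k" for C k
    using coordinate_in_dual[of k] by (simp add: matrix_form_def pick)
  have off: "matrix_form C (\<lambda>x. ?e k x + ?e l x) = C $ k $ k + C $ l $ l + 2 * C $ k $ l"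
    if "transpose C = C" for C k l
  proof -
    have "C $ l $ k = C $ k $ l" using that by (metis transpose_def vec_lambda_beta)
    then show ?thesis
      using dual_space_closed(1)[OF coordinate_in_dual[of k] coordinate_in_dual[of l]]
      by (simp add: matrix_form_def distrib_left distrib_right sum.distrib pick)
  qed
  have "A $ k $ l = B $ k $ l" for k l
    using off[of A k l] off[of B k l] AB eq diag[of A] diag[of B] by simp
  then show "A = B" by (simp add: vec_eq_iff)
qed

lemma matrix_form_add: "matrix_form (A + B) = matrix_form A + matrix_form B"
  by (rule ext) (simp add: matrix_form_def distrib_right sum.distrib)

lemma matrix_form_scale: "matrix_form (\<chi> i j. c * A $ i $ j) = function_scale c (matrix_form A)"
  by (rule ext) (simp add: matrix_form_def function_scale_def sum_distrib_left mult.assoc)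

section \<open>The group action\<close>

text \<open>The matrix of \<open>\<Sum> a\<^sub>i\<^sub>j \<sigma>(u\<^sup>i) \<otimes> \<sigma>(u\<^sup>j)\<close> in the basis \<open>u\<close>.\<close>

definition transformed_matrix :: "('g \<Rightarrow> 'g) \<Rightarrow> complex ^ 'd ^ 'd \<Rightarrow> complex ^ 'd ^ 'd" where
  "transformed_matrix \<sigma> A =
     (\<chi> k l. \<Sum>i\<in>UNIV. \<Sum>j\<in>UNIV. A $ i $ j * (form (\<sigma> (u i)) (u k) * form (\<sigma> (u j)) (u l)))"

lemma transpose_transformed_matrix:
  assumes "transpose A = A"
  shows "transpose (transformed_matrix \<sigma> A) = transformed_matrix \<sigma> A"
proof -
  have sym: "A $ j $ i = A $ i $ j" for i j using assms by (metis transpose_def vec_lambda_beta)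
  have "(\<Sum>i\<in>UNIV. \<Sum>j\<in>UNIV. A $ i $ j * (form (\<sigma> (u i)) (u l) * form (\<sigma> (u j)) (u k))) =
      (\<Sum>i\<in>UNIV. \<Sum>j\<in>UNIV. A $ i $ j * (form (\<sigma> (u i)) (u k) * form (\<sigma> (u j)) (u l)))" for k l
    by (subst sum.swap) (intro sum.cong refl, simp add: sym mult.commute)
  then show ?thesis by (simp add: transformed_matrix_def transpose_def vec_eq_iff)
qed

lemma sum_rearrange:
  "(\<Sum>k\<in>UNIV. \<Sum>l\<in>UNIV. \<Sum>i\<in>UNIV. \<Sum>j\<in>UNIV. f k l i j) =
    (\<Sum>i\<in>UNIV. \<Sum>j\<in>UNIV. \<Sum>k\<in>UNIV. \<Sum>l\<in>UNIV. (f (k::'d) (l::'d) (i::'d) (j::'d) :: 'z::comm_monoid_add))"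
proof -
  have outward: "(\<Sum>k\<in>UNIV. \<Sum>l\<in>UNIV. \<Sum>i\<in>UNIV. g k l i) = (\<Sum>i\<in>UNIV. \<Sum>k\<in>UNIV. \<Sum>l\<in>UNIV. g k l i)"
    for g :: "'d \<Rightarrow> 'd \<Rightarrow> 'd \<Rightarrow> 'z"
  proof -
    have "(\<Sum>l\<in>UNIV. \<Sum>i\<in>UNIV. g k l i) = (\<Sum>i\<in>UNIV. \<Sum>l\<in>UNIV. g k l i)" for k by (rule sum.swap)
    then show ?thesis by (simp only: sum.swap[of "\<lambda>k i. \<Sum>l\<in>UNIV. g k l i"])
  qed
  show ?thesis unfolding outward[of "\<lambda>k l i. \<Sum>j\<in>UNIV. f k l i j"] by (intro sum.cong refl outward)
qed

lemma quadratic_vector_transformed: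
  "quadratic_vector (transformed_matrix \<sigma> A) =
    (\<Sum>i\<in>UNIV. \<Sum>j\<in>UNIV. (A $ i $ j) \<odot> quadratic (\<sigma> (u i)) (\<sigma> (u j)))"
proof -
  have "quadratic_vector (transformed_matrix \<sigma> A) =
      (\<Sum>k\<in>UNIV. \<Sum>l\<in>UNIV. \<Sum>i\<in>UNIV. \<Sum>j\<in>UNIV.
        (A $ i $ j * (form (\<sigma> (u i)) (u k) * form (\<sigma> (u j)) (u l))) \<odot> quadratic (u k) (u l))"
    by (simp add: quadratic_vector_def transformed_matrix_def V.scale_sum_left)
  also have "\<dots> = (\<Sum>i\<in>UNIV. \<Sum>j\<in>UNIV. \<Sum>k\<in>UNIV. \<Sum>l\<in>UNIV.
        (A $ i $ j * (form (\<sigma> (u i)) (u k) * form (\<sigma> (u j)) (u l))) \<odot> quadratic (u k) (u l))"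
    by (rule sum_rearrange)
  also have "\<dots> = (\<Sum>i\<in>UNIV. \<Sum>j\<in>UNIV. (A $ i $ j) \<odot> quadratic (\<sigma> (u i)) (\<sigma> (u j)))"
    unfolding quadratic_expansion[of "\<sigma> _" "\<sigma> _"] by (simp add: V.scale_sum_right)
  finally show ?thesis .
qed

lemma matrix_form_transformed:
  assumes "\<xi> \<in> dual_space scale" "\<xi> \<circ> \<sigma> \<in> dual_space scale"
  shows "matrix_form (transformed_matrix \<sigma> A) \<xi> = matrix_form A (\<xi> \<circ> \<sigma>)"
proof -
  have exp: "\<xi> (\<sigma> (u i)) * \<xi> (\<sigma> (u j)) =
      (\<Sum>k\<in>UNIV. \<Sum>l\<in>UNIV. form (\<sigma> (u i)) (u k) * form (\<sigma> (u j)) (u l) * (\<xi> (u k) * \<xi> (u l)))" for i j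
    unfolding dual_expansion[OF assms(1), of "\<sigma> _"] sum_product by (simp add: mult.commute mult.left_commute)
  have "matrix_form (transformed_matrix \<sigma> A) \<xi> = (\<Sum>k\<in>UNIV. \<Sum>l\<in>UNIV. \<Sum>i\<in>UNIV. \<Sum>j\<in>UNIV.
      A $ i $ j * (form (\<sigma> (u i)) (u k) * form (\<sigma> (u j)) (u l)) * (\<xi> (u k) * \<xi> (u l)))"
    using assms by (simp add: matrix_form_def transformed_matrix_def sum_distrib_right)
  also have "\<dots> = (\<Sum>i\<in>UNIV. \<Sum>j\<in>UNIV. \<Sum>k\<in>UNIV. \<Sum>l\<in>UNIV.
      A $ i $ j * (form (\<sigma> (u i)) (u k) * form (\<sigma> (u j)) (u l)) * (\<xi> (u k) * \<xi> (u l)))"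
    by (rule sum_rearrange)
  also have "\<dots> = matrix_form A (\<xi> \<circ> \<sigma>)"
    using assms by (simp add: matrix_form_def exp sum_distrib_left mult.assoc)
  finally show ?thesis .
qed

lemma quadratic_action_matrix_form:
  assumes \<sigma>: "Vector_Spaces.linear scale scale \<sigma>" "bij \<sigma>"
  shows "quadratic_action \<sigma> (matrix_form A) = matrix_form (transformed_matrix \<sigma> A)"
proof
  fix \<xi> :: "'g \<Rightarrow> complex"
  interpret s: Vector_Spaces.linear scale scale \<sigma> by fact
  have comp: "\<xi> \<circ> \<sigma> \<in> dual_space scale \<longleftrightarrow> \<xi> \<in> dual_space scale"
  proof
    assume "\<xi> \<in> dual_space scale"
    then show "\<xi> \<circ> \<sigma> \<in> dual_space scale"
      by (intro dual_spaceI) (simp_all add: s.add s.scale dual_spaceD)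
  next
    assume lin: "\<xi> \<circ> \<sigma> \<in> dual_space scale"
    have surj: "\<sigma> (inv \<sigma> x) = x" for x using \<sigma>(2) by (simp add: bij_is_surj surj_f_inv_f)
    show "\<xi> \<in> dual_space scale"
    proof (rule dual_spaceI)
      show "\<xi> (x + y) = \<xi> x + \<xi> y" for x y
        using dual_spaceD(1)[OF lin, of "inv \<sigma> x" "inv \<sigma> y"] by (simp add: s.add surj)
      show "\<xi> (c *s x) = c * \<xi> x" for c x
        using dual_spaceD(2)[OF lin, of c "inv \<sigma> x"] by (simp add: s.scale surj)
    qed
  qed
  have "quadratic_action \<sigma> (matrix_form A) \<xi> = matrix_form A (\<xi> \<circ> \<sigma>)"
    using \<sigma>(2) by (simp add: quadratic_action_def dual_action_def inv_inv_eq)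
  also have "\<dots> = matrix_form (transformed_matrix \<sigma> A) \<xi>"
  proof (cases "\<xi> \<in> dual_space scale")
    case True
    then show ?thesis using comp matrix_form_transformed by simp
  next
    case False
    then show ?thesis using comp by (simp add: matrix_form_def)
  qed
  finally show "quadratic_action \<sigma> (matrix_form A) \<xi> = matrix_form (transformed_matrix \<sigma> A) \<xi>" .
qed

lemma monomial_action_quadratic_vector:
  assumes "acts_on_monomials G scaleV act vac \<rho>" "\<sigma> \<in> G"
  shows "\<rho> \<sigma> (quadratic_vector A) = quadratic_vector (transformed_matrix \<sigma> A)"
proof -
  interpret r: Vector_Spaces.linear scaleV scaleV "\<rho> \<sigma>"
    using assms by (auto simp: acts_on_monomials_def)
  have "\<rho> \<sigma> (monomial_vector act vac [(a, 1), (b, 1)]) =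
      monomial_vector act vac (map (\<lambda>(a, n). (\<sigma> a, n)) [(a, 1), (b, 1)])" for a b
    using assms unfolding acts_on_monomials_def by (auto simp del: list.map)
  then have "\<rho> \<sigma> (quadratic a b) = quadratic (\<sigma> a) (\<sigma> b)" for a b
    by (simp add: monomial_vector_def)
  then show ?thesis
    unfolding quadratic_vector_transformed by (simp add: quadratic_vector_def r.sum r.scale)
qed

lemma symmetric_closed:
  "transpose A = A \<Longrightarrow> transpose B = B \<Longrightarrow> transpose (A + B) = A + B"
  "transpose A = A \<Longrightarrow> transpose (\<chi> i j. c * A $ i $ j) = (\<chi> i j. c * A $ i $ j)"
  by (simp_all add: transpose_def vec_eq_iff)

text \<open>Both modules are parametrized by symmetric matrices, and a group element acts on the parameters
  by \<open>transformed_matrix\<close> in both cases.\<close>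

theorem quasi_primary_isomorphic_quadratic_forms:
  assumes \<rho>: "acts_on_monomials G scaleV act vac \<rho>"
    and G: "\<And>\<sigma>. \<sigma> \<in> G \<Longrightarrow> Vector_Spaces.linear scale scale \<sigma> \<and> bij \<sigma>"
  shows "isomorphic_modules G scaleV \<rho> ({v. L 1 v = 0} \<inter> {v. L 0 v = 2 \<odot> v})
    function_scale quadratic_action (quadratic_forms scale)"
proof -
  let ?S = "{A :: complex ^ 'd ^ 'd. transpose A = A}"
  let ?K = "quadratic_vector ` ?S" and ?Q = "matrix_form ` ?S"
  interpret F: vector_space "function_scale :: complex \<Rightarrow> (('g \<Rightarrow> complex) \<Rightarrow> complex) \<Rightarrow> _"
    by unfold_locales (auto simp: function_scale_def fun_eq_iff algebra_simps)
  have zero: "quadratic_vector 0 = 0" "matrix_form 0 = 0" "(0 :: complex ^ 'd ^ 'd) \<in> ?S"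
    by (auto simp: quadratic_vector_def matrix_form_def transpose_def vec_eq_iff)
  have \<rho>A: "\<rho> \<sigma> (quadratic_vector A) = quadratic_vector (transformed_matrix \<sigma> A)"
    and qA: "quadratic_action \<sigma> (matrix_form A) = matrix_form (transformed_matrix \<sigma> A)"
    and S: "A \<in> ?S \<Longrightarrow> transformed_matrix \<sigma> A \<in> ?S" if "\<sigma> \<in> G" for \<sigma> A
    using monomial_action_quadratic_vector[OF \<rho> that] quadratic_action_matrix_form G[OF that]
      transpose_transformed_matrix by auto
  have K: "stable_subspace G scaleV \<rho> ?K"
    unfolding stable_subspace_def
  proof (intro conjI ballI V.subspaceI)
    show "0 \<in> ?K" using zero by force
  next
    fix x y assume "x \<in> ?K" "y \<in> ?K"
    then show "x + y \<in> ?K" using symmetric_closed(1) by (force simp: quadratic_vector_add[symmetric])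
  next
    fix c x assume "x \<in> ?K"
    then show "c \<odot> x \<in> ?K" using symmetric_closed(2) by (force simp: quadratic_vector_scale[symmetric])
  next
    fix \<sigma> v assume "\<sigma> \<in> G" "v \<in> ?K"
    then show "\<rho> \<sigma> v \<in> ?K" using \<rho>A S by blast
  qed
  have Q: "stable_subspace G function_scale quadratic_action ?Q"
    unfolding stable_subspace_def
  proof (intro conjI ballI F.subspaceI)
    show "0 \<in> ?Q" using zero by force
  next
    fix x y assume "x \<in> ?Q" "y \<in> ?Q"
    then show "x + y \<in> ?Q" using symmetric_closed(1) by (force simp: matrix_form_add[symmetric])
  next
    fix c x assume "x \<in> ?Q"
    then show "function_scale c x \<in> ?Q" using symmetric_closed(2) by (force simp: matrix_form_scale[symmetric])
  next
    fix \<sigma> v assume "\<sigma> \<in> G" "v \<in> ?Q"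
    then show "quadratic_action \<sigma> v \<in> ?Q" using qA S by blast
  qed
  define \<phi> where "\<phi> v = matrix_form (inv_into ?S quadratic_vector v)" for v
  have \<phi>: "\<phi> (quadratic_vector A) = matrix_form A" if "A \<in> ?S" for A
    unfolding \<phi>_def using inv_into_f_f[OF quadratic_vector_inj that] by simp
  have "bij_betw \<phi> ?K ?Q"
    unfolding bij_betw_def
  proof
    show "inj_on \<phi> ?K"
    proof (rule inj_onI)
      fix x y assume "x \<in> ?K" "y \<in> ?K" "\<phi> x = \<phi> y"
      then obtain A B where AB: "A \<in> ?S" "B \<in> ?S" "x = quadratic_vector A" "y = quadratic_vector B" by blast
      then have "matrix_form A = matrix_form B" using \<phi> \<open>\<phi> x = \<phi> y\<close> by simp
      then show "x = y" using inj_onD[OF matrix_form_inj _ AB(1,2)] AB(3,4) by simp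
    qed
    show "\<phi> ` ?K = ?Q" using \<phi> by force
  qed
  moreover have "\<phi> (x + y) = \<phi> x + \<phi> y" if "x \<in> ?K" "y \<in> ?K" for x y
  proof -
    obtain A B where "A \<in> ?S" "B \<in> ?S" "x = quadratic_vector A" "y = quadratic_vector B" using \<open>x \<in> ?K\<close> \<open>y \<in> ?K\<close> by blast
    moreover from this have "A + B \<in> ?S" using symmetric_closed(1) by blast
    ultimately show ?thesis using \<phi>[of A] \<phi>[of B] \<phi>[of "A + B"] by (simp add: quadratic_vector_add matrix_form_add)
  qed
  moreover have "\<phi> (c \<odot> x) = function_scale c (\<phi> x)" if "x \<in> ?K" for c x
  proof -
    obtain A where "A \<in> ?S" "x = quadratic_vector A" using \<open>x \<in> ?K\<close> by blast
    moreover from this have "(\<chi> i j. c * A $ i $ j) \<in> ?S" using symmetric_closed(2) by blast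
    ultimately show ?thesis
      using \<phi>[of A] \<phi>[of "\<chi> i j. c * A $ i $ j"] by (simp add: quadratic_vector_scale matrix_form_scale)
  qed
  moreover have "\<phi> (\<rho> \<sigma> x) = quadratic_action \<sigma> (\<phi> x)" if "\<sigma> \<in> G" "x \<in> ?K" for \<sigma> x
    using that(2) \<rho>A[OF that(1)] qA[OF that(1)] S[OF that(1)] \<phi> by auto
  ultimately show ?thesis
    unfolding quasi_primary_weight_2 quadratic_forms_eq isomorphic_modules_def using K Q by blast
qed

end

section \<open>The quasi-primary vectors of weight two\<close>

theorem proposition3p1:
  fixes scaleG :: "complex \<Rightarrow> 'g::ab_group_add \<Rightarrow> 'g"
    and br :: "'g \<Rightarrow> 'g \<Rightarrow> 'g"
    and H :: "'g set" and \<Delta> :: "('g \<Rightarrow> complex) set" and \<theta> :: "'g \<Rightarrow> complex"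
    and form :: "'g \<Rightarrow> 'g \<Rightarrow> complex"
    and lev h :: complex
    and u :: "'d::finite \<Rightarrow> 'g"
    and scaleV :: "complex \<Rightarrow> 'v::ab_group_add \<Rightarrow> 'v"
    and act :: "'g affine \<Rightarrow> 'v \<Rightarrow> 'v"
    and tens :: "'g affine list \<Rightarrow> complex \<Rightarrow> 'v"
    and vac \<omega> :: 'v
    and Y :: "'v \<Rightarrow> int \<Rightarrow> 'v \<Rightarrow> 'v"
    and L :: "int \<Rightarrow> 'v \<Rightarrow> 'v"
    and \<rho> :: "('g \<Rightarrow> 'g) \<Rightarrow> 'v \<Rightarrow> 'v"
    and G :: "('g \<Rightarrow> 'g) set"
    and KerL1V2 :: "'v set"
  assumes "simple_lie_algebra scaleG br"
    and "lie_algebra.cartan_subalgebra scaleG br H"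
    and "lie_algebra.root_base scaleG br H \<Delta>"
    and "lie_algebra.highest_root scaleG br H \<Delta> \<theta>"
    and "lie_algebra.normalized_killing_form scaleG br H \<theta> form"
    and "h = lie_algebra.dual_coxeter_number scaleG br H \<Delta> \<theta>"
    and "lev \<noteq> - h"
    and "lie_algebra.orthonormal_basis scaleG form u"
    and "universal_affine_module scaleG br form lev scaleV act tens"
    and "vac = tens [] 1"
    and "vertex_algebra scaleV vac Y"
    and "\<And>a n v. Y (act (mode a (- 1)) vac) n v = act (mode a n) v"
    and "\<omega> = conformal_vector scaleV act vac u lev h"
    and "L = virasoro_mode Y \<omega>"
    and "KerL1V2 = {v. L 1 v = 0} \<inter> {v. L 0 v = scaleV 2 v}"
    and "G = lie_algebra.adjoint_group scaleG br"
    and "acts_on_monomials G scaleV act vac \<rho>"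
  shows "(\<forall>\<omega>'\<in>KerL1V2. \<exists>!A :: complex ^ 'd ^ 'd. transpose A = A \<and>
            \<omega>' = (\<Sum>i\<in>UNIV. \<Sum>j\<in>UNIV.
                    scaleV (A $ i $ j) (act (mode (u i) (- 1)) (act (mode (u j) (- 1)) vac))))
       \<and> isomorphic_modules G scaleV \<rho> KerL1V2
            function_scale quadratic_action (quadratic_forms scaleG)"


proof -
  interpret N: normalized_lie_algebra scaleG br H \<Delta> \<theta> form u
    using assms(1-5,8) by (simp add: normalized_lie_algebra_def normalized_lie_algebra_axioms_def)
  interpret U: universal_affine_vertex_algebra scaleG br form lev scaleV act tens h u Y
  proof unfold_locales
    show "universal_affine_module scaleG br form lev scaleV act tens" by fact
    show "lev + h \<noteq> 0" using assms(7) by (simp add: eq_neg_iff_add_eq_0)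
    show "(\<Sum>i\<in>UNIV. br (br a (u i)) (u i)) = scaleG (2 * h) a" for a
      unfolding assms(6) by (rule N.casimir_on_adjoint)
    show "form (u i) (u j) = (if i = j then 1 else 0)" for i j by (rule N.form_basis)
    show "a = (\<Sum>i\<in>UNIV. scaleG (form a (u i)) (u i))" for a by (rule N.basis_expansion)
    show "vertex_algebra scaleV (tens [] 1) Y" using assms(10,11) by simp
    show "Y (act (mode a (- 1)) (tens [] 1)) n v = act (mode a n) v" for a n v
      using assms(10,12) by simp
  qed
  have K: "KerL1V2 = {v. U.L 1 v = 0} \<inter> {v. U.L 0 v = scaleV 2 v}"
    using assms(10,13-15) by simp
  \<comment> \<open>The identity component is contained in the whole automorphism group.\<close>
  have G: "Vector_Spaces.linear scaleG scaleG \<sigma> \<and> bij \<sigma>" if "\<sigma> \<in> G" for \<sigma>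
  proof -
    have "\<sigma> \<in> topspace (subtopology N.zariski_topology N.lie_automorphisms)"
      using that assms(16) connected_component_of_subset_topspace
      unfolding N.adjoint_group_def by fast
    then show ?thesis by (simp add: N.lie_automorphisms_def)
  qed
  have "\<exists>!A. transpose A = A \<and> \<omega>' = U.quadratic_vector A" if mem: "\<omega>' \<in> KerL1V2" for \<omega>'
  proof -
    obtain A where "transpose A = A" "\<omega>' = U.quadratic_vector A"
      using mem unfolding K U.quasi_primary_weight_2 by blast
    then show ?thesis using inj_onD[OF U.quadratic_vector_inj] by (intro ex1I[of _ A]) auto
  qed
  moreover have "isomorphic_modules G scaleV \<rho> KerL1V2 function_scale quadratic_action (quadratic_forms scaleG)"
    unfolding K
    by (rule U.quasi_primary_isomorphic_quadratic_forms[OF _ G]) (use assms(10,17) in simp_all)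
  ultimately show ?thesis unfolding U.quadratic_vector_def assms(10) by blast
qed

end
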